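(* Let $s_i=2l_i\in\mathbb Z_{\ge0}$ ($i=1,2$) and consider the operator $\mathbf R=Q\,\mathcal R_{>0}\,\mathcal R_0\,\mathcal R_{<0}$ on $W_{s_1}(\lambda_1)\otimes W_{s_2}(\lambda_2)$, with basis $e^{l_1}_{m_1,\epsilon_1}\otimes e^{l_2}_{m_2,\epsilon_2}$, where $\epsilon_i\in\{0,1\}$ denotes parity. Its factors are as follows (as formal power series in $\lambda_1/\lambda_2$). (1) The matrix coefficient $\langle e^{l_1}_{m_1',\epsilon_1'}\otimes e^{l_2}_{m_2',\epsilon_2'}|\mathcal R_{>0}|e^{l_1}_{m_1,\epsilon_1}\otimes e^{l_2}_{m_2,\epsilon_2}\rangle$ is $0$ if $m_1'-m_1\ne m_2-m_2'$ or $m_1'-m_1=m_2-m_2'<0$. Otherwise, with $n=m_1'-m_1$ and $\epsilon_i'\equiv\epsilon_i+n \pmod 2$, it equals $$\frac{(-1)^{n(\epsilon_1+\epsilon_2-1)}(q_*-q_*^{-1})^n(\lambda_1\lambda_2)^n}{\prod_{k=1}^n(\lambda_2^2-q_*^{2m_2-2m_1-2k}\lambda_1^2)}\cdot\frac{[l_1-m_1]_{q_*}!}{\lfloor n\rfloor_{q_*}!\,[l_1-m_1-n]_{q_*}!}\cdot\frac{[l_2+m_2]_{q_*}!}{[l_2+m_2-n]_{q_*}!}.$$ (2) The matrix coefficient $\langle e^{l_1}_{m_1',\epsilon_1'}\otimes e^{l_2}_{m_2',\epsilon_2'}|\mathcal R_{<0}|e^{l_1}_{m_1,\epsilon_1}\otimes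 e^{l_2}_{m_2,\epsilon_2}\rangle$ is $0$ if $m_1'-m_1\ne m_2-m_2'$ or $m_1'-m_1=m_2-m_2'>0$. Otherwise, with $n=m_1-m_1'$ and $\epsilon_i'\equiv\epsilon_i+n\pmod 2$, it equals $$\frac{(-1)^{n(\epsilon_1+\epsilon_2-1)}(q_*-q_*^{-1})^n(\lambda_1\lambda_2)^n}{\prod_{k=1}^n(\lambda_2^2-q_*^{2m_2-2m_1+2(k+n-1)}\lambda_1^2)}\cdot\frac{[l_1+m_1]_{q_*}!}{\lfloor n\rfloor_{q_*}!\,[l_1+m_1-n]_{q_*}!}\cdot\frac{[l_2-m_2]_{q_*}!}{[l_2-m_2-n]_{q_*}!}.$$ (3) $\mathcal R_0$ is diagonal, acting on $e^{l_1}_{m_1,\epsilon_1}\otimes e^{l_2}_{m_2,\epsilon_2}$ by the scalar $$f_q\cdot\prod_{k=1}^{l_1+m_1}\frac{\lambda_2^2-\lambda_1^2q_*^{2l_1+2l_2-2k+2}}{\lambda_2^2-\lambda_1^2q_*^{2m_2-2m_1+2k}}\ \prod_{k=1}^{l_2+m_2}\frac{\lambda_2^2-\lambda_1^2q_*^{2m_2-2m_1-2k}}{\lambda_2^2-\lambda_1^2q_*^{-2l_1-2l_2+2k-2}},$$ where $$f_q=\exp\Big(\sum_{n>0}\frac1n\Big(\frac{\lambda_1}{\lambda_2}\Big)^{2n}\frac{(q_*^{2l_1n}-q_*^{-2l_1n})(q_*^{2l_2n}-q_*^{-2l_2n})}{q_*^{2n}-q_*^{-2n}}\Big)=\exp\Big(\sum_{n>0}\frac1n\Big(\frac{\lambda_1}{\lambda_2}\Big)^{2n}[2l_1]_{q_*^n}[2l_2]_{q_*^n}\frac{q_*^n-q_*^{-n}}{q_*^n+q_*^{-n}}\Big).$$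 (4) $Q(e^{l_1}_{m_1,\epsilon_1}\otimes e^{l_2}_{m_2,\epsilon_2})=(-1)^{\epsilon_1\epsilon_2}q_*^{2m_1m_2}\,e^{l_1}_{m_1,\epsilon_1}\otimes e^{l_2}_{m_2,\epsilon_2}$.
   Context: $q=e^{\pi i b^2}$, $q_*:=-iq=e^{\pi i b_*^2}$, $b_*^2=b^2-\frac12$, $q^x=e^{\pi ib^2x}$, $q_*^x=e^{\pi i b_*^2x}$; $q_*$ is not a root of unity. $[n]_p=\frac{p^n-p^{-n}}{p-p^{-1}}$, $[n]_p!=\prod_{k=1}^n[k]_p$; $\lfloor n\rfloor_{q_*}=\frac{1-q_*^{-2n}}{1-q_*^{-2}}$, $\lfloor n\rfloor_{q_*}!=\prod_{k=1}^n\lfloor k\rfloor_{q_*}$; $\exp_p(x)=\sum_{n\ge0}x^n/\lceil n\rceil_p!$ with $\lceil n\rceil_p=\frac{1-p^n}{1-p}$. $U_q(C^{(2)}(2))$ is the superalgebra with odd generators $\mathcal E_i,\mathcal F_i$ and even invertible $\mathcal K_i$, $i=0,1$, with $\mathcal K_i\mathcal E_j=q^{a_{ij}}\mathcal E_j\mathcal K_i$, $\mathcal K_i\mathcal F_j=q^{-a_{ij}}\mathcal F_j\mathcal K_i$, $(a_{ij})=\begin{pmatrix}2&-2\\-2&2\end{pmatrix}$, $\mathcal E_i\mathcal F_j+\mathcal F_j\mathcal E_i=\delta_{ij}\frac{\mathcal K_i-\mathcal K_i^{-1}}{q+q^{-1}}$ and Serre relations. Evaluation module $W_s(\lambda)$,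 $s=2l$, $\lambda\ne0$: basis $e^l_{m,\pm}$, $m=-l,\dots,l$, with $e^l_{m,+}$ even and $e^l_{m,-}$ odd (also written $e^l_{m,\epsilon}$ with $\pm=(-1)^\epsilon$), and $\mathcal E_1e^l_{m,\pm}=\lambda[l-m]_{q_*}e^l_{m+1,\mp}$, $\mathcal E_0e^l_{m,\pm}=\lambda[l+m]_{q_*}e^l_{m-1,\mp}$, $\mathcal F_1e^l_{m,\pm}=\mp i\lambda^{-1}[l+m]_{q_*}e^l_{m-1,\mp}$, $\mathcal F_0e^l_{m,\pm}=\mp i\lambda^{-1}[l-m]_{q_*}e^l_{m+1,\mp}$, $\mathcal K_1e^l_{m,\pm}=\pm q_*^{2m}e^l_{m,\pm}$, $\mathcal K_0e^l_{m,\pm}=\pm q_*^{-2m}e^l_{m,\pm}$. It is the direct sum of $W_s^+(\lambda)$ and $W_s^-(\lambda)$, where $W_s^{\pm}(\lambda)$ is spanned by $e^l_{m,\pm(-1)^{l-m}}$. $\langle\cdot|\cdot|\cdot\rangle$ denotes matrix coefficients in the given basis. Tensor products are super tensor products: $(A\otimes B)(v\otimes w)=(-1)^{|B||v|}Av\otimes Bw$. Root vectors. $\mathcal E_\alpha=\mathcal E_1$, $\mathcal E_{\delta-\alpha}=\mathcal E_0$, $\mathcal F_\alpha=\mathcal F_1$, $\mathcal F_{\delta-\alpha}=\mathcal F_0$; $\mathcal E_\delta=\mathcal E_1\mathcal E_0+q^{-2}\mathcal E_0\mathcal E_1$, $\mathcal F_\delta=\mathcal F_0\mathcal F_1+q^2\mathcal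 F_1\mathcal F_0$; for $n\ge1$ (ordinary commutators) $\mathcal E_{n\delta+\alpha}=\frac{1}{q-q^{-1}}[\mathcal E_{(n-1)\delta+\alpha},\mathcal E_\delta]$, $\mathcal F_{n\delta+\alpha}=\frac1{q-q^{-1}}[\mathcal F_\delta,\mathcal F_{(n-1)\delta+\alpha}]$, $\mathcal E_{(n+1)\delta-\alpha}=\frac1{q-q^{-1}}[\mathcal E_\delta,\mathcal E_{n\delta-\alpha}]$, $\mathcal F_{(n+1)\delta-\alpha}=\frac1{q-q^{-1}}[\mathcal F_{n\delta-\alpha},\mathcal F_\delta]$; $\mathcal E'_{n\delta}=\mathcal E_\alpha\mathcal E_{n\delta-\alpha}+q^{-2}\mathcal E_{n\delta-\alpha}\mathcal E_\alpha$, $\mathcal F'_{n\delta}=\mathcal F_{n\delta-\alpha}\mathcal F_\alpha+q^2\mathcal F_\alpha\mathcal F_{n\delta-\alpha}$. The elements $\mathcal E_{n\delta},\mathcal F_{n\delta}$ are defined by the formal series identities $-(q+q^{-1})\sum_{n\ge1}\mathcal E_{n\delta}u^{-n}=\ln\big(1-(q+q^{-1})\sum_{n\ge1}\mathcal E'_{n\delta}u^{-n}\big)$ and $(q+q^{-1})\sum_{n\ge1}\mathcal F_{n\delta}u^{-n}=\ln\big(1+(q+q^{-1})\sum_{n\ge1}\mathcal F'_{n\delta}u^{-n}\big)$. Factors of $\mathbf R$ (the element on the left acts last): $\mathcal R_{>0}=\prod_{n\ge0}\exp_{-q^{-2}}\big((-1)^{n+1}(q+q^{-1})\mathcal E_{\alpha+n\delta}\otimes\mathcal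 F_{\alpha+n\delta}\big)$, ordered with $n$ increasing from left to right; $\mathcal R_{<0}=\prod_{n\ge0}\exp_{-q^{-2}}\big((-1)^{n+1}(q+q^{-1})\mathcal E_{\delta-\alpha+n\delta}\otimes\mathcal F_{\delta-\alpha+n\delta}\big)$, ordered with $n$ decreasing from left to right; $\mathcal R_0=\exp\Big(\sum_{n>0}\frac{n(q+q^{-1})^2}{q^{2n}-q^{-2n}}\mathcal E_{n\delta}\otimes\mathcal F_{n\delta}\Big)$; $Q=C\,q_*^{\frac{H_1\otimes H_1}{2}+H_\delta\otimes H_d+H_d\otimes H_\delta}$, where on evaluation modules $H_1e^l_{m,\pm}=2m\,e^l_{m,\pm}$ and $H_\delta=0$, and $C(e^{l_1}_{m_1,\epsilon_1}\otimes e^{l_2}_{m_2,\epsilon_2})=(-1)^{\epsilon_1\epsilon_2}e^{l_1}_{m_1,\epsilon_1}\otimes e^{l_2}_{m_2,\epsilon_2}$. *)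

theory Defs
  imports Complex_Main "HOL-Computational_Algebra.Formal_Laurent_Series"
begin

section \<open>Powers of \<open>q\<close> and \<open>q\<^sub>*\<close>, and \<open>q\<close>-numbers\<close>

definition q_pow :: "complex \<Rightarrow> real \<Rightarrow> complex" where
  "q_pow b x = exp (complex_of_real pi * \<i> * b\<^sup>2 * complex_of_real x)"

definition bstar2 :: "complex \<Rightarrow> complex" where
  "bstar2 b = b\<^sup>2 - 1 / 2"

definition qs_pow :: "complex \<Rightarrow> real \<Rightarrow> complex" where
  "qs_pow b x = exp (complex_of_real pi * \<i> * bstar2 b * complex_of_real x)"

abbreviation qq :: "complex \<Rightarrow> complex" where "qq b \<equiv> q_pow b 1"
abbreviation qs :: "complex \<Rightarrow> complex" where "qs b \<equiv> qs_pow b 1"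

definition q_num :: "complex \<Rightarrow> int \<Rightarrow> complex" where
  "q_num p n = (p powi n - p powi (- n)) / (p - inverse p)"

definition q_fact :: "complex \<Rightarrow> nat \<Rightarrow> complex" where
  "q_fact p n = (\<Prod>k=1..n. q_num p (int k))"

definition floor_num :: "complex \<Rightarrow> int \<Rightarrow> complex" where
  "floor_num p n = (1 - p powi (- 2 * n)) / (1 - p powi (- 2))"

definition floor_fact :: "complex \<Rightarrow> nat \<Rightarrow> complex" where
  "floor_fact p n = (\<Prod>k=1..n. floor_num p (int k))"

definition ceil_num :: "complex \<Rightarrow> int \<Rightarrow> complex" where
  "ceil_num p n = (1 - p powi n) / (1 - p)"

definition ceil_fact :: "complex \<Rightarrow> nat \<Rightarrow> complex" where
  "ceil_fact p n = (\<Prod>k=1..n. ceil_num p (int k))"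


section \<open>Operators given by their matrix coefficients\<close>

text \<open>
  An operator on the free module with basis indexed by a finite set \<open>I\<close> is given by its matrix
  coefficients: \<open>A i j\<close> is \<open>\<langle>i|A|j\<rangle>\<close>, the coefficient of the basis vector \<open>i\<close> in the
  image of the basis vector \<open>j\<close>.  Only the coefficients with \<open>i, j \<in> I\<close> are meaningful.
\<close>

type_synonym ('i, 'a) oper = "'i \<Rightarrow> 'i \<Rightarrow> 'a"

definition zero_op :: "('i, 'a::zero) oper" where
  "zero_op = (\<lambda>i j. 0)"

definition one_op :: "('i, 'a::zero_neq_one) oper" where
  "one_op = (\<lambda>i j. of_bool (i = j))"

definition add_op :: "('i, 'a::plus) oper \<Rightarrow> ('i, 'a) oper \<Rightarrow> ('i, 'a) oper" where
  "add_op A B = (\<lambda>i j. A i j + B i j)"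

definition diff_op :: "('i, 'a::minus) oper \<Rightarrow> ('i, 'a) oper \<Rightarrow> ('i, 'a) oper" where
  "diff_op A B = (\<lambda>i j. A i j - B i j)"

definition scale_op :: "'a::times \<Rightarrow> ('i, 'a) oper \<Rightarrow> ('i, 'a) oper" where
  "scale_op c A = (\<lambda>i j. c * A i j)"

definition mult_op :: "'i set \<Rightarrow> ('i, 'a::semiring_0) oper \<Rightarrow> ('i, 'a) oper \<Rightarrow> ('i, 'a) oper" where
  "mult_op I A B = (\<lambda>i j. \<Sum>k\<in>I. A i k * B k j)"

primrec pow_op :: "'i set \<Rightarrow> ('i, 'a::field) oper \<Rightarrow> nat \<Rightarrow> ('i, 'a) oper" where
  "pow_op I A 0 = one_op"
| "pow_op I A (Suc n) = mult_op I A (pow_op I A n)"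

definition comm_op :: "'i set \<Rightarrow> ('i, 'a::ring) oper \<Rightarrow> ('i, 'a) oper \<Rightarrow> ('i, 'a) oper" where
  "comm_op I A B = diff_op (mult_op I A B) (mult_op I B A)"

text \<open>
  The exponential series, taken coefficientwise in the topology of the scalars: this is the usual
  one for complex matrices, and the formal (\<open>z\<close>-adic) one for matrices of Laurent series.
\<close>

definition exp_op ::
    "'i set \<Rightarrow> ('i, 'a::{field_char_0, topological_space}) oper \<Rightarrow> ('i, 'a) oper" where
  "exp_op I A = (\<lambda>i j. \<Sum>n. pow_op I A n i j / fact n)"


section \<open>Formal series in \<open>u\<^sup>-\<^sup>1\<close> with operator coefficients\<close>

text \<open>A series \<open>X\<close> stands for \<open>\<Sum>n. X n * u^(-n)\<close>.\<close>

primrec series_pow ::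
    "'i set \<Rightarrow> (nat \<Rightarrow> ('i, 'a::field) oper) \<Rightarrow> nat \<Rightarrow> nat \<Rightarrow> ('i, 'a) oper" where
  "series_pow I X 0 = (\<lambda>n. if n = 0 then one_op else zero_op)"
| "series_pow I X (Suc k) =
     (\<lambda>n i j. \<Sum>r\<le>n. mult_op I (X r) (series_pow I X k (n - r)) i j)"

text \<open>
  Coefficient of \<open>u^(-n)\<close> in \<open>ln (1 + X)\<close>, for a series \<open>X\<close> without constant term; the powers
  \<open>X^k\<close> with \<open>k > n\<close> do not contribute to it.
\<close>

definition series_ln1p ::
    "'i set \<Rightarrow> (nat \<Rightarrow> ('i, 'a::field) oper) \<Rightarrow> nat \<Rightarrow> ('i, 'a) oper" where
  "series_ln1p I X n = (\<lambda>i j. \<Sum>k=1..n. (- 1) ^ (k + 1) / of_nat k * series_pow I X k n i j)"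


section \<open>Root vectors\<close>

text \<open>
  The scalars are the formal Laurent series \<open>\<complex>((z))\<close>, the formal variable \<open>z\<close> playing the role
  of \<open>\<lambda>\<^sub>1 / \<lambda>\<^sub>2\<close>.  The root vectors are noncommutative polynomials in
  \<open>\<E>\<^sub>0, \<E>\<^sub>1\<close> (respectively \<open>\<F>\<^sub>0, \<F>\<^sub>1\<close>); below they are formed from operators
  \<open>E0, E1, F0, F1\<close> by which these generators act.
\<close>

type_synonym laurent = "complex fls"

definition E_delta ::
    "complex \<Rightarrow> 'i set \<Rightarrow> ('i, laurent) oper \<Rightarrow> ('i, laurent) oper \<Rightarrow> ('i, laurent) oper" where
  "E_delta b I E0 E1 =
     add_op (mult_op I E1 E0) (scale_op (fls_const (q_pow b (- 2))) (mult_op I E0 E1))"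

definition F_delta ::
    "complex \<Rightarrow> 'i set \<Rightarrow> ('i, laurent) oper \<Rightarrow> ('i, laurent) oper \<Rightarrow> ('i, laurent) oper" where
  "F_delta b I F0 F1 =
     add_op (mult_op I F0 F1) (scale_op (fls_const (q_pow b 2)) (mult_op I F1 F0))"

text \<open>\<open>E_plus \<dots> n\<close> is \<open>\<E>\<close> for the root \<open>n\<delta> + \<alpha>\<close>; \<open>E_minus \<dots> n\<close> is \<open>\<E>\<close> for the root
  \<open>(n + 1)\<delta> - \<alpha>\<close>; similarly for \<open>\<F>\<close>.\<close>

primrec E_plus :: "complex \<Rightarrow> 'i set \<Rightarrow> ('i, laurent) oper \<Rightarrow> ('i, laurent) oper \<Rightarrow>
    nat \<Rightarrow> ('i, laurent) oper" where
  "E_plus b I E0 E1 0 = E1"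
| "E_plus b I E0 E1 (Suc n) = scale_op (fls_const (1 / (qq b - inverse (qq b))))
     (comm_op I (E_plus b I E0 E1 n) (E_delta b I E0 E1))"

primrec F_plus :: "complex \<Rightarrow> 'i set \<Rightarrow> ('i, laurent) oper \<Rightarrow> ('i, laurent) oper \<Rightarrow>
    nat \<Rightarrow> ('i, laurent) oper" where
  "F_plus b I F0 F1 0 = F1"
| "F_plus b I F0 F1 (Suc n) = scale_op (fls_const (1 / (qq b - inverse (qq b))))
     (comm_op I (F_delta b I F0 F1) (F_plus b I F0 F1 n))"

primrec E_minus :: "complex \<Rightarrow> 'i set \<Rightarrow> ('i, laurent) oper \<Rightarrow> ('i, laurent) oper \<Rightarrow>
    nat \<Rightarrow> ('i, laurent) oper" where
  "E_minus b I E0 E1 0 = E0"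
| "E_minus b I E0 E1 (Suc n) = scale_op (fls_const (1 / (qq b - inverse (qq b))))
     (comm_op I (E_delta b I E0 E1) (E_minus b I E0 E1 n))"

primrec F_minus :: "complex \<Rightarrow> 'i set \<Rightarrow> ('i, laurent) oper \<Rightarrow> ('i, laurent) oper \<Rightarrow>
    nat \<Rightarrow> ('i, laurent) oper" where
  "F_minus b I F0 F1 0 = F0"
| "F_minus b I F0 F1 (Suc n) = scale_op (fls_const (1 / (qq b - inverse (qq b))))
     (comm_op I (F_minus b I F0 F1 n) (F_delta b I F0 F1))"

text \<open>The primed imaginary root vectors, for \<open>n \<ge> 1\<close>; the value at \<open>0\<close> is set to zero, so that
  they are the coefficients of a series without constant term.\<close>

definition E_imag' :: "complex \<Rightarrow> 'i set \<Rightarrow> ('i, laurent) oper \<Rightarrow> ('i, laurent) oper \<Rightarrow>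
    nat \<Rightarrow> ('i, laurent) oper" where
  "E_imag' b I E0 E1 n =
     (if n = 0 then zero_op
      else add_op (mult_op I E1 (E_minus b I E0 E1 (n - 1)))
        (scale_op (fls_const (q_pow b (- 2))) (mult_op I (E_minus b I E0 E1 (n - 1)) E1)))"

definition F_imag' :: "complex \<Rightarrow> 'i set \<Rightarrow> ('i, laurent) oper \<Rightarrow> ('i, laurent) oper \<Rightarrow>
    nat \<Rightarrow> ('i, laurent) oper" where
  "F_imag' b I F0 F1 n =
     (if n = 0 then zero_op
      else add_op (mult_op I (F_minus b I F0 F1 (n - 1)) F1)
        (scale_op (fls_const (q_pow b 2)) (mult_op I F1 (F_minus b I F0 F1 (n - 1)))))"

text \<open>The generating series identities
    \<open>-(q + q\<inverse>) \<Sum> E n u^(-n) = ln (1 - (q + q\<inverse>) \<Sum> E' n u^(-n))\<close> and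
    \<open>(q + q\<inverse>) \<Sum> F n u^(-n) = ln (1 + (q + q\<inverse>) \<Sum> F' n u^(-n))\<close>,
  solved for \<open>E n\<close> and \<open>F n\<close>.\<close>

definition E_imag :: "complex \<Rightarrow> 'i set \<Rightarrow> ('i, laurent) oper \<Rightarrow> ('i, laurent) oper \<Rightarrow>
    nat \<Rightarrow> ('i, laurent) oper" where
  "E_imag b I E0 E1 n =
     scale_op (fls_const (- 1 / (qq b + inverse (qq b))))
       (series_ln1p I
         (\<lambda>r. scale_op (fls_const (- (qq b + inverse (qq b)))) (E_imag' b I E0 E1 r)) n)"

definition F_imag :: "complex \<Rightarrow> 'i set \<Rightarrow> ('i, laurent) oper \<Rightarrow> ('i, laurent) oper \<Rightarrow>
    nat \<Rightarrow> ('i, laurent) oper" where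
  "F_imag b I F0 F1 n =
     scale_op (fls_const (1 / (qq b + inverse (qq b))))
       (series_ln1p I
         (\<lambda>r. scale_op (fls_const (qq b + inverse (qq b))) (F_imag' b I F0 F1 r)) n)"


section \<open>Evaluation modules\<close>

text \<open>The pair \<open>(m, e)\<close> labels the basis vector \<open>e\<^sup>l\<close> with weight \<open>m\<close> and parity
  \<open>e \<in> {0, 1}\<close>; the sign \<open>\<plusminus>\<close> of the usual notation is \<open>(- 1) ^ e\<close>.\<close>

type_synonym label = "real \<times> nat"

definition weights :: "real \<Rightarrow> real set" where
  "weights l = {m. \<exists>j::nat. m = - l + real j \<and> m \<le> l}"

definition basis :: "real \<Rightarrow> label set" where
  "basis l = weights l \<times> {0, 1}"

definition E1_ev :: "complex \<Rightarrow> real \<Rightarrow> laurent \<Rightarrow> (label, laurent) oper" where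
  "E1_ev b l lam = (\<lambda>(m', e') (m, e).
     if m' = m + 1 \<and> e' = 1 - e then lam * fls_const (q_num (qs b) \<lfloor>l - m\<rfloor>) else 0)"

definition E0_ev :: "complex \<Rightarrow> real \<Rightarrow> laurent \<Rightarrow> (label, laurent) oper" where
  "E0_ev b l lam = (\<lambda>(m', e') (m, e).
     if m' = m - 1 \<and> e' = 1 - e then lam * fls_const (q_num (qs b) \<lfloor>l + m\<rfloor>) else 0)"

definition F1_ev :: "complex \<Rightarrow> real \<Rightarrow> laurent \<Rightarrow> (label, laurent) oper" where
  "F1_ev b l lam = (\<lambda>(m', e') (m, e).
     if m' = m - 1 \<and> e' = 1 - e
     then fls_const (- ((- 1) ^ e) * \<i>) * inverse lam * fls_const (q_num (qs b) \<lfloor>l + m\<rfloor>) else 0)"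

definition F0_ev :: "complex \<Rightarrow> real \<Rightarrow> laurent \<Rightarrow> (label, laurent) oper" where
  "F0_ev b l lam = (\<lambda>(m', e') (m, e).
     if m' = m + 1 \<and> e' = 1 - e
     then fls_const (- ((- 1) ^ e) * \<i>) * inverse lam * fls_const (q_num (qs b) \<lfloor>l - m\<rfloor>) else 0)"

definition H1_ev :: "(label, complex) oper" where
  "H1_ev = (\<lambda>(m', e') (m, e). if m' = m \<and> e' = e then 2 * complex_of_real m else 0)"

definition Hdelta_ev :: "(label, complex) oper" where
  "Hdelta_ev = zero_op"


section \<open>The factors of the R-matrix\<close>

text \<open>
  Super tensor product \<open>(A \<otimes> B) (v \<otimes> w) = (- 1) ^ (|B| |v|) (A v \<otimes> B w)\<close>: the coefficient of
  \<open>B\<close> between basis vectors of parities \<open>f\<close> and \<open>f'\<close> belongs to the component of \<open>B\<close> of parity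
  \<open>f + f'\<close>.
\<close>

definition stensor ::
    "(label, 'a::comm_ring_1) oper \<Rightarrow> (label, 'a) oper \<Rightarrow> (label \<times> label, 'a) oper" where
  "stensor A B = (\<lambda>((m', e'), (n', f')) ((m, e), (n, f)).
     (- 1) ^ ((f' + f) * e) * A (m', e') (m, e) * B (n', f') (n, f))"

definition qexp_op :: "'i set \<Rightarrow> complex \<Rightarrow> ('i, laurent) oper \<Rightarrow> ('i, laurent) oper" where
  "qexp_op I p A = (\<lambda>i j. \<Sum>n. pow_op I A n i j / fls_const (ceil_fact p n))"

definition R_pos_factor ::
    "complex \<Rightarrow> real \<Rightarrow> real \<Rightarrow> laurent \<Rightarrow> laurent \<Rightarrow> nat \<Rightarrow> (label \<times> label, laurent) oper" where
  "R_pos_factor b l1 l2 lam1 lam2 n =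
     qexp_op (basis l1 \<times> basis l2) (- q_pow b (- 2))
       (scale_op (fls_const ((- 1) ^ (n + 1) * (qq b + inverse (qq b))))
         (stensor (E_plus b (basis l1) (E0_ev b l1 lam1) (E1_ev b l1 lam1) n)
                  (F_plus b (basis l2) (F0_ev b l2 lam2) (F1_ev b l2 lam2) n)))"

definition R_neg_factor ::
    "complex \<Rightarrow> real \<Rightarrow> real \<Rightarrow> laurent \<Rightarrow> laurent \<Rightarrow> nat \<Rightarrow> (label \<times> label, laurent) oper" where
  "R_neg_factor b l1 l2 lam1 lam2 n =
     qexp_op (basis l1 \<times> basis l2) (- q_pow b (- 2))
       (scale_op (fls_const ((- 1) ^ (n + 1) * (qq b + inverse (qq b))))
         (stensor (E_minus b (basis l1) (E0_ev b l1 lam1) (E1_ev b l1 lam1) n)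
                  (F_minus b (basis l2) (F0_ev b l2 lam2) (F1_ev b l2 lam2) n)))"

text \<open>Partial products of the first \<open>N\<close> factors, with the index increasing from left to right for
  \<open>R_pos\<close> and decreasing from left to right for \<open>R_neg\<close>.\<close>

primrec R_pos_upto ::
    "complex \<Rightarrow> real \<Rightarrow> real \<Rightarrow> laurent \<Rightarrow> laurent \<Rightarrow> nat \<Rightarrow> (label \<times> label, laurent) oper" where
  "R_pos_upto b l1 l2 lam1 lam2 0 = one_op"
| "R_pos_upto b l1 l2 lam1 lam2 (Suc N) =
     mult_op (basis l1 \<times> basis l2)
       (R_pos_upto b l1 l2 lam1 lam2 N) (R_pos_factor b l1 l2 lam1 lam2 N)"

primrec R_neg_upto ::
    "complex \<Rightarrow> real \<Rightarrow> real \<Rightarrow> laurent \<Rightarrow> laurent \<Rightarrow> nat \<Rightarrow> (label \<times> label, laurent) oper" where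
  "R_neg_upto b l1 l2 lam1 lam2 0 = one_op"
| "R_neg_upto b l1 l2 lam1 lam2 (Suc N) =
     mult_op (basis l1 \<times> basis l2)
       (R_neg_factor b l1 l2 lam1 lam2 N) (R_neg_upto b l1 l2 lam1 lam2 N)"

definition R_pos ::
    "complex \<Rightarrow> real \<Rightarrow> real \<Rightarrow> laurent \<Rightarrow> laurent \<Rightarrow> (label \<times> label, laurent) oper" where
  "R_pos b l1 l2 lam1 lam2 = (\<lambda>i j. lim (\<lambda>N. R_pos_upto b l1 l2 lam1 lam2 N i j))"

definition R_neg ::
    "complex \<Rightarrow> real \<Rightarrow> real \<Rightarrow> laurent \<Rightarrow> laurent \<Rightarrow> (label \<times> label, laurent) oper" where
  "R_neg b l1 l2 lam1 lam2 = (\<lambda>i j. lim (\<lambda>N. R_neg_upto b l1 l2 lam1 lam2 N i j))"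

definition sum_pos :: "(nat \<Rightarrow> 'a::{comm_monoid_add, topological_space}) \<Rightarrow> 'a" where
  "sum_pos g = (\<Sum>n. g (Suc n))"

definition R_zero ::
    "complex \<Rightarrow> real \<Rightarrow> real \<Rightarrow> laurent \<Rightarrow> laurent \<Rightarrow> (label \<times> label, laurent) oper" where
  "R_zero b l1 l2 lam1 lam2 =
     exp_op (basis l1 \<times> basis l2)
       (\<lambda>i j. sum_pos (\<lambda>n.
          fls_const (of_nat n * (qq b + inverse (qq b))\<^sup>2
            / (q_pow b (2 * real n) - q_pow b (- 2 * real n)))
          * stensor (E_imag b (basis l1) (E0_ev b l1 lam1) (E1_ev b l1 lam1) n)
                    (F_imag b (basis l2) (F0_ev b l2 lam2) (F1_ev b l2 lam2) n) i j))"

definition C_op :: "(label \<times> label, complex) oper" where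
  "C_op = (\<lambda>i ((m, e), (n, f)). if i = ((m, e), (n, f)) then (- 1) ^ (e * f) else 0)"

text \<open>The operator \<open>q\<^sub>*^A\<close> for a complex matrix \<open>A\<close>.\<close>

definition qs_pow_op :: "complex \<Rightarrow> 'i set \<Rightarrow> ('i, complex) oper \<Rightarrow> ('i, complex) oper" where
  "qs_pow_op b I A = exp_op I (scale_op (complex_of_real pi * \<i> * bstar2 b) A)"

text \<open>
  \<open>Hd1\<close> and \<open>Hd2\<close> are the operators by which \<open>H\<^sub>d\<close> acts on the two tensor factors.  They are
  parameters because no action of \<open>H\<^sub>d\<close> is specified on evaluation modules; they enter only
  multiplied by the action of \<open>H\<^sub>\<delta>\<close>, which is zero.
\<close>

definition Q_op :: "complex \<Rightarrow> real \<Rightarrow> real \<Rightarrow> (label, complex) oper \<Rightarrow> (label, complex) oper \<Rightarrow>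
    (label \<times> label, laurent) oper" where
  "Q_op b l1 l2 Hd1 Hd2 = (\<lambda>i j. fls_const
     (mult_op (basis l1 \<times> basis l2) C_op
       (qs_pow_op b (basis l1 \<times> basis l2)
         (add_op (scale_op (1 / 2) (stensor H1_ev H1_ev))
           (add_op (stensor Hdelta_ev Hd2) (stensor Hd1 Hdelta_ev)))) i j))"

definition R_op :: "complex \<Rightarrow> real \<Rightarrow> real \<Rightarrow> (label, complex) oper \<Rightarrow> (label, complex) oper \<Rightarrow>
    laurent \<Rightarrow> laurent \<Rightarrow> (label \<times> label, laurent) oper" where
  "R_op b l1 l2 Hd1 Hd2 lam1 lam2 =
     (let I = basis l1 \<times> basis l2 in
      mult_op I (Q_op b l1 l2 Hd1 Hd2)
        (mult_op I (R_pos b l1 l2 lam1 lam2)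
          (mult_op I (R_zero b l1 l2 lam1 lam2) (R_neg b l1 l2 lam1 lam2))))"

definition exp_laurent :: "laurent \<Rightarrow> laurent" where
  "exp_laurent x = (\<Sum>k. x ^ k / fact k)"

end

theory Submission
  imports Defs
begin


text \<open>
  On evaluation modules all root vectors act by weighted shifts of the weight basis.  Put
  \<open>t = q\<^sub>*\<^sup>-\<^sup>2\<close> and \<open>z = \<lambda>\<^sub>1 / \<lambda>\<^sub>2\<close>.  The argument of the \<open>n\<close>-th factor of \<open>\<R>\<^sub>>\<^sub>0\<close> is \<open>T D\<^sup>n\<close>,
  where \<open>T\<close> is the argument of the factor \<open>n = 0\<close> and \<open>D\<close> is diagonal with entries
  \<open>x = z\<^sup>2 q\<^sub>*^(2m\<^sub>2 - 2m\<^sub>1 - 2)\<close>, so that \<open>D T = t\<^sup>2 T D\<close>.  The infinite product of the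
  \<open>exp\<^sub>t (T D\<^sup>n)\<close> is \<open>\<Sum>k. T\<^sup>k / (\<lceil>k\<rceil>\<^sub>t! (1 - D) \<dots> (1 - t\<^sup>k\<^sup>-\<^sup>1 D))\<close>: this series solves the functional equation
  obtained by splitting off the first factor, by a finite \<open>q\<close>-series identity of Cauchy.  The transpose of
  \<open>\<R>\<^sub><\<^sub>0\<close> is an ordered product of the same shape, for the same shift and the same \<open>x\<close>.

  The generating series of the primed imaginary root vectors, shifted by \<open>1\<close>, act by rational functions
  \<open>(1 - c\<^sub>1 v) (1 - c\<^sub>2 v) / ((1 - c\<^sub>3 v) (1 - c\<^sub>4 v))\<close>, so the imaginary root vectors act by differences of
  power sums.  The resulting exponent of \<open>\<R>\<^sub>0\<close> is that of \<open>f\<^sub>q\<close> plus finite geometric sums, which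
  exponentiate to the two products.
\<close>

section \<open>Orders and limits of Laurent series\<close>

text \<open>Root vectors stay explicit because the eigenvalue of \<open>E_delta\<close> on weight
  \<open>m\<close> depends on \<open>m\<close> through one exponential, \<open>q_*^(-2m)\<close>
  (for \<open>F_delta\<close>, \<open>q_*^(2m)\<close>). A commutator with a shift multiplies the
  shift by the difference of neighbouring eigenvalues, which is then a monomial; \<open>n\<close>
  commutators give an \<open>n\<close>-th power, and this is the source of \<open>D^n\<close>. The
  relation \<open>q = \<i> q_*\<close> governs all signs: \<open>-q^(-2)\<close> is
  \<open>t\<close>, and the powers of \<open>\<i>\<close> cancel against \<open>(-1)^(n+1)\<close>
  in the real root factors and against the sign of \<open>q^(2n) - q^(-2n)\<close> in
  \<open>\<R>\<^sub>0\<close>. Matrix products run over the finite basis only, so paths through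
  labels outside it must not matter: on one module the \<open>q\<close>-numbers vanish at the ends,
  and on the tensor product all labels between two basis labels are basis labels. Each entry of a
  single \<open>q\<close>-exponential is a finite sum. Convergence in \<open>z\<close> concerns only
  the product over \<open>n\<close>, where it comes from the factor \<open>z^2\<close> in
  \<open>x\<close>, and the exponent and exponential of \<open>\<R>\<^sub>0\<close>, where the
  exponent has no constant term.\<close>

definition ord_ge :: "int \<Rightarrow> 'a::zero fls \<Rightarrow> bool" where
  "ord_ge m f \<longleftrightarrow> (\<forall>n<m. fls_nth f n = 0)"

lemma ord_ge_0 [simp]: "ord_ge m 0"
  by (simp add: ord_ge_def)

lemma ord_ge_mono: "ord_ge m f \<Longrightarrow> m' \<le> m \<Longrightarrow> ord_ge m' f"
  by (auto simp: ord_ge_def)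

text \<open>\<open>fls_subdegree 0\<close> is \<open>0\<close>, so a bound on the subdegree fails
  for a difference that happens to vanish; the disjunct \<open>f = 0\<close> is why orders are
  expressed through \<open>ord_ge\<close>.\<close>

lemma ord_ge_iff: "ord_ge m f \<longleftrightarrow> f = 0 \<or> m \<le> fls_subdegree f"
  unfolding ord_ge_def
  by (metis fls_eq0_below_subdegree fls_zero_nth linorder_not_less nth_fls_subdegree_nonzero order_less_le_trans)

lemma ord_ge_const [simp]: "ord_ge 0 (fls_const c)"
  by (auto simp: ord_ge_def)

lemma ord_ge_1 [simp]: "ord_ge 0 (1 :: 'a::zero_neq_one fls)"
  by (auto simp: ord_ge_def)

lemma ord_ge_uminus: "ord_ge m (f :: 'a::group_add fls) \<Longrightarrow> ord_ge m (- f)"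
  by (simp add: ord_ge_def)

lemma ord_ge_diff: "ord_ge m (f :: 'a::group_add fls) \<Longrightarrow> ord_ge m g \<Longrightarrow> ord_ge m (f - g)"
  by (simp add: ord_ge_def)

lemma ord_ge_sum: "(\<And>i. i \<in> S \<Longrightarrow> ord_ge m (f i)) \<Longrightarrow> ord_ge m (\<Sum>i\<in>S. f i :: 'a::comm_monoid_add fls)"
  by (simp add: ord_ge_def fls_nth_sum)

lemma ord_ge_mult:
  fixes f g :: "'a::{comm_semiring_1, semiring_no_zero_divisors} fls"
  assumes "ord_ge m f" "ord_ge n g"
  shows "ord_ge (m + n) (f * g)"
proof (cases "f = 0 \<or> g = 0")
  case False
  thus ?thesis using assms by (simp add: ord_ge_iff)
qed auto

lemma ord_ge_mult':
  fixes f g :: "'a::{comm_semiring_1, semiring_no_zero_divisors} fls"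
  assumes "ord_ge m f" "ord_ge n g" "k \<le> m + n"
  shows "ord_ge k (f * g)"
  using ord_ge_mult ord_ge_mono assms by blast

lemma ord_ge_power:
  fixes f :: "'a::{comm_ring_1, semiring_no_zero_divisors} fls"
  assumes "ord_ge m f"
  shows "ord_ge (int n * m) (f ^ n)"
proof (induction n)
  case (Suc n)
  show ?case
    using ord_ge_mult[OF assms Suc] by (simp add: algebra_simps)
qed simp

lemma ord_ge_prod_0:
  fixes f :: "'i \<Rightarrow> 'a::{comm_ring_1, semiring_no_zero_divisors} fls"
  shows "(\<And>i. i \<in> S \<Longrightarrow> ord_ge 0 (f i)) \<Longrightarrow> ord_ge 0 (\<Prod>i\<in>S. f i)"
proof (induction S rule: infinite_finite_induct)
  case (insert x S)
  thus ?case using ord_ge_mult[of 0 "f x" 0 "prod f S"] by simp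
qed simp_all

lemma ord_ge_inverse_0:
  fixes f :: "'a::field fls"
  assumes "ord_ge 0 f" "fls_nth f 0 \<noteq> 0"
  shows "ord_ge 0 (inverse f)"
proof -
  have "f \<noteq> 0" "fls_subdegree f = 0"
    using assms by (auto simp: ord_ge_iff fls_subdegree_leI order_antisym)
  thus ?thesis by (simp add: ord_ge_iff)
qed

lemma ord_ge_fls_X_mult: "ord_ge 0 f \<Longrightarrow> ord_ge 1 (fls_X * f :: 'a::field fls)"
  by (rule ord_ge_mult'[of 1 _ 0]) (auto simp: ord_ge_iff)

text \<open>The metric turns agreement to order \<open>N\<close> into distance at most
  \<open>2^(-N)\<close>. The rate in the hypothesis suffices because every limit taken below gains
  at least one order per step.\<close>

lemma fls_tendstoI:
  fixes f :: "nat \<Rightarrow> 'a::group_add fls"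
  assumes "\<And>N. ord_ge (int N) (f N - L)"
  shows "f \<longlonglongrightarrow> L"
proof (rule metric_LIMSEQ_I)
  fix r :: real assume "r > 0"
  then obtain N where N: "inverse (2 ^ N) < r"
    using real_arch_pow_inv[of r "1/2"] by (auto simp: power_one_over inverse_eq_divide)
  have "dist (f n) L < r" if "n \<ge> N" for n
  proof (cases "f n = L")
    case False
    hence "int n \<le> fls_subdegree (f n - L)"
      using assms[of n] by (auto simp: ord_ge_iff)
    hence "n \<le> nat (fls_subdegree (f n - L))" "fls_subdegree (f n - L) \<ge> 0" by auto
    hence "dist (f n) L \<le> inverse (2 ^ N)"
      using that False by (simp add: dist_fls_def)
    thus ?thesis using N by simp
  qed (use \<open>r > 0\<close> in simp)
  thus "\<exists>N. \<forall>n\<ge>N. dist (f n) L < r" by blast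
qed

lemma fls_suminf_eqI:
  fixes f :: "nat \<Rightarrow> 'a::ab_group_add fls"
  assumes "\<And>N. ord_ge (int N) ((\<Sum>n<N. f n) - L)"
  shows "suminf f = L"
  using fls_tendstoI[OF assms] by (simp add: sums_def[symmetric] sums_iff)

text \<open>With zero constant term, \<open>f^k\<close> has no terms below degree \<open>k\<close>,
  so the first \<open>N\<close> terms of the exponential series already give all coefficients of the
  formal composition below \<open>N\<close>.\<close>

lemma exp_laurent_fps:
  assumes "fps_nth f 0 = 0"
  shows "exp_laurent (fps_to_fls f) = fps_to_fls (fps_compose (fps_exp 1) f)"
  unfolding exp_laurent_def
proof (rule fls_suminf_eqI, unfold ord_ge_def, intro allI impI)
  fix N :: nat and n :: int assume n: "n < int N"
  have fc: "fls_nth (fps_to_fls f ^ k / fact k) n = (if n < 0 then 0 else fps_nth (f ^ k) (nat n) / fact k)" for k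
  proof -
    have "fps_to_fls f ^ k / fact k = fls_const (1 / fact k) * fps_to_fls (f ^ k)"
    proof -
      have "(fact k :: laurent) = fls_const (fact k)" by (metis fls_of_nat of_nat_fact)
      thus ?thesis by (simp add: fps_to_fls_power divide_inverse fls_inverse_const)
    qed
    thus ?thesis by simp
  qed
  show "fls_nth ((\<Sum>k<N. fps_to_fls f ^ k / fact k) - fps_to_fls (fps_compose (fps_exp 1) f)) n = 0"
  proof (cases "n < 0")
    case True
    thus ?thesis by (simp add: fls_nth_sum fc)
  next
    case False
    have "(\<Sum>k<N. fps_nth (f ^ k) (nat n) / fact k) = (\<Sum>k=0..nat n. fps_nth (f ^ k) (nat n) / fact k)"
      by (rule sum.mono_neutral_right) (use n False startsby_zero_power_prefix[OF assms] in auto)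
    thus ?thesis using False by (simp add: fls_nth_sum fc fps_compose_nth)
  qed
qed

text \<open>The exponents of \<open>\<R>\<^sub>0\<close> and of \<open>f_q\<close> contain only even
  powers of the formal variable; this packs them into one power series, to which the formal
  exponential applies.\<close>

lemma sum_pos_even:
  fixes c :: "nat \<Rightarrow> 'a::field"
  shows "sum_pos (\<lambda>n. fls_const (c n) * fls_X ^ (2 * n)) =
    fps_to_fls (Abs_fps (\<lambda>k. if even k \<and> k > 0 then c (k div 2) else 0))"
  unfolding sum_pos_def
proof (rule fls_suminf_eqI, unfold ord_ge_def, intro allI impI)
  fix N :: nat and n :: int assume n: "n < int N"
  have "fls_nth (fls_const (c k) * fls_X ^ (2 * k)) n = (if n = 2 * int k then c k else 0)" for k
    by (simp add: fls_X_power_nth)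
  hence *: "fls_nth (\<Sum>k<N. fls_const (c (Suc k)) * fls_X ^ (2 * Suc k)) n =
     (\<Sum>k<N. if n = 2 * int (Suc k) then c (Suc k) else 0)"
    by (simp only: fls_nth_sum)
  show "fls_nth ((\<Sum>k<N. fls_const (c (Suc k)) * fls_X ^ (2 * Suc k)) -
      fps_to_fls (Abs_fps (\<lambda>k. if even k \<and> 0 < k then c (k div 2) else 0))) n = 0"
  proof (cases "n > 0 \<and> even n")
    case True
    then obtain k where k: "n = 2 * int (Suc k)"
      by (metis Suc_pred' evenE int_nat_eq less_imp_le zero_less_mult_pos zero_less_numeral zero_less_nat_eq)
    have "(\<Sum>j<N. if n = 2 * int (Suc j) then c (Suc j) else 0) = (\<Sum>j<N. if j = k then c (Suc k) else 0)"
      by (rule sum.cong) (auto simp: k)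
    also have "\<dots> = c (Suc k)" using n k by simp
    finally show ?thesis unfolding fls_minus_nth * by (simp add: k nat_add_distrib nat_mult_distrib)
  next
    case False
    hence "(\<Sum>k<N. if n = 2 * int (Suc k) then c (Suc k) else 0) = 0"
      by (intro sum.neutral) auto
    thus ?thesis unfolding fls_minus_nth *
      using False by (auto simp: even_nat_iff)
  qed
qed

section \<open>Exponentials of formal power series\<close>

abbreviation fps_Exp :: "'a::field_char_0 fps \<Rightarrow> 'a fps" where
  "fps_Exp f \<equiv> fps_compose (fps_exp 1) f"

lemma fps_deriv_Exp: "fps_nth f 0 = 0 \<Longrightarrow> fps_deriv (fps_Exp f) = fps_Exp f * fps_deriv f"
  by (simp add: fps_compose_deriv)

text \<open>Uniqueness for \<open>y' = y h'\<close> with \<open>y(0) = 1\<close>: the quotient of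
  two solutions has derivative zero. The exponentials of sums and of logarithms below are identified
  in this way.\<close>

lemma fps_Exp_eqI:
  fixes y h :: "'a::field_char_0 fps"
  assumes h: "fps_nth h 0 = 0" and y: "fps_nth y 0 = 1" and d: "fps_deriv y = y * fps_deriv h"
  shows "fps_Exp h = y"
proof -
  have nz: "fps_nth (fps_Exp h) 0 \<noteq> 0" by simp
  have "fps_deriv (y * inverse (fps_Exp h)) = 0"
    using inverse_mult_eq_1[OF nz] h nz
    by (simp add: fps_deriv_Exp d fps_inverse_deriv power2_eq_square algebra_simps)
  hence "y * inverse (fps_Exp h) = 1"
    by (subst (asm) fps_deriv_eq_0_iff) (simp add: y)
  hence "fps_Exp h = y * (inverse (fps_Exp h) * fps_Exp h)"
    by (simp only: mult.assoc[symmetric] mult_1_left)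
  thus ?thesis by (simp only: inverse_mult_eq_1[OF nz] mult_1_right)
qed

lemma fps_Exp_add:
  fixes f g :: "'a::field_char_0 fps"
  assumes "fps_nth f 0 = 0" "fps_nth g 0 = 0"
  shows "fps_Exp (f + g) = fps_Exp f * fps_Exp g"
  by (rule fps_Exp_eqI) (use assms in \<open>simp_all add: fps_deriv_Exp algebra_simps\<close>)

lemma fps_Exp_uminus:
  fixes f :: "'a::field_char_0 fps"
  assumes "fps_nth f 0 = 0"
  shows "fps_Exp (- f) = inverse (fps_Exp f)"
  using fps_Exp_add[OF assms, of "- f"] assms
  by (simp add: fps_inverse_unique)

lemma fps_Exp_diff:
  fixes f g :: "'a::field_char_0 fps"
  assumes "fps_nth f 0 = 0" "fps_nth g 0 = 0"
  shows "fps_Exp (f - g) = fps_Exp f * inverse (fps_Exp g)"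
  using fps_Exp_add[OF assms(1), of "- g"] assms by (simp add: fps_Exp_uminus)

lemma fps_Exp_sum:
  fixes f :: "'i \<Rightarrow> 'a::field_char_0 fps"
  assumes "finite S" "\<And>i. i \<in> S \<Longrightarrow> fps_nth (f i) 0 = 0"
  shows "fps_Exp (\<Sum>i\<in>S. f i) = (\<Prod>i\<in>S. fps_Exp (f i))"
  using assms
  by (induction S rule: finite_induct) (simp_all add: fps_Exp_add fps_sum_nth)

text \<open>The series of \<open>ln (1 - c X)\<close>.\<close>

definition fps_log1m :: "'a::field_char_0 \<Rightarrow> 'a fps" where
  "fps_log1m c = Abs_fps (\<lambda>n. if n = 0 then 0 else - (c ^ n) / of_nat n)"

lemma fps_log1m_nth: "fps_nth (fps_log1m c) n = (if n = 0 then 0 else - (c ^ n) / of_nat n)"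
  by (simp add: fps_log1m_def)

lemma fps_Exp_log1m: "fps_Exp (fps_log1m c) = 1 - fps_const c * fps_X"
proof (rule fps_Exp_eqI)
  have d: "fps_nth (fps_deriv (fps_log1m c)) n = - (c ^ Suc n)" for n
    by (simp add: fps_log1m_nth field_simps del: of_nat_Suc)
  show "fps_deriv (1 - fps_const c * fps_X) = (1 - fps_const c * fps_X) * fps_deriv (fps_log1m c)"
  proof (rule fps_ext)
    fix n
    have "(1 - fps_const c * fps_X) * fps_deriv (fps_log1m c) =
      fps_deriv (fps_log1m c) - fps_const c * (fps_X * fps_deriv (fps_log1m c))"
      by (simp add: algebra_simps)
    thus "fps_nth (fps_deriv (1 - fps_const c * fps_X)) n =
        fps_nth ((1 - fps_const c * fps_X) * fps_deriv (fps_log1m c)) n"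
      by (cases n) (simp_all add: d del: fps_deriv_nth)
  qed
qed (simp_all add: fps_log1m_nth)

text \<open>\<open>fps_ln 1\<close> is the series of \<open>ln (1 + X)\<close>, the compositional
  inverse of \<open>exp - 1\<close>. A candidate for a logarithm therefore only has to be
  exponentiated.\<close>

lemma fps_ln_compose_eqI:
  fixes L X :: "'a::field_char_0 fps"
  assumes "fps_nth L 0 = 0" "fps_Exp L = 1 + X" "fps_nth X 0 = 0"
  shows "fps_compose (fps_ln 1) X = L"
proof -
  have "fps_compose (fps_ln 1) X = fps_compose (fps_ln 1) (fps_compose (fps_exp 1 - 1) L)"
    using assms by (simp add: fps_compose_sub_distrib)
  also have "\<dots> = fps_compose (fps_compose (fps_ln 1) (fps_exp 1 - 1)) L"
    by (rule fps_compose_assoc) (use assms in auto)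
  also have "\<dots> = L"
    using assms by (simp add: fps_ln_fps_exp_inv fps_inv_fps_exp_compose)
  finally show ?thesis .
qed


section \<open>Ordered products of \<open>q\<close>-exponentials of shift operators\<close>

text \<open>The coefficient of \<open>T^k\<close> in the equation that splits off the factor
  \<open>n = 0\<close>. The power \<open>t^(r (r - 1))\<close> arises from reordering
  \<open>(T D)^r\<close> into \<open>T^r D^r\<close> by \<open>D T = t^2 T D\<close>. The
  \<open>t\<close>-factorial \<open>c\<close> enters through its recursion, so that it can be a
  constant Laurent series.\<close>

lemma q_exponential_product_identity:
  fixes t x :: "'a::field" and c :: "nat \<Rightarrow> 'a"
  assumes c0: "c 0 = 1" and cS: "\<And>k. c (Suc k) * (1 - t) = c k * (1 - t ^ Suc k)"
    and c: "\<And>k. c k \<noteq> 0" and t: "t \<noteq> 1" and x: "\<And>k. 1 - x * t ^ k \<noteq> 0"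
  shows "(\<Sum>r\<le>k. x ^ r * t ^ (r * (r - 1)) / (c (k - r) * c r * (\<Prod>u<r. 1 - x * t ^ u))) =
    1 / (c k * (\<Prod>u<k. 1 - x * t ^ u))"
  using x
proof (induction k arbitrary: x)
  case 0
  show ?case by (simp add: c0)
next
  case (Suc k)
  define ce where "ce n = (1 - t ^ n) / (1 - t)" for n
  have cS': "c (Suc n) = c n * ce (Suc n)" for n
    using cS[of n] t by (simp add: ce_def field_simps)
  have ce: "ce (Suc n) \<noteq> 0" for n using c[of "Suc n"] cS'[of n] by auto
  have ce0: "ce 0 = 0" by (simp add: ce_def)
  define P where "P r = (\<Prod>u<r. 1 - x * t ^ u)" for r
  have P: "P r \<noteq> 0" for r using Suc.prems by (simp add: P_def)
  have Px: "P (Suc r) = (1 - x) * (\<Prod>u<r. 1 - x * t * t ^ u)" for r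
    unfolding P_def by (subst prod.lessThan_Suc_shift) (simp add: mult.assoc)
  have x1: "1 - x \<noteq> 0" using Suc.prems[of 0] by simp
  define w where "w r = x ^ r * t ^ (r * (r - 1)) / (c (Suc k - r) * c r * P r)" for r
  have split: "ce (Suc k) = t ^ r * ce (Suc k - r) + ce r" if "r \<le> Suc k" for r
    using that t by (simp add: ce_def field_simps flip: power_add)
  have "ce (Suc k) * (\<Sum>r\<le>Suc k. w r) =
      (\<Sum>r\<le>Suc k. t ^ r * ce (Suc k - r) * w r) + (\<Sum>r\<le>Suc k. ce r * w r)"
    unfolding sum_distrib_left sum.distrib[symmetric]
    by (intro sum.cong refl) (use split in \<open>simp add: algebra_simps\<close>)
  also have "(\<Sum>r\<le>Suc k. t ^ r * ce (Suc k - r) * w r) = (\<Sum>r\<le>k. t ^ r * ce (Suc k - r) * w r)"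
    by (simp add: ce0)
  also have "(\<Sum>r\<le>Suc k. ce r * w r) = (\<Sum>r\<le>k. ce (Suc r) * w (Suc r))"
    by (subst sum.atMost_Suc_shift) (simp add: ce0)
  also have "(\<Sum>r\<le>k. t ^ r * ce (Suc k - r) * w r) + (\<Sum>r\<le>k. ce (Suc r) * w (Suc r)) =
     (\<Sum>r\<le>k. (x * t) ^ r * t ^ (r * (r - 1)) / (c (k - r) * c r * (\<Prod>u<r. 1 - x * t * t ^ u))) / (1 - x)"
    unfolding sum.distrib[symmetric] sum_divide_distrib
  proof (intro sum.cong refl)
    fix r assume "r \<in> {..k}"
    hence r: "Suc k - r = Suc (k - r)" "r \<le> k" by auto
    have "t ^ r * ce (Suc k - r) * w r = x ^ r * t ^ (r * r) / (c (k - r) * c r * P r)"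
    proof -
      have "t ^ r * t ^ (r * (r - 1)) = t ^ (r * r)"
        by (cases r) (simp_all flip: power_add)
      thus ?thesis unfolding w_def r(1) cS' using ce[of "k - r"] by (simp add: field_simps)
    qed
    moreover have "ce (Suc r) * w (Suc r) = x ^ r * t ^ (r * r) * (x * t ^ r) / (c (k - r) * c r * P (Suc r))"
      unfolding w_def cS' using ce[of r] by (simp add: field_simps power_add)
    moreover have "P (Suc r) = P r * (1 - x * t ^ r)" by (simp add: P_def)
    \<comment> \<open>Over the common denominator with \<open>P (Suc r)\<close> the numerators
      contain \<open>1 - x t^r\<close> and \<open>x t^r\<close>, which add up to
      \<open>1\<close>.\<close>
    ultimately have "t ^ r * ce (Suc k - r) * w r + ce (Suc r) * w (Suc r) =
        x ^ r * t ^ (r * r) / (c (k - r) * c r * P (Suc r))"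
      using P[of r] Suc.prems[of r] c by (simp add: divide_simps) (simp add: algebra_simps)
    also have "x ^ r * t ^ (r * r) = (x * t) ^ r * t ^ (r * (r - 1))"
      by (cases r) (simp_all add: power_mult_distrib power_add algebra_simps)
    finally show "t ^ r * ce (Suc k - r) * w r + ce (Suc r) * w (Suc r) =
        (x * t) ^ r * t ^ (r * (r - 1)) / (c (k - r) * c r * (\<Prod>u<r. 1 - x * t * t ^ u)) / (1 - x)"
      by (simp add: Px mult.commute mult.left_commute)
  qed
  also have "\<dots> = 1 / (c k * (\<Prod>u<k. 1 - x * t * t ^ u)) / (1 - x)"
    by (subst Suc.IH) (use Suc.prems[of "Suc _"] in \<open>simp_all add: mult.assoc\<close>)
  also have "\<dots> = 1 / (c k * P (Suc k))" by (simp add: Px)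
  finally have "(\<Sum>r\<le>Suc k. w r) = 1 / (c k * P (Suc k)) / ce (Suc k)"
    using ce[of k] by (metis nonzero_mult_div_cancel_left)
  hence "(\<Sum>r\<le>Suc k. w r) = 1 / (c (Suc k) * P (Suc k))"
    by (simp only: cS' divide_divide_eq_left mult_ac)
  thus ?case by (simp add: w_def P_def)
qed

lemma mult_op_assoc:
  assumes "finite I"
  shows "mult_op I (mult_op I A B) C = mult_op I A (mult_op I B C)"
  unfolding mult_op_def
  by (intro ext) (simp add: sum_distrib_left sum_distrib_right mult.assoc, rule sum.swap)

lemma mult_op_cong:
  assumes "\<And>k. k \<in> I \<Longrightarrow> A i k = A' i k" "\<And>k. k \<in> I \<Longrightarrow> B k j = B' k j"
  shows "mult_op I A B i j = mult_op I A' B' i j"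
  unfolding mult_op_def by (rule sum.cong) (use assms in auto)

text \<open>The shift acts on all labels and may leave \<open>I\<close>. The grade prevents an orbit
  from repeating, so \<open>n\<close> is determined by \<open>(sh ^^ n) j\<close>; convexity ensures
  that matrix products over \<open>I\<close> lose no intermediate label.\<close>

locale graded_shift =
  fixes I :: "'i set" and sh :: "'i \<Rightarrow> 'i" and grade :: "'i \<Rightarrow> real"
  assumes finite_I: "finite I"
    and grade_sh: "grade (sh i) = grade i + 1"
    and convex: "j \<in> I \<Longrightarrow> (sh ^^ n) j \<in> I \<Longrightarrow> m \<le> n \<Longrightarrow> (sh ^^ m) j \<in> I"
begin

lemma grade_funpow: "grade ((sh ^^ n) j) = grade j + real n"
  by (induction n) (simp_all add: grade_sh)

lemma funpow_eq_iff: "(sh ^^ m) j = (sh ^^ n) j \<longleftrightarrow> m = n"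
  by (metis add_left_cancel grade_funpow of_nat_eq_iff)

text \<open>\<open>A\<close> agrees on \<open>I\<close> with the sum over \<open>n\<close> of the operators sending \<open>j\<close> to \<open>g n j\<close> times
  its \<open>n\<close>-fold shift.\<close>

definition shift_rep :: "('i, 'a::zero) oper \<Rightarrow> (nat \<Rightarrow> 'i \<Rightarrow> 'a) \<Rightarrow> bool" where
  "shift_rep A g \<longleftrightarrow> (\<forall>i\<in>I. \<forall>j\<in>I. (\<forall>n. i = (sh ^^ n) j \<longrightarrow> A i j = g n j) \<and>
     ((\<forall>n. i \<noteq> (sh ^^ n) j) \<longrightarrow> A i j = 0))"

definition of_coeffs :: "(nat \<Rightarrow> 'i \<Rightarrow> 'a::zero) \<Rightarrow> ('i, 'a) oper" where
  "of_coeffs g = (\<lambda>i j. if \<exists>n. i = (sh ^^ n) j then g (THE n. i = (sh ^^ n) j) j else 0)"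

lemma shift_rep_of_coeffs: "shift_rep (of_coeffs g) g"
  unfolding shift_rep_def of_coeffs_def by (auto simp: funpow_eq_iff)

lemma shift_repI:
  assumes "\<And>j n. j \<in> I \<Longrightarrow> (sh ^^ n) j \<in> I \<Longrightarrow> A ((sh ^^ n) j) j = g n j"
    and "\<And>i j. i \<in> I \<Longrightarrow> j \<in> I \<Longrightarrow> (\<And>n. i \<noteq> (sh ^^ n) j) \<Longrightarrow> A i j = 0"
  shows "shift_rep A g"
  using assms unfolding shift_rep_def by blast

lemma shift_repD:
  "shift_rep A g \<Longrightarrow> j \<in> I \<Longrightarrow> (sh ^^ n) j \<in> I \<Longrightarrow> A ((sh ^^ n) j) j = g n j"
  "shift_rep A g \<Longrightarrow> i \<in> I \<Longrightarrow> j \<in> I \<Longrightarrow> (\<And>n. i \<noteq> (sh ^^ n) j) \<Longrightarrow> A i j = 0"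
  unfolding shift_rep_def by blast+

lemma shift_rep_cong:
  assumes "shift_rep A g" "\<And>j n. j \<in> I \<Longrightarrow> (sh ^^ n) j \<in> I \<Longrightarrow> g n j = h n j"
  shows "shift_rep A h"
  using assms unfolding shift_rep_def by metis

lemma shift_rep_unique:
  assumes "shift_rep A g" "shift_rep B g" "i \<in> I" "j \<in> I"
  shows "A i j = B i j"
  using assms unfolding shift_rep_def by metis

lemma shift_rep_one: "shift_rep one_op (\<lambda>n j. of_bool (n = 0))"
proof (rule shift_repI)
  fix j n
  show "one_op ((sh ^^ n) j) j = of_bool (n = 0)"
    using funpow_eq_iff[of n j 0] by (auto simp: one_op_def)
next
  fix i j assume "\<And>n. i \<noteq> (sh ^^ n) j"
  from this[of 0] show "one_op i j = 0" by (simp add: one_op_def)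
qed

text \<open>A Cauchy product, since only orbit points between \<open>j\<close> and its
  \<open>n\<close>-fold shift contribute and \<open>convex\<close> puts them in \<open>I\<close>.
  The left coefficient is taken at the shifted label, which is how the noncommutativity of
  \<open>T\<close> and \<open>D\<close> enters.\<close>

lemma shift_rep_mult:
  fixes A B :: "('i, 'a::semiring_0) oper"
  assumes A: "shift_rep A g" and B: "shift_rep B h"
  shows "shift_rep (mult_op I A B) (\<lambda>n j. \<Sum>r\<le>n. g (n - r) ((sh ^^ r) j) * h r j)"
proof (rule shift_repI)
  fix j n assume j: "j \<in> I" and n: "(sh ^^ n) j \<in> I"
  have sub: "(\<lambda>r. (sh ^^ r) j) ` {..n} \<subseteq> I" using convex[OF j n] by auto
  have inj: "inj_on (\<lambda>r. (sh ^^ r) j) {..n}" by (auto simp: inj_on_def funpow_eq_iff)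
  have "mult_op I A B ((sh ^^ n) j) j =
      (\<Sum>k\<in>(\<lambda>r. (sh ^^ r) j) ` {..n}. A ((sh ^^ n) j) k * B k j)"
    unfolding mult_op_def
  proof (rule sum.mono_neutral_right[OF finite_I sub], intro ballI)
    fix k assume k: "k \<in> I - (\<lambda>r. (sh ^^ r) j) ` {..n}"
    show "A ((sh ^^ n) j) k * B k j = 0"
    proof (cases "\<exists>r. k = (sh ^^ r) j")
      case True
      then obtain r where r: "k = (sh ^^ r) j" by blast
      \<comment> \<open>A point beyond the target cannot be carried back to it by further
        shifts.\<close>
      with k have "r > n" by (auto simp: not_le[symmetric])
      have "(sh ^^ n) j \<noteq> (sh ^^ s) k" for s
      proof -
        have "(sh ^^ s) k = (sh ^^ (s + r)) j" by (simp add: r funpow_add)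
        thus ?thesis using \<open>r > n\<close> by (simp add: funpow_eq_iff)
      qed
      thus ?thesis using shift_repD(2)[OF A n, of k] k by simp
    next
      case False
      thus ?thesis using shift_repD(2)[OF B, of k j] k j by simp
    qed
  qed
  also have "\<dots> = (\<Sum>r\<le>n. A ((sh ^^ n) j) ((sh ^^ r) j) * B ((sh ^^ r) j) j)"
    by (simp add: sum.reindex[OF inj])
  also have "\<dots> = (\<Sum>r\<le>n. g (n - r) ((sh ^^ r) j) * h r j)"
  proof (intro sum.cong refl)
    fix r assume r: "r \<in> {..n}"
    hence rI: "(sh ^^ r) j \<in> I" using sub by auto
    have *: "(sh ^^ n) j = (sh ^^ (n - r)) ((sh ^^ r) j)"
      using r by (simp flip: funpow_add[unfolded o_def, THEN fun_cong, simplified] add: funpow_add[symmetric, THEN fun_cong, unfolded o_def])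
    show "A ((sh ^^ n) j) ((sh ^^ r) j) * B ((sh ^^ r) j) j = g (n - r) ((sh ^^ r) j) * h r j"
      using shift_repD(1)[OF A rI, of "n - r"] shift_repD(1)[OF B j rI] n unfolding * by simp
  qed
  finally show "mult_op I A B ((sh ^^ n) j) j = (\<Sum>r\<le>n. g (n - r) ((sh ^^ r) j) * h r j)" .
next
  fix i j assume i: "i \<in> I" and j: "j \<in> I" and ne: "\<And>n. i \<noteq> (sh ^^ n) j"
  show "mult_op I A B i j = 0"
    unfolding mult_op_def
  proof (rule sum.neutral, intro ballI)
    fix k assume k: "k \<in> I"
    show "A i k * B k j = 0"
    proof (cases "\<exists>r. k = (sh ^^ r) j")
      case True
      then obtain r where r: "k = (sh ^^ r) j" by blast
      have "i \<noteq> (sh ^^ s) k" for s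
        using ne[of "s + r"] by (simp add: r funpow_add)
      thus ?thesis using shift_repD(2)[OF A i k] by simp
    next
      case False
      thus ?thesis using shift_repD(2)[OF B k j] by simp
    qed
  qed
qed

lemma shift_rep_pow:
  fixes A :: "('i, 'a::field) oper"
  assumes A: "shift_rep A (\<lambda>n j. if n = 1 then a j else 0)"
  shows "shift_rep (pow_op I A k) (\<lambda>n j. if n = k then \<Prod>u<k. a ((sh ^^ u) j) else 0)"
proof (induction k)
  case 0
  show ?case using shift_rep_one by (auto simp: of_bool_def cong: if_cong)
next
  case (Suc k)
  show ?case unfolding pow_op.simps
  proof (rule shift_rep_cong[OF shift_rep_mult[OF A Suc]])
    fix j n
    have "(\<Sum>r\<le>n. (if n - r = 1 then a ((sh ^^ r) j) else 0) *
        (if r = k then \<Prod>u<k. a ((sh ^^ u) j) else 0)) =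
      (\<Sum>r\<le>n. if r = k then if n = Suc k then a ((sh ^^ k) j) * (\<Prod>u<k. a ((sh ^^ u) j)) else 0 else 0)"
      by (intro sum.cong refl) auto
    also have "\<dots> = (if n = Suc k then \<Prod>u<Suc k. a ((sh ^^ u) j) else 0)"
      by (simp add: mult.commute)
    finally show "(\<Sum>r\<le>n. (if n - r = 1 then a ((sh ^^ r) j) else 0) *
        (if r = k then \<Prod>u<k. a ((sh ^^ u) j) else 0)) =
      (if n = Suc k then \<Prod>u<Suc k. a ((sh ^^ u) j) else 0)" .
  qed
qed

text \<open>The \<open>k\<close>-th power of a one-step shift moves by exactly \<open>k\<close>, so
  at most one term of the series contributes to a given entry.\<close>

lemma shift_rep_qexp:
  assumes A: "shift_rep A (\<lambda>n j. if n = 1 then a j else 0)"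
  shows "shift_rep (qexp_op I p A) (\<lambda>n j. (\<Prod>u<n. a ((sh ^^ u) j)) / fls_const (ceil_fact p n))"
proof (rule shift_repI)
  fix j n assume j: "j \<in> I" and n: "(sh ^^ n) j \<in> I"
  have "pow_op I A m ((sh ^^ n) j) j = (if n = m then \<Prod>u<n. a ((sh ^^ u) j) else 0)" for m
    using shift_repD(1)[OF shift_rep_pow[OF A] j n] by simp
  thus "qexp_op I p A ((sh ^^ n) j) j = (\<Prod>u<n. a ((sh ^^ u) j)) / fls_const (ceil_fact p n)"
    unfolding qexp_op_def by (subst suminf_finite[of "{n}"]) auto
next
  fix i j assume "i \<in> I" "j \<in> I" "\<And>n. i \<noteq> (sh ^^ n) j"
  hence "pow_op I A m i j = 0" for m
    using shift_repD(2)[OF shift_rep_pow[OF A]] by simp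
  thus "qexp_op I p A i j = 0" by (simp add: qexp_op_def)
qed

end


section \<open>The limit of the ordered product of \<open>q\<close>-exponentials\<close>

lemma ceil_fact_Suc: "ceil_fact p (Suc k) * (1 - p) = ceil_fact p k * (1 - p ^ Suc k)" if "p \<noteq> 1"
  using that by (simp add: ceil_fact_def ceil_num_def power_int_def nat_add_distrib)

lemma ceil_fact_nonzero:
  assumes "\<And>k. k > 0 \<Longrightarrow> p ^ k \<noteq> 1"
  shows "ceil_fact p n \<noteq> 0"
  using assms assms[of 1] by (auto simp: ceil_fact_def ceil_num_def power_int_def)

text \<open>The reordering \<open>(T D^n)^m = t^(n m (m - 1)) T^m D^(n m)\<close>, read off along an
  orbit: \<open>X u\<close> is the entry of \<open>D\<close> after \<open>u\<close> shifts.\<close>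

lemma prod_shift_powers:
  fixes t x :: "'a::comm_monoid_mult" and X :: "nat \<Rightarrow> 'a"
  assumes "\<And>u. X u = (t ^ 2) ^ u * x"
  shows "(\<Prod>u<m. X u ^ n) = x ^ (n * m) * t ^ (n * (m * (m - 1)))"
proof (induction m)
  case (Suc m)
  have "X m ^ n = x ^ n * t ^ (n * (2 * m))"
    by (simp add: assms power_mult_distrib mult.commute flip: power_mult)
  moreover have "m * (m - 1) + 2 * m = Suc m * (Suc m - 1)"
    by (cases m) (simp_all add: algebra_simps)
  hence "n * (Suc m * (Suc m - 1)) = n * (m * (m - 1)) + n * (2 * m)"
    by (metis distrib_left)
  hence "t ^ (n * (Suc m * (Suc m - 1))) = t ^ (n * (m * (m - 1))) * t ^ (n * (2 * m))"
    by (simp only: power_add)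
  moreover have "x ^ (n * Suc m) = x ^ (n * m) * x ^ n"
    by (simp add: mult.commute power_add)
  ultimately show ?case
    unfolding prod.lessThan_Suc Suc.IH by (simp only: mult_ac)
qed simp

context graded_shift
begin

primrec upto_op :: "(nat \<Rightarrow> ('i, 'a::semiring_1) oper) \<Rightarrow> nat \<Rightarrow> ('i, 'a) oper" where
  "upto_op E 0 = one_op"
| "upto_op E (Suc N) = mult_op I (upto_op E N) (E N)"

text \<open>The tails of the infinite product have the explicit form \<open>G N\<close> below: \<open>G N\<close> is the product of the
  factor \<open>N\<close> and \<open>G (N + 1)\<close>, and \<open>G N\<close> tends to the identity.  Hence the partial products times
  \<open>G N\<close> are constantly \<open>G 0\<close>.\<close>

proposition upto_op_tendsto:
  fixes F :: "nat \<Rightarrow> ('i, laurent) oper" and t :: complex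
  assumes t: "\<And>k. k > 0 \<Longrightarrow> t ^ k \<noteq> 1"
    and F: "\<And>n. shift_rep (F n) (\<lambda>m j. if m = 1 then \<tau> j * x j ^ n else 0)"
    and x_sh: "\<And>j. x (sh j) = fls_const (t ^ 2) * x j"
    and ord_x: "\<And>j. ord_ge 1 (x j)"
    and ord_\<tau>: "\<And>j. ord_ge 0 (\<tau> j)"
    and P: "shift_rep P (\<lambda>m j. (\<Prod>u<m. \<tau> ((sh ^^ u) j)) /
      (fls_const (ceil_fact t m) * (\<Prod>u<m. 1 - x j * fls_const t ^ u)))"
    and i: "i \<in> I" and j: "j \<in> I"
  shows "(\<lambda>N. upto_op (\<lambda>n. qexp_op I t (F n)) N i j) \<longlonglongrightarrow> P i j"
proof -
  define T where "T = fls_const t"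
  define c where "c n = fls_const (ceil_fact t n)" for n
  define pr where "pr m j = (\<Prod>u<m. \<tau> ((sh ^^ u) j))" for m j
  define den where "den m j = (\<Prod>u<m. 1 - x j * T ^ u)" for m j
  \<comment> \<open>As \<open>D (T D^n) = t^2 (T D^n) D\<close>, the tail from factor
    \<open>n\<close> on is the series for the whole product with \<open>T D^n\<close> in place of
    \<open>T\<close>; the denominators in \<open>D\<close> stay the same.\<close>
  define G where "G n m j = pr m j * (x j ^ (n * m) * T ^ (n * (m * (m - 1)))) / (c m * den m j)" for n m j
  define E where "E n = qexp_op I t (F n)" for n
  have t1: "t \<noteq> 1" using t[of 1] by simp
  have c_nz: "c n \<noteq> 0" for n using ceil_fact_nonzero[OF t] by (simp add: c_def)
  have cS: "c (Suc k) * (1 - T) = c k * (1 - T ^ Suc k)" for k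
    using ceil_fact_Suc[OF t1, of k] unfolding c_def T_def
    by (metis (no_types, lifting) fls_const_1 fls_const_mult_const fls_const_power fls_minus_const)
  have x_nth0: "fls_nth (x j) 0 = 0" for j using ord_x[of j] by (simp add: ord_ge_def)
  have xT: "ord_ge 1 (x j * T ^ u)" for j u
    using ord_ge_mult[OF ord_x[of j], of 0 "T ^ u"] by (simp add: T_def flip: fls_const_power)
  have fac: "ord_ge 0 (1 - x j * T ^ u)" "fls_nth (1 - x j * T ^ u) 0 = 1" "1 - x j * T ^ u \<noteq> 0" for j u
  proof -
    show "ord_ge 0 (1 - x j * T ^ u)"
      by (intro ord_ge_diff ord_ge_1 ord_ge_mono[OF xT]) simp
    show *: "fls_nth (1 - x j * T ^ u) 0 = 1"
      using xT[of j u] by (simp add: ord_ge_def)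
    show "1 - x j * T ^ u \<noteq> 0" using * by force
  qed
  have x_iter: "x ((sh ^^ u) j) = (T ^ 2) ^ u * x j" for u j
    by (induction u) (simp_all add: x_sh T_def fls_const_power algebra_simps)
  have E: "shift_rep (E n) (\<lambda>m j. pr m j * (x j ^ (n * m) * T ^ (n * (m * (m - 1)))) / c m)" for n
  proof -
    have "(\<Prod>u<m. \<tau> ((sh ^^ u) j) * x ((sh ^^ u) j) ^ n) =
        pr m j * (x j ^ (n * m) * T ^ (n * (m * (m - 1))))" for m j
      unfolding prod.distrib pr_def by (subst prod_shift_powers[OF x_iter]) simp
    thus ?thesis using shift_rep_qexp[OF F[of n], of t] by (simp add: E_def c_def)
  qed
  have step: "mult_op I (E n) (of_coeffs (G (Suc n))) i' j' = of_coeffs (G n) i' j'"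
    if "i' \<in> I" "j' \<in> I" for n i' j'
  proof (rule shift_rep_unique[OF _ shift_rep_of_coeffs that])
    show "shift_rep (mult_op I (E n) (of_coeffs (G (Suc n)))) (G n)"
    proof (rule shift_rep_cong[OF shift_rep_mult[OF E shift_rep_of_coeffs]])
      fix j k
      have "(\<Sum>r\<le>k. pr (k - r) ((sh ^^ r) j) * (x ((sh ^^ r) j) ^ (n * (k - r)) *
             T ^ (n * ((k - r) * (k - r - 1)))) / c (k - r) * G (Suc n) r j) =
          (\<Sum>r\<le>k. pr k j * (x j ^ (n * k) * T ^ (n * (k * (k - 1)))) *
            (x j ^ r * T ^ (r * (r - 1)) / (c (k - r) * c r * den r j)))"
      proof (intro sum.cong refl)
        fix r assume "r \<in> {..k}"
        then obtain s where k: "k = r + s" by (auto simp: le_iff_add)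
        have 1: "pr s ((sh ^^ r) j) * pr r j = pr k j"
          unfolding pr_def k
          by (induction s) (simp_all add: funpow_add[symmetric, THEN fun_cong, unfolded o_def] add.commute mult_ac)
        have 2: "x ((sh ^^ r) j) ^ (n * s) = x j ^ (n * s) * T ^ (n * (2 * r * s))"
          by (simp add: x_iter power_mult_distrib mult_ac flip: power_mult)
        \<comment> \<open>This is \<open>k (k - 1) = r (r - 1) + s (s - 1) + 2 r s\<close> for
          \<open>k = r + s\<close>, where \<open>2 r s\<close> comes from moving
          \<open>D^(n s)\<close> past \<open>T^r\<close>. The extra \<open>r (r - 1)\<close> becomes
          the power of \<open>t\<close> in the Cauchy identity.\<close>
        have "n * (2 * r * s) + n * (s * (s - 1)) + Suc n * (r * (r - 1)) =
          n * (k * (k - 1)) + r * (r - 1)"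
          unfolding k by (cases r; cases s) (simp_all add: algebra_simps)
        hence 3: "T ^ (n * (2 * r * s)) * T ^ (n * (s * (s - 1))) * T ^ (Suc n * (r * (r - 1))) =
          T ^ (n * (k * (k - 1))) * T ^ (r * (r - 1))"
          by (metis power_add)
        have 4: "x j ^ (n * s) * x j ^ (Suc n * r) = x j ^ (n * k) * x j ^ r"
          by (simp add: k algebra_simps flip: power_add)
        have "pr s ((sh ^^ r) j) * (x ((sh ^^ r) j) ^ (n * s) * T ^ (n * (s * (s - 1)))) / c s * G (Suc n) r j =
          (pr s ((sh ^^ r) j) * pr r j) * (x j ^ (n * s) * x j ^ (Suc n * r)) *
          (T ^ (n * (2 * r * s)) * T ^ (n * (s * (s - 1))) * T ^ (Suc n * (r * (r - 1)))) /
          (c s * c r * den r j)"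
          unfolding G_def 2 by (simp only: times_divide_eq_left times_divide_eq_right divide_divide_eq_left mult_ac)
        thus "pr (k - r) ((sh ^^ r) j) * (x ((sh ^^ r) j) ^ (n * (k - r)) *
             T ^ (n * ((k - r) * (k - r - 1)))) / c (k - r) * G (Suc n) r j =
          pr k j * (x j ^ (n * k) * T ^ (n * (k * (k - 1)))) *
            (x j ^ r * T ^ (r * (r - 1)) / (c (k - r) * c r * den r j))"
          unfolding 1 3 4 by (simp add: k mult_ac)
      qed
      also have "\<dots> = pr k j * (x j ^ (n * k) * T ^ (n * (k * (k - 1)))) *
          (\<Sum>r\<le>k. x j ^ r * T ^ (r * (r - 1)) / (c (k - r) * c r * den r j))"
        by (simp add: sum_distrib_left)
      also have "(\<Sum>r\<le>k. x j ^ r * T ^ (r * (r - 1)) / (c (k - r) * c r * den r j)) = 1 / (c k * den k j)"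
        unfolding den_def
      proof (rule q_exponential_product_identity)
        show "c 0 = 1" by (simp add: c_def ceil_fact_def)
        show "T \<noteq> 1" using t1 by (simp add: T_def)
      qed (use cS c_nz fac in auto)
      finally show "(\<Sum>r\<le>k. pr (k - r) ((sh ^^ r) j) * (x ((sh ^^ r) j) ^ (n * (k - r)) *
             T ^ (n * ((k - r) * (k - r - 1)))) / c (k - r) * G (Suc n) r j) = G n k j"
        by (simp add: G_def)
    qed
  qed
  define U where "U = upto_op E"
  have U_tail: "mult_op I (U N) (of_coeffs (G N)) i' j' = of_coeffs (G 0) i' j'"
    if "i' \<in> I" "j' \<in> I" for N i' j'
  proof (induction N)
    case 0
    have "mult_op I (U 0) (of_coeffs (G 0)) i' j' =
        (\<Sum>k\<in>I. if k = i' then of_coeffs (G 0) i' j' else 0)"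
      unfolding mult_op_def U_def by (intro sum.cong) (auto simp: one_op_def)
    thus ?case using that finite_I by simp
  next
    case (Suc N)
    have "mult_op I (U (Suc N)) (of_coeffs (G (Suc N))) i' j' =
        mult_op I (U N) (mult_op I (E N) (of_coeffs (G (Suc N)))) i' j'"
      by (simp add: U_def mult_op_assoc[OF finite_I])
    also have "\<dots> = mult_op I (U N) (of_coeffs (G N)) i' j'"
      by (rule mult_op_cong) (use step that in auto)
    finally show ?case using Suc by simp
  qed
  have ord_pr: "ord_ge 0 (pr m j)" for m j
    unfolding pr_def by (intro ord_ge_prod_0 ord_\<tau>)
  have ord_c: "ord_ge 0 (inverse (c m))" for m
    by (simp add: c_def fls_inverse_const)
  have ord_T: "ord_ge 0 (T ^ m)" for m
    by (simp add: T_def flip: fls_const_power)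
  have ord_xn: "ord_ge (int n) (x j ^ n)" for n j
    using ord_ge_power[OF ord_x[of j], of n] by simp
  have ord_den: "ord_ge 0 (inverse (den m j))" for m j
  proof -
    have "ord_ge 0 (den m j)" unfolding den_def by (intro ord_ge_prod_0 fac)
    moreover have "fls_nth (den m j) 0 = 1"
    proof (induction m)
      case (Suc m)
      have "ord_ge 0 (den m j)" unfolding den_def by (intro ord_ge_prod_0 fac)
      hence "ord_ge 1 (den m j * (x j * T ^ m))"
        using ord_ge_mult[OF _ xT] by force
      hence "fls_nth (den m j * (x j * T ^ m)) 0 = 0" by (simp add: ord_ge_def)
      thus ?case using Suc by (simp add: den_def algebra_simps)
    qed (simp add: den_def)
    ultimately show ?thesis by (intro ord_ge_inverse_0) auto
  qed
  have ord_num: "ord_ge (int (n * m)) (pr m j * (x j ^ (n * m) * T ^ (n * (m * (m - 1)))))" for n m j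
    by (rule ord_ge_mult'[OF ord_pr ord_ge_mult'[OF ord_xn ord_T]]) auto
  \<comment> \<open>Partial products contain no negative powers of the formal variable, so
    multiplication by them keeps the order gained by the tail.\<close>
  have ord_U: "ord_ge 0 (U N i' j')" if "i' \<in> I" "j' \<in> I" for N i' j'
    using that
  proof (induction N arbitrary: i' j')
    case 0
    show ?case by (simp add: U_def one_op_def)
  next
    case (Suc N)
    have "ord_ge 0 (E N k j')" if "k \<in> I" for k
    proof (cases "\<exists>m. k = (sh ^^ m) j'")
      case True
      then obtain m where m: "k = (sh ^^ m) j'" by blast
      have "ord_ge 0 (pr m j' * (x j' ^ (N * m) * T ^ (N * (m * (m - 1)))) * inverse (c m))"
        by (rule ord_ge_mult'[OF ord_num ord_c]) simp
      thus ?thesis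
        using shift_repD(1)[OF E Suc.prems(2), of m N] that m by (simp add: divide_inverse)
    next
      case False
      thus ?thesis using shift_repD(2)[OF E that Suc.prems(2), of N] by simp
    qed
    thus ?case
      unfolding U_def upto_op.simps mult_op_def
      using Suc by (intro ord_ge_sum ord_ge_mult'[of 0 _ 0]) (auto simp: U_def)
  qed
  \<comment> \<open>The coefficient at \<open>m = 0\<close> is exactly \<open>1\<close>; every other
    one contains \<open>x^(N m)\<close> and has order at least \<open>N\<close>.\<close>
  have ord_tail: "ord_ge (int N) (one_op k j - of_coeffs (G N) k j)" if "k \<in> I" for N k
  proof (cases "\<exists>m. k = (sh ^^ m) j")
    case True
    then obtain m where m: "k = (sh ^^ m) j" by blast
    have 1: "one_op k j = (of_bool (m = 0) :: laurent)"
      using shift_repD(1)[OF shift_rep_one j, of m] that m by simp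
    have 2: "of_coeffs (G N) k j = G N m j"
      using shift_repD(1)[OF shift_rep_of_coeffs j, of m] that m by simp
    show ?thesis
    proof (cases "m = 0")
      case True
      have "G N 0 j = 1" by (simp add: G_def pr_def c_def den_def ceil_fact_def)
      thus ?thesis by (simp add: 1 2 True)
    next
      case False
      have "ord_ge (int N) (pr m j * (x j ^ (N * m) * T ^ (N * (m * (m - 1)))) * (inverse (c m) * inverse (den m j)))"
        by (rule ord_ge_mult'[OF ord_num ord_ge_mult'[OF ord_c ord_den order_refl]])
          (use False in \<open>cases m; simp\<close>)
      thus ?thesis using False by (simp add: 1 2 G_def divide_inverse ord_ge_uminus)
    qed
  next
    case False
    have "one_op k j = (0 :: laurent)" "of_coeffs (G N) k j = 0"
      by (rule shift_repD(2)[OF shift_rep_one that j] shift_repD(2)[OF shift_rep_of_coeffs that j],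
          use False in blast)+
    thus ?thesis by simp
  qed
  have "of_coeffs (G 0) i j = P i j"
    by (rule shift_rep_unique[OF shift_rep_of_coeffs _ i j])
      (use P in \<open>simp add: G_def pr_def c_def den_def T_def\<close>)
  \<comment> \<open>Since \<open>U N\<close> times the tail \<open>G N\<close> is always
    \<open>G 0\<close>, the error is \<open>U N\<close> times \<open>1 - G N\<close>.\<close>
  moreover have "ord_ge (int N) (U N i j - of_coeffs (G 0) i j)" for N
  proof -
    have "U N i j = (\<Sum>k\<in>I. U N i k * one_op k j)"
      using finite_I j by (simp add: one_op_def of_bool_def if_distrib[of "(*) _"] cong: if_cong)
    hence "U N i j - of_coeffs (G 0) i j = (\<Sum>k\<in>I. U N i k * (one_op k j - of_coeffs (G N) k j))"
      by (simp add: U_tail[OF i j, symmetric, of N] mult_op_def right_diff_distrib sum_subtractf)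
    thus ?thesis
      using i ord_U ord_tail by (auto intro!: ord_ge_sum ord_ge_mult'[of 0])
  qed
  ultimately show ?thesis
    using fls_tendstoI[of "\<lambda>N. U N i j"] by (simp add: U_def E_def[abs_def])
qed

end


section \<open>Root vectors on evaluation modules\<close>

locale generic_q =
  fixes b :: complex
  assumes not_root_of_unity: "\<forall>n::nat. n > 0 \<longrightarrow> qs b ^ n \<noteq> 1"
begin

abbreviation p :: complex where "p \<equiv> qs b"
abbreviation P :: "real \<Rightarrow> complex" where "P \<equiv> qs_pow b"

lemma P_add: "P (x + y) = P x * P y"
  by (simp add: qs_pow_def algebra_simps flip: exp_add)

lemma P_0 [simp]: "P 0 = 1"
  by (simp add: qs_pow_def)

lemma P_nonzero [simp]: "P x \<noteq> 0"
  by (simp add: qs_pow_def)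

lemma P_minus: "P (- x) = inverse (P x)"
  using P_add[of x "- x"] by (simp add: inverse_unique)

lemma P_diff: "P (x - y) = P x / P y"
  using P_add[of x "- y"] by (simp add: P_minus divide_inverse)

lemma P_power: "P x ^ n = P (x * real n)"
  by (induction n) (simp_all add: P_add algebra_simps)

lemma P_2: "P 2 = p ^ 2"
  by (simp add: P_power)

lemma p_powi: "p powi k = P (of_int k)"
  by (cases k rule: int_cases2) (simp_all add: power_int_minus P_power P_minus)

lemma p_power_ne_1: "n > 0 \<Longrightarrow> p ^ n \<noteq> 1"
  using not_root_of_unity by blast

lemma P_nat_ne_1: "n > 0 \<Longrightarrow> P (real n) \<noteq> 1"
  using p_power_ne_1[of n] by (simp add: P_power)

text \<open>A failure gives \<open>p^(2n) = 1\<close> in the first case and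
  \<open>p^(2n) = -1\<close>, hence \<open>p^(4n) = 1\<close>, in the second.\<close>

lemma p_power_ne: "n > 0 \<Longrightarrow> p ^ n \<noteq> inverse (p ^ n)" "n > 0 \<Longrightarrow> p ^ n + inverse (p ^ n) \<noteq> 0"
proof -
  assume n: "n > 0"
  show "p ^ n \<noteq> inverse (p ^ n)"
  proof
    assume "p ^ n = inverse (p ^ n)"
    hence "p ^ n * p ^ n = 1" by (metis P_power P_nonzero right_inverse)
    thus False using p_power_ne_1[of "n + n"] n by (simp add: power_add)
  qed
  show "p ^ n + inverse (p ^ n) \<noteq> 0"
  proof
    assume "p ^ n + inverse (p ^ n) = 0"
    hence "p ^ n = - inverse (p ^ n)" by (simp add: eq_neg_iff_add_eq_0)
    hence "p ^ n * p ^ n = - 1" by (metis P_power P_nonzero right_inverse mult_minus_right)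
    hence "p ^ (n + n + (n + n)) = 1" by (simp add: power_add)
    thus False using p_power_ne_1[of "n + n + (n + n)"] n by simp
  qed
qed

lemma p_minus_nonzero [simp]: "p - inverse p \<noteq> 0"
  using p_power_ne(1)[of 1] by simp

lemma p_plus_nonzero [simp]: "p + inverse p \<noteq> 0"
  using p_power_ne(2)[of 1] by simp

text \<open>\<open>b^2\<close> exceeds \<open>bstar2 b\<close> by \<open>1/2\<close>; at the integer
  arguments used below the resulting phase is a power of \<open>\<i>\<close>.\<close>

lemma q_pow_eq: "q_pow b x = P x * exp (complex_of_real (pi * x / 2) * \<i>)"
  by (simp add: q_pow_def qs_pow_def bstar2_def algebra_simps flip: exp_add)

lemma qq_eq: "qq b = \<i> * p"
  using q_pow_eq[of 1] cis_pi_half by (simp add: cis_conv_exp mult.commute)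

lemma q_pow_minus_2: "q_pow b (- 2) = - P (- 2)"
  by (simp add: q_pow_eq exp_minus)

lemma q_pow_2: "q_pow b 2 = - P 2"
  by (simp add: q_pow_eq)

lemma q_pow_even: "q_pow b (2 * real n) = (- 1) ^ n * P (2 * real n)"
proof -
  have "exp (complex_of_real (pi * (2 * real n) / 2) * \<i>) = exp (of_nat n * (complex_of_real pi * \<i>))"
    by (simp add: mult_ac)
  also have "\<dots> = (- 1) ^ n"
    unfolding exp_of_nat_mult by simp
  finally show ?thesis unfolding q_pow_eq by simp
qed

lemma q_pow_minus_even: "q_pow b (- 2 * real n) = (- 1) ^ n * P (- 2 * real n)"
proof -
  have "q_pow b (- 2 * real n) = inverse (q_pow b (2 * real n))"
    by (simp add: q_pow_def flip: exp_minus)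
  thus ?thesis
    using P_minus[of "2 * real n"] by (simp add: q_pow_even power_inverse[symmetric])
qed

lemma qq_plus: "qq b + inverse (qq b) = \<i> * (p - inverse p)"
  by (simp add: qq_eq algebra_simps)

lemma qq_minus: "qq b - inverse (qq b) = \<i> * (p + inverse p)"
  by (simp add: qq_eq algebra_simps)

text \<open>Real arguments, because weights are real numbers and possibly half-integers; the floors
  in \<open>q_num\<close> then appear only in the translation from and to the given
  formulas.\<close>

definition qnum :: "real \<Rightarrow> complex" where
  "qnum x = (P x - P (- x)) / (p - inverse p)"

lemma q_num_eq: "q_num p k = qnum (of_int k)"
  by (simp add: q_num_def qnum_def p_powi)

lemma qnum_0 [simp]: "qnum 0 = 0"
  by (simp add: qnum_def)

lemma qnum_nonzero: "n > 0 \<Longrightarrow> qnum (real n) \<noteq> 0"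
  using p_power_ne(1)[of n] p_minus_nonzero by (simp add: qnum_def P_minus P_power)

text \<open>The left sides are the eigenvalues of \<open>E_delta\<close> and \<open>F_delta\<close>
  on weight \<open>m\<close>, apart from the spectral parameter. On the right, \<open>m\<close>
  occurs in one exponential only. In \<open>u = q_*^l\<close> and \<open>v = q_*^m\<close> both are
  rational identities.\<close>

lemma qnum_quadratic:
  "qnum (l + m) * qnum (l - m + 1) - P (- 2) * (qnum (l - m) * qnum (l + m + 1)) =
     P (- 1) * (P (2 * l + 1) + P (- 2 * l - 1) - P (- 2 * m) * (p + inverse p)) / (p - inverse p)"
  "qnum (l + m) * qnum (l - m + 1) - P 2 * (qnum (l - m) * qnum (l + m + 1)) =
     - (P 1 * (P (2 * l + 1) + P (- 2 * l - 1) - P (2 * m) * (p + inverse p)) / (p - inverse p))"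
proof -
  define u v where "u = P l" and "v = P m"
  have nz: "u \<noteq> 0" "v \<noteq> 0" "p \<noteq> 0" by (simp_all add: u_def v_def)
  have d: "p ^ 2 - 1 \<noteq> 0" using p_power_ne_1[of 2] by simp
  have [simp]: "P (2 * l) = u ^ 2" "P (2 * m) = v ^ 2" "P (l * 2) = u ^ 2" "P (m * 2) = v ^ 2"
    by (simp_all add: u_def v_def P_power mult.commute)
  have e: "P (- 2) = inverse (p ^ 2)" "P (- 1) = inverse p"
    using P_minus[of 2] P_minus[of 1] by (simp_all add: P_2)
  have e1: "qnum (l + m) = (u * v - inverse (u * v)) / (p - inverse p)"
    "qnum (l - m) = (u / v - v / u) / (p - inverse p)"
    "qnum (l - m + 1) = (u * p / v - v / (u * p)) / (p - inverse p)"
    "qnum (l + m + 1) = (u * v * p - inverse (u * v * p)) / (p - inverse p)"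
    by (simp_all add: qnum_def P_add P_diff P_minus u_def v_def field_simps)
  have e2: "P (2 * l + 1) = u ^ 2 * p" "P (- 2 * l - 1) = inverse (u ^ 2 * p)" "P (- 2 * m) = inverse (v ^ 2)"
    using P_minus[of "2 * l + 1"] P_minus[of "2 * m"] by (simp_all add: P_add)
  have d': "p - inverse p = (p ^ 2 - 1) / p" using nz by (simp add: field_simps power2_eq_square)
  show "qnum (l + m) * qnum (l - m + 1) - P (- 2) * (qnum (l - m) * qnum (l + m + 1)) =
     P (- 1) * (P (2 * l + 1) + P (- 2 * l - 1) - P (- 2 * m) * (p + inverse p)) / (p - inverse p)"
    unfolding e e1 e2 d' using nz d by (simp add: divide_simps) (simp add: algebra_simps power_numeral_reduce)
  show "qnum (l + m) * qnum (l - m + 1) - P 2 * (qnum (l - m) * qnum (l + m + 1)) =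
     - (P 1 * (P (2 * l + 1) + P (- 2 * l - 1) - P (2 * m) * (p + inverse p)) / (p - inverse p))"
    unfolding P_2 e e1 e2 d' using nz d by (simp add: divide_simps) (simp add: algebra_simps power_numeral_reduce)
qed

end

section \<open>Weights of a module and weighted shifts of its basis\<close>

lemma weights_iff:
  assumes "real s = 2 * l"
  shows "m \<in> weights l \<longleftrightarrow> (\<exists>j\<le>s. m = - l + real j)"
  using assms unfolding weights_def by auto


lemma finite_weights: "real s = 2 * l \<Longrightarrow> finite (weights l)"
  using finite_surj[of "{..s}" "weights l" "\<lambda>j. - l + real j"] by (force simp: weights_iff)

lemma finite_basis: "real s = 2 * l \<Longrightarrow> finite (basis l)"
  by (simp add: basis_def finite_weights)

lemma weights_bottom:
  assumes "m \<in> weights l" "m - 1 \<notin> weights l"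
  shows "m = - l"
proof -
  from assms(1) obtain j where j: "m = - l + real j" "m \<le> l" by (auto simp: weights_def)
  show ?thesis
  proof (cases j)
    case (Suc k)
    hence "m - 1 \<in> weights l" using j by (auto simp: weights_def intro!: exI[of _ k])
    thus ?thesis using assms by simp
  qed (use j in simp)
qed

lemma weights_top:
  assumes "real s = 2 * l" "m \<in> weights l" "m + 1 \<notin> weights l"
  shows "m = l"
proof -
  from assms(1,2) obtain j where j: "j \<le> s" "m = - l + real j" by (auto simp: weights_iff)
  have "\<not> Suc j \<le> s"
    using assms(3) j by (auto simp: weights_iff[OF assms(1)] dest: spec[of _ "Suc j"])
  hence "j = s" using j by simp
  thus ?thesis using j assms(1) by simp
qed

lemma weights_between:
  assumes "m \<in> weights l" "m + real n \<in> weights l" "k \<le> n"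
  shows "m + real k \<in> weights l"
proof -
  from assms obtain j where "m = - l + real j" "m + real n \<le> l" by (auto simp: weights_def)
  thus ?thesis using assms(3) by (auto simp: weights_def intro!: exI[of _ "j + k"])
qed

lemma weights_natE:
  assumes "real s = 2 * l" "m \<in> weights l"
  obtains j k where "l + m = real j" "l - m = real k"
proof -
  from assms obtain j where "j \<le> s" "m = - l + real j" by (auto simp: weights_iff)
  thus ?thesis using assms(1) that[of j "s - j"] by (simp add: of_nat_diff)
qed

text \<open>The scalar is split into \<open>\<rho>\<close>, a power of the spectral parameter, and a complex coefficient, so that
  products of root vectors reduce to identities between complex numbers.\<close>

abbreviation flip_if :: "bool \<Rightarrow> nat \<Rightarrow> nat" where
  "flip_if s e \<equiv> (if s then 1 - e else e)"

definition hop :: "real \<Rightarrow> real \<Rightarrow> bool \<Rightarrow> laurent \<Rightarrow> (label, laurent) oper \<Rightarrow> (real \<Rightarrow> nat \<Rightarrow> complex) \<Rightarrow> bool" where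
  "hop l c s \<rho> A f \<longleftrightarrow> (\<forall>(m, e)\<in>basis l. \<forall>(m', e')\<in>basis l.
     A (m', e') (m, e) = (if m' = m + c \<and> e' = flip_if s e then \<rho> * fls_const (f m e) else 0))"

lemma hopD: "hop l c s \<rho> A f \<Longrightarrow> (m, e) \<in> basis l \<Longrightarrow> (m', e') \<in> basis l \<Longrightarrow>
    A (m', e') (m, e) = (if m' = m + c \<and> e' = flip_if s e then \<rho> * fls_const (f m e) else 0)"
  unfolding hop_def by blast

lemma hopI:
  assumes "\<And>m e m' e'. (m, e) \<in> basis l \<Longrightarrow> (m', e') \<in> basis l \<Longrightarrow>
    A (m', e') (m, e) = (if m' = m + c \<and> e' = flip_if s e then \<rho> * fls_const (f m e) else 0)"
  shows "hop l c s \<rho> A f"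
  using assms unfolding hop_def by blast

lemma hop_cong:
  assumes "hop l c s \<rho> A f" "\<rho> = \<rho>'" "c = c'" "s = s'"
    "\<And>m e. m \<in> weights l \<Longrightarrow> e \<in> {0, 1} \<Longrightarrow> f m e = g m e"
  shows "hop l c' s' \<rho>' A g"
  using assms(2-) by (intro hopI) (simp add: hopD[OF assms(1)], auto simp: basis_def)

lemma hop_scale: "hop l c s \<rho> A f \<Longrightarrow> hop l c s \<rho> (scale_op (fls_const a) A) (\<lambda>m e. a * f m e)"
  by (rule hopI) (simp add: hopD scale_op_def mult.left_commute flip: fls_const_mult_const)

lemma hop_add: "hop l c s \<rho> A f \<Longrightarrow> hop l c s \<rho> B g \<Longrightarrow> hop l c s \<rho> (add_op A B) (\<lambda>m e. f m e + g m e)"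
  by (rule hopI) (simp add: hopD add_op_def distrib_left flip: fls_plus_const)

lemma hop_diff: "hop l c s \<rho> A f \<Longrightarrow> hop l c s \<rho> B g \<Longrightarrow> hop l c s \<rho> (diff_op A B) (\<lambda>m e. f m e - g m e)"
  by (rule hopI) (simp add: hopD diff_op_def right_diff_distrib flip: fls_minus_const)

text \<open>The matrix product skips an intermediate weight outside the module, while the formula
  counts it; \<open>bd\<close> makes the coefficient vanish there whenever the final weight lies
  inside again. For the generators this holds because \<open>[l + m]\<close> and
  \<open>[l - m]\<close> vanish at the ends.\<close>

lemma hop_mult:
  assumes l: "real s = 2 * l" and A: "hop l c r \<rho> A f" and B: "hop l c' r' \<rho>' B g"
    and bd: "\<And>m e. m \<in> weights l \<Longrightarrow> m + c' \<notin> weights l \<Longrightarrow> m + c' + c \<in> weights l \<Longrightarrow> g m e = 0"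
  shows "hop l (c' + c) (r' \<noteq> r) (\<rho> * \<rho>') (mult_op (basis l) A B)
    (\<lambda>m e. f (m + c') (flip_if r' e) * g m e)"
  unfolding hop_def
proof clarify
  fix m e m' e' assume j: "(m, e) \<in> basis l" and i: "(m', e') \<in> basis l"
  have e: "e \<in> {0, 1}" "e' \<in> {0, 1}" using i j by (auto simp: basis_def)
  have me: "m \<in> weights l" "m' \<in> weights l" using i j by (auto simp: basis_def)
  let ?k = "(m + c', flip_if r' e)"
  have k: "?k \<in> basis l \<longleftrightarrow> m + c' \<in> weights l" using e by (auto simp: basis_def)
  have "mult_op (basis l) A B (m', e') (m, e) =
    (\<Sum>k\<in>basis l. if k = ?k then A (m', e') ?k * B ?k (m, e) else 0)"
    unfolding mult_op_def
  proof (intro sum.cong refl)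
    fix k assume k: "k \<in> basis l"
    show "A (m', e') k * B k (m, e) = (if k = ?k then A (m', e') ?k * B ?k (m, e) else 0)"
      using hopD[OF B j, of "fst k" "snd k"] k by (cases k) auto
  qed
  also have "\<dots> = (if m + c' \<in> weights l then A (m', e') ?k * B ?k (m, e) else 0)"
    using finite_basis[OF l] by (simp add: k)
  also have "\<dots> = (if m' = m + (c' + c) \<and> e' = flip_if (r' \<noteq> r) e
      then \<rho> * \<rho>' * fls_const (f (m + c') (flip_if r' e) * g m e) else 0)"
  proof (cases "m + c' \<in> weights l")
    case True
    hence k': "?k \<in> basis l" using k by simp
    show ?thesis
      using hopD[OF A k' i] hopD[OF B j k'] True e
      by (auto simp: add.assoc mult_ac simp flip: fls_const_mult_const)
  next
    case False
    thus ?thesis using bd[OF me(1) False, of e] me(2) by (auto simp: add.assoc)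
  qed
  finally show "mult_op (basis l) A B (m', e') (m, e) = (if m' = m + (c' + c) \<and> e' = flip_if (r' \<noteq> r) e
      then \<rho> * \<rho>' * fls_const (f (m + c') (flip_if r' e) * g m e) else 0)" .
qed

lemma hop_comm:
  assumes l: "real s = 2 * l" and A: "hop l c r \<rho> A f" and D: "hop l 0 False \<rho>' D (\<lambda>m e. d m)"
  shows "hop l c r (\<rho> * \<rho>') (comm_op (basis l) A D) (\<lambda>m e. f m e * (d m - d (m + c)))"
    and "hop l c r (\<rho> * \<rho>') (comm_op (basis l) D A) (\<lambda>m e. f m e * (d (m + c) - d m))"
proof -
  have 1: "hop l c r (\<rho> * \<rho>') (mult_op (basis l) A D) (\<lambda>m e. f m e * d m)"
    by (rule hop_cong[OF hop_mult[OF l A D]]) auto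
  have 2: "hop l c r (\<rho> * \<rho>') (mult_op (basis l) D A) (\<lambda>m e. f m e * d (m + c))"
    by (rule hop_cong[OF hop_mult[OF l D A]]) (auto simp: mult_ac)
  show "hop l c r (\<rho> * \<rho>') (comm_op (basis l) A D) (\<lambda>m e. f m e * (d m - d (m + c)))"
    unfolding comm_op_def by (rule hop_cong[OF hop_diff[OF 1 2]]) (auto simp: algebra_simps)
  show "hop l c r (\<rho> * \<rho>') (comm_op (basis l) D A) (\<lambda>m e. f m e * (d (m + c) - d m))"
    unfolding comm_op_def by (rule hop_cong[OF hop_diff[OF 2 1]]) (auto simp: algebra_simps)
qed

locale evaluation_module = generic_q +
  fixes s :: nat and l :: real and lam :: laurent
  assumes l: "real s = 2 * l" and lam: "lam \<noteq> 0"
begin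

abbreviation "E0 \<equiv> E0_ev b l lam"
abbreviation "E1 \<equiv> E1_ev b l lam"
abbreviation "F0 \<equiv> F0_ev b l lam"
abbreviation "F1 \<equiv> F1_ev b l lam"
abbreviation "I \<equiv> basis l"

lemma floor_weight:
  assumes "m \<in> weights l"
  shows "of_int \<lfloor>l - m\<rfloor> = l - m" "of_int \<lfloor>l + m\<rfloor> = l + m"
  using weights_natE[OF l assms] by (metis floor_of_nat of_int_of_nat_eq)+

lemma hop_generators:
  "hop l 1 True lam E1 (\<lambda>m e. qnum (l - m))"
  "hop l (- 1) True lam E0 (\<lambda>m e. qnum (l + m))"
  "hop l (- 1) True (inverse lam) F1 (\<lambda>m e. - ((- 1) ^ e) * \<i> * qnum (l + m))"
  "hop l 1 True (inverse lam) F0 (\<lambda>m e. - ((- 1) ^ e) * \<i> * qnum (l - m))"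
  unfolding hop_def E0_ev_def E1_ev_def F0_ev_def F1_ev_def
  by (auto simp: basis_def q_num_eq floor_weight mult_ac simp flip: fls_const_mult_const)

definition d_E :: "real \<Rightarrow> complex" where
  "d_E m = P (- 1) * (P (2 * l + 1) + P (- 2 * l - 1) - P (- 2 * m) * (p + inverse p)) / (p - inverse p)"

definition d_F :: "real \<Rightarrow> complex" where
  "d_F m = - (P 1 * (P (2 * l + 1) + P (- 2 * l - 1) - P (2 * m) * (p + inverse p)) / (p - inverse p))"

lemma neg_cancel: "w \<noteq> 0 \<Longrightarrow> - w * y * x / w = - x * y" for w x y :: complex
  by simp

lemma d_E_diff: "d_E m - d_E (m + 1) = - (p + inverse p) * P (- 2 * m - 2)"
proof -
  have "d_E m - d_E (m + 1) = P (- 1) * (P (- 2 * (m + 1)) - P (- 2 * m)) * (p + inverse p) / (p - inverse p)"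
    by (simp add: d_E_def divide_simps) (simp add: algebra_simps)
  also have "P (- 1) * (P (- 2 * (m + 1)) - P (- 2 * m)) = - (p - inverse p) * P (- 2 * m - 2)"
    unfolding right_diff_distrib left_diff_distrib mult_minus_left P_minus[of 1, symmetric]
    by (simp flip: P_add)
  finally show ?thesis by (simp only: neg_cancel[OF p_minus_nonzero])
qed

lemma d_F_diff: "d_F (m - 1) - d_F m = - (p + inverse p) * P (2 * m)"
proof -
  have "d_F (m - 1) - d_F m = P 1 * (P (2 * (m - 1)) - P (2 * m)) * (p + inverse p) / (p - inverse p)"
    by (simp add: d_F_def divide_simps) (simp add: algebra_simps)
  also have "P 1 * (P (2 * (m - 1)) - P (2 * m)) = - (p - inverse p) * P (2 * m)"
    unfolding right_diff_distrib left_diff_distrib mult_minus_left P_minus[of 1, symmetric]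
    by (simp flip: P_add)
  finally show ?thesis by (simp only: neg_cancel[OF p_minus_nonzero])
qed

lemma bottom:
  "m \<in> weights l \<Longrightarrow> m - 1 \<notin> weights l \<Longrightarrow> qnum (l + m) = 0"
  "m \<in> weights l \<Longrightarrow> m - 1 \<notin> weights l \<Longrightarrow> qnum (m + l) = 0"
  using weights_bottom[of m l] by auto

lemma top: "m \<in> weights l \<Longrightarrow> m + 1 \<notin> weights l \<Longrightarrow> qnum (l - m) = 0"
  using weights_top[OF l, of m] by simp

lemma hop_E_delta: "hop l 0 False (lam ^ 2) (E_delta b I E0 E1) (\<lambda>m e. d_E m)"
proof -
  have 1: "hop l 0 False (lam ^ 2) (mult_op I E1 E0) (\<lambda>m e. qnum (l + m) * qnum (l - m + 1))"
    by (rule hop_cong[OF hop_mult[OF l hop_generators(1,2)]])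
      (auto simp: bottom power2_eq_square mult_ac algebra_simps)
  have 2: "hop l 0 False (lam ^ 2) (mult_op I E0 E1) (\<lambda>m e. qnum (l - m) * qnum (l + m + 1))"
    by (rule hop_cong[OF hop_mult[OF l hop_generators(2,1)]])
      (auto simp: top power2_eq_square mult_ac algebra_simps)
  show ?thesis
    unfolding E_delta_def
    by (rule hop_cong[OF hop_add[OF 1 hop_scale[OF 2]]])
      (use qnum_quadratic(1)[of l] in \<open>auto simp: q_pow_minus_2 d_E_def\<close>)
qed

lemma hop_F_delta: "hop l 0 False (inverse lam ^ 2) (F_delta b I F0 F1) (\<lambda>m e. d_F m)"
proof -
  have 1: "hop l 0 False (inverse lam ^ 2) (mult_op I F0 F1) (\<lambda>m e. qnum (l + m) * qnum (l - m + 1))"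
    by (rule hop_cong[OF hop_mult[OF l hop_generators(4,3)]])
      (auto simp: bottom power2_eq_square algebra_simps)
  have 2: "hop l 0 False (inverse lam ^ 2) (mult_op I F1 F0) (\<lambda>m e. qnum (l - m) * qnum (l + m + 1))"
    by (rule hop_cong[OF hop_mult[OF l hop_generators(3,4)]])
      (auto simp: top power2_eq_square algebra_simps)
  show ?thesis
    unfolding F_delta_def
    by (rule hop_cong[OF hop_add[OF 1 hop_scale[OF 2]]])
      (use qnum_quadratic(2)[of l] in \<open>auto simp: q_pow_2 d_F_def\<close>)
qed

text \<open>The difference of neighbouring eigenvalues is \<open>-(p + 1/p)\<close> times a
  monomial, and \<open>q - 1/q = \<i> (p + 1/p)\<close>. As \<open>-1 / \<i> = \<i>\<close>, each
  commutator multiplies the coefficient by \<open>\<i>\<close> times that monomial.\<close>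

lemma commutator_factor: "1 / (\<i> * (p + inverse p)) * (x * (- (p + inverse p) * y)) = x * (\<i> * y)"
proof -
  define w where "w = p + inverse p"
  have "w \<noteq> 0" by (simp add: w_def)
  thus ?thesis unfolding w_def[symmetric] by (simp add: field_simps)
qed

lemma hop_E_plus:
  "hop l 1 True (lam ^ (2 * n + 1)) (E_plus b I E0 E1 n) (\<lambda>m e. (\<i> * P (- 2 * m - 2)) ^ n * qnum (l - m))"
proof (induction n)
  case 0
  show ?case using hop_generators(1) by simp
next
  case (Suc n)
  show ?case unfolding E_plus.simps
    by (rule hop_cong[OF hop_scale[OF hop_comm(1)[OF l Suc hop_E_delta]]])
      (simp_all only: d_E_diff qq_minus commutator_factor, simp_all add: power2_eq_square)
qed

lemma hop_E_minus:
  "hop l (- 1) True (lam ^ (2 * n + 1)) (E_minus b I E0 E1 n) (\<lambda>m e. (\<i> * P (- 2 * m)) ^ n * qnum (l + m))"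
proof (induction n)
  case 0
  show ?case using hop_generators(2) by simp
next
  case (Suc n)
  have "d_E (m + - 1) - d_E m = - (p + inverse p) * P (- 2 * m)" for m
    using d_E_diff[of "m - 1"] by (simp add: algebra_simps)
  thus ?case unfolding E_minus.simps
    by (intro hop_cong[OF hop_scale[OF hop_comm(2)[OF l Suc hop_E_delta]]])
      (simp_all only: qq_minus commutator_factor, simp_all add: power2_eq_square mult_ac)
qed

lemma hop_F_plus:
  "hop l (- 1) True (inverse lam ^ (2 * n + 1)) (F_plus b I F0 F1 n)
     (\<lambda>m e. - ((- 1) ^ e) * \<i> * (\<i> * P (2 * m)) ^ n * qnum (l + m))"
proof (induction n)
  case 0
  show ?case using hop_generators(3) by simp
next
  case (Suc n)
  have "d_F (m + - 1) - d_F m = - (p + inverse p) * P (2 * m)" for m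
    using d_F_diff[of m] by simp
  thus ?case unfolding F_plus.simps
    by (intro hop_cong[OF hop_scale[OF hop_comm(2)[OF l Suc hop_F_delta]]])
      (simp_all only: qq_minus commutator_factor, simp_all add: power2_eq_square mult_ac)
qed

lemma hop_F_minus:
  "hop l 1 True (inverse lam ^ (2 * n + 1)) (F_minus b I F0 F1 n)
     (\<lambda>m e. - ((- 1) ^ e) * \<i> * (\<i> * P (2 * m + 2)) ^ n * qnum (l - m))"
proof (induction n)
  case 0
  show ?case using hop_generators(4) by simp
next
  case (Suc n)
  have "d_F m - d_F (m + 1) = - (p + inverse p) * P (2 * m + 2)" for m
    using d_F_diff[of "m + 1"] by (simp add: algebra_simps)
  thus ?case unfolding F_minus.simps
    by (intro hop_cong[OF hop_scale[OF hop_comm(1)[OF l Suc hop_F_delta]]])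
      (simp_all only: qq_minus commutator_factor, simp_all add: power2_eq_square mult_ac)
qed

end


section \<open>The real root factors\<close>

lemma mult_op_one:
  fixes A :: "('i, 'a::semiring_1) oper"
  assumes "finite I"
  shows "j \<in> I \<Longrightarrow> mult_op I A one_op i j = A i j" "i \<in> I \<Longrightarrow> mult_op I one_op A i j = A i j"
proof -
  assume "j \<in> I"
  have "mult_op I A one_op i j = (\<Sum>k\<in>I. if k = j then A i j else 0)"
    unfolding mult_op_def by (intro sum.cong) (auto simp: one_op_def)
  thus "mult_op I A one_op i j = A i j" using assms \<open>j \<in> I\<close> by simp
next
  assume "i \<in> I"
  have "mult_op I one_op A i j = (\<Sum>k\<in>I. if k = i then A i j else 0)"
    unfolding mult_op_def by (intro sum.cong) (auto simp: one_op_def)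
  thus "mult_op I one_op A i j = A i j" using assms \<open>i \<in> I\<close> by simp
qed

context graded_shift
begin

lemma shift_rep_1I:
  assumes "\<And>i j. i \<in> I \<Longrightarrow> j \<in> I \<Longrightarrow> A i j = (if i = sh j then a j else 0)"
  shows "shift_rep A (\<lambda>n j. if n = 1 then a j else 0)"
proof (rule shift_repI)
  fix j n assume "j \<in> I" "(sh ^^ n) j \<in> I"
  thus "A ((sh ^^ n) j) j = (if n = 1 then a j else 0)"
    using assms[of "(sh ^^ n) j" j] funpow_eq_iff[of n j 1] by simp
next
  fix i j assume "i \<in> I" "j \<in> I" "\<And>n. i \<noteq> (sh ^^ n) j"
  thus "A i j = 0" using assms[of i j] by (metis funpow_0 funpow.simps(2) comp_apply)
qed

text \<open>\<open>pow_op\<close> multiplies on the left, which transposition turns into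
  multiplication on the right. The indices are restricted to \<open>I\<close> because
  \<open>one_op\<close> is a unit only there.\<close>

lemma pow_op_commute:
  assumes "i \<in> I" "j \<in> I"
  shows "mult_op I A (pow_op I A n) i j = mult_op I (pow_op I A n) A i j"
  using assms
proof (induction n arbitrary: i j)
  case 0
  thus ?case using finite_I by (simp add: mult_op_one)
next
  case (Suc n)
  have "mult_op I A (mult_op I A (pow_op I A n)) i j = mult_op I A (mult_op I (pow_op I A n) A) i j"
    by (rule mult_op_cong) (use Suc in auto)
  thus ?case by (simp add: mult_op_assoc[OF finite_I])
qed

definition tr :: "('i, 'a) oper \<Rightarrow> ('i, 'a) oper" where
  "tr A = (\<lambda>i j. A j i)"

lemma mult_op_tr: "mult_op I (tr A) (tr B) = tr (mult_op I B (A :: ('i, 'a::comm_semiring_1) oper))"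
  unfolding mult_op_def tr_def by (simp add: mult.commute)

lemma pow_op_tr:
  assumes "i \<in> I" "j \<in> I"
  shows "pow_op I (tr A) n i j = pow_op I A n j i"
  using assms
proof (induction n arbitrary: i j)
  case 0
  show ?case by (auto simp: one_op_def)
next
  case (Suc n)
  have "pow_op I (tr A) (Suc n) i j = mult_op I (tr A) (tr (pow_op I A n)) i j"
    unfolding pow_op.simps by (rule mult_op_cong) (use Suc in \<open>auto simp: tr_def\<close>)
  also have "\<dots> = mult_op I (pow_op I A n) A j i"
    unfolding mult_op_tr by (simp add: tr_def)
  also have "\<dots> = pow_op I A (Suc n) j i"
    unfolding pow_op.simps using pow_op_commute[OF Suc.prems(2,1), of A n] by (rule sym)
  finally show ?case .
qed

lemma qexp_op_tr:
  assumes "i \<in> I" "j \<in> I"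
  shows "qexp_op I q (tr A) i j = qexp_op I q A j i"
  unfolding qexp_op_def by (subst pow_op_tr[OF assms]) (rule refl)

end

context generic_q
begin

lemma P_powi: "P x powi k = P (x * of_int k)"
  by (cases k rule: int_cases2) (simp_all add: power_int_minus P_power P_minus)

text \<open>The base here is \<open>t\<close>, which is also the base \<open>-q^(-2)\<close> of the
  \<open>q\<close>-exponentials; their denominators are thus the \<open>floor_fact\<close> of the
  result.\<close>

lemma floor_fact_eq: "floor_fact p n = ceil_fact (P (- 2)) n"
  unfolding floor_fact_def ceil_fact_def floor_num_def ceil_num_def by (simp add: P_powi P_power)

lemma t_power_ne_1: "k > 0 \<Longrightarrow> P (- 2) ^ k \<noteq> 1"
  using P_nat_ne_1[of "2 * k"] P_minus[of "2 * real k"] by (simp add: P_power inverse_eq_1_iff)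

lemma q_fact_Suc: "q_fact p (Suc n) = q_fact p n * qnum (real (Suc n))"
  by (simp add: q_fact_def q_num_eq)

lemma q_fact_nonzero: "q_fact p n \<noteq> 0"
proof (induction n)
  case (Suc n)
  thus ?case using qnum_nonzero[of "Suc n"] by (simp only: q_fact_Suc) simp
qed (simp add: q_fact_def)

lemma prod_qnum_up: "(\<Prod>u<n. qnum (real k + 1 + real u)) = q_fact p (k + n) / q_fact p k"
proof (induction n)
  case 0
  show ?case by (simp add: q_fact_nonzero)
next
  case (Suc n)
  have "qnum (real k + 1 + real n) = qnum (real (Suc (k + n)))" by (simp add: algebra_simps)
  thus ?case unfolding prod.lessThan_Suc Suc add_Suc_right q_fact_Suc by simp
qed

lemma prod_qnum_down:
  assumes "n \<le> k"
  shows "(\<Prod>u<n. qnum (real k - real u)) = q_fact p k / q_fact p (k - n)"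
proof -
  have "(\<Prod>u<n. qnum (real k - real u)) = (\<Prod>u<n. qnum (real (k - n) + 1 + real u))"
    by (rule prod.reindex_bij_witness[of _ "\<lambda>u. n - 1 - u" "\<lambda>u. n - 1 - u"])
      (use assms in \<open>auto simp: of_nat_diff algebra_simps\<close>)
  also have "\<dots> = q_fact p (k - n + n) / q_fact p (k - n)"
    by (rule prod_qnum_up)
  finally show ?thesis using assms by simp
qed

end

text \<open>Each of \<open>n\<close> shifts contributes the same sign. For
  \<open>e1 = e2 = 0\<close> the exponent is \<open>-n\<close>, hence the integer power.\<close>

lemma minus_one_powi_sign:
  assumes "e1 \<in> {0, 1}" "e2 \<in> {0, 1}"
  shows "(- 1 :: complex) powi (int n * (int e1 + int e2 - 1)) = (- ((- 1) ^ (e1 + e2))) ^ n"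
proof -
  have "inverse ((- 1 :: complex) ^ n) = (- 1) ^ n" by (cases "even n") auto
  thus ?thesis using assms by (auto simp: power_int_minus)
qed

locale tensor_modules = generic_q +
  fixes s1 s2 :: nat and l1 l2 :: real and lam1 lam2 :: laurent
  assumes l1: "real s1 = 2 * l1" and l2: "real s2 = 2 * l2"
    and lam1: "lam1 \<noteq> 0" and lam2: "lam2 \<noteq> 0" and formal: "lam1 / lam2 = fls_X"
begin

sublocale ev1: evaluation_module b s1 l1 lam1
  by unfold_locales (use l1 lam1 in auto)

sublocale ev2: evaluation_module b s2 l2 lam2
  by unfold_locales (use l2 lam2 in auto)

lemma lam1_eq: "lam1 = fls_X * lam2"
  using formal lam2 by (simp add: field_simps)

lemma lam_ratio: "lam1 ^ k * inverse lam2 ^ k = fls_X ^ k"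
  using formal by (simp add: divide_inverse flip: power_mult_distrib)

abbreviation I :: "(label \<times> label) set" where "I \<equiv> basis l1 \<times> basis l2"

definition sh :: "label \<times> label \<Rightarrow> label \<times> label" where
  "sh = (\<lambda>((m1, e1), (m2, e2)). ((m1 + 1, 1 - e1), (m2 - 1, 1 - e2)))"

lemma sh_funpow:
  assumes "e1 \<in> {0, 1}" "e2 \<in> {0, 1}"
  shows "(sh ^^ u) ((m1, e1), (m2, e2)) =
    ((m1 + real u, (e1 + u) mod 2), (m2 - real u, (e2 + u) mod 2))"
proof (induction u)
  case 0
  show ?case using assms by auto
next
  case (Suc u)
  have "1 - (e + u) mod 2 = (e + Suc u) mod 2" for e :: nat
    by (cases "(e + u) mod 2 = 0") (auto simp: mod_Suc)
  thus ?case unfolding funpow.simps comp_apply Suc by (simp add: sh_def)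
qed

sublocale sh: graded_shift I sh "\<lambda>j. fst (fst j)"
proof
  show "finite I" using finite_basis l1 l2 by blast
  show "fst (fst (sh i)) = fst (fst i) + 1" for i by (auto simp: sh_def split: prod.splits)
  fix j n k assume j: "j \<in> I" and n: "(sh ^^ n) j \<in> I" and k: "k \<le> n"
  obtain m1 e1 m2 e2 where jj: "j = ((m1, e1), (m2, e2))" by (metis surj_pair)
  have e: "e1 \<in> {0, 1}" "e2 \<in> {0, 1}" using j by (auto simp: jj basis_def)
  have w: "m1 \<in> weights l1" "m1 + real n \<in> weights l1" "m2 \<in> weights l2" "m2 - real n \<in> weights l2"
    using j n by (auto simp: jj sh_funpow[OF e] basis_def)
  have "m1 + real k \<in> weights l1"
    by (rule weights_between[OF w(1,2) k])
  moreover have "m2 - real n + real (n - k) \<in> weights l2"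
    by (rule weights_between[OF w(4), of n]) (use w k in auto)
  ultimately show "(sh ^^ k) j \<in> I"
    using k by (auto simp: jj sh_funpow[OF e] basis_def of_nat_diff)
qed

text \<open>For the positive roots, one more imaginary step multiplies the coefficient of
  \<open>E_plus\<close> by \<open>\<i> lam1^2 q_*^(-2 m1 - 2)\<close> and that of
  \<open>F_plus\<close> by \<open>\<i> lam2^(-2) q_*^(2 m2)\<close>. The product is
  \<open>-x\<close>, and \<open>(-1)^(n + 1)\<close> absorbs the sign.\<close>

definition x :: "label \<times> label \<Rightarrow> laurent" where
  "x = (\<lambda>((m1, e1), (m2, e2)). fls_X ^ 2 * fls_const (P (2 * m2 - 2 * m1 - 2)))"

definition \<tau>_pos :: "label \<times> label \<Rightarrow> laurent" where
  "\<tau>_pos = (\<lambda>((m1, e1), (m2, e2)). fls_X *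
     fls_const (- ((- 1) ^ (e1 + e2)) * (p - inverse p) * (qnum (l1 - m1) * qnum (l2 + m2))))"

text \<open>An entry of the transposed operator: it describes the transition from
  \<open>sh j\<close> back to \<open>j\<close>, so the \<open>q\<close>-numbers are taken at the
  weights \<open>m1 + 1\<close> and \<open>m2 - 1\<close> of \<open>sh j\<close>.\<close>

definition \<tau>_neg :: "label \<times> label \<Rightarrow> laurent" where
  "\<tau>_neg = (\<lambda>((m1, e1), (m2, e2)). fls_X *
     fls_const (- ((- 1) ^ (e1 + e2)) * (p - inverse p) * (qnum (l1 + m1 + 1) * qnum (l2 - m2 + 1))))"

abbreviation R_pos_arg where
  "R_pos_arg n \<equiv> scale_op (fls_const ((- 1) ^ (n + 1) * (qq b + inverse (qq b))))
     (stensor (E_plus b (basis l1) ev1.E0 ev1.E1 n) (F_plus b (basis l2) ev2.F0 ev2.F1 n))"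

abbreviation R_neg_arg where
  "R_neg_arg n \<equiv> scale_op (fls_const ((- 1) ^ (n + 1) * (qq b + inverse (qq b))))
     (stensor (E_minus b (basis l1) ev1.E0 ev1.E1 n) (F_minus b (basis l2) ev2.F0 ev2.F1 n))"

text \<open>The sign count common to both kinds of real roots. One \<open>\<i>\<close> comes from
  \<open>q + 1/q = \<i> (p - 1/p)\<close>, one from the action of the \<open>F\<close> generator,
  and \<open>\<i>^(2n)\<close> from the imaginary steps; with \<open>(-1)^(n + 1)\<close> they
  multiply to \<open>1\<close>. There remain the super sign \<open>(-1)^e\<close> and the
  \<open>-(-1)^e'\<close> of the generator.\<close>

lemma root_factor_coeff:
  fixes e e' :: nat
  shows "fls_const ((- 1) ^ (n + 1) * (qq b + inverse (qq b))) *
    ((- 1) ^ e * (lam1 ^ (2 * n + 1) * fls_const ((\<i> * P y) ^ n * N)) *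
      (inverse lam2 ^ (2 * n + 1) * fls_const (- ((- 1) ^ e') * \<i> * (\<i> * P y') ^ n * N'))) =
    fls_X * fls_const (- ((- 1) ^ (e + e')) * (p - inverse p) * (N * N')) *
      (fls_X ^ 2 * fls_const (P (y + y'))) ^ n"
proof -
  have "(- 1 :: laurent) ^ e = fls_const ((- 1) ^ e)" by (simp add: fls_const_power)
  hence "fls_const ((- 1) ^ (n + 1) * (qq b + inverse (qq b))) *
    ((- 1) ^ e * (lam1 ^ (2 * n + 1) * fls_const ((\<i> * P y) ^ n * N)) *
      (inverse lam2 ^ (2 * n + 1) * fls_const (- ((- 1) ^ e') * \<i> * (\<i> * P y') ^ n * N'))) =
    (lam1 ^ (2 * n + 1) * inverse lam2 ^ (2 * n + 1)) *
    fls_const ((- 1) ^ (n + 1) * (qq b + inverse (qq b)) * (- 1) ^ e * ((\<i> * P y) ^ n * N) *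
      (- ((- 1) ^ e') * \<i> * (\<i> * P y') ^ n * N'))"
    by (simp only: fls_const_mult_const[symmetric] mult_ac)
  also have "(- 1) ^ (n + 1) * (qq b + inverse (qq b)) * (- 1) ^ e * ((\<i> * P y) ^ n * N) *
      (- ((- 1) ^ e') * \<i> * (\<i> * P y') ^ n * N') =
      - ((- 1) ^ (e + e')) * (p - inverse p) * (N * N') * ((\<i> * \<i>) * (- 1) ^ (n + 1) * ((\<i> * P y) ^ n * (\<i> * P y') ^ n))"
    unfolding qq_plus power_add by (simp only: mult_ac mult_minus_left mult_minus_right)
  also have "(\<i> * P y) ^ n * (\<i> * P y') ^ n = (- 1) ^ n * P (y + y') ^ n"
  proof -
    have "(\<i> * P y) ^ n * (\<i> * P y') ^ n = (\<i> * \<i>) ^ n * (P y * P y') ^ n"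
      by (simp only: power_mult_distrib mult_ac)
    thus ?thesis by (simp add: P_add)
  qed
  also have "(\<i> * \<i>) * (- 1) ^ (n + 1) * ((- 1) ^ n * P (y + y') ^ n) = P (y + y') ^ n"
  proof -
    have "(\<i> * \<i>) * (- 1) ^ (n + 1) * (- 1) ^ n = 1" by simp
    thus ?thesis by (metis mult.assoc mult_1)
  qed
  also have "lam1 ^ (2 * n + 1) * inverse lam2 ^ (2 * n + 1) = fls_X * (fls_X ^ 2) ^ n"
    unfolding lam_ratio by (simp flip: power_mult)
  finally show ?thesis
    by (simp only: power_mult_distrib fls_const_power fls_const_mult_const[symmetric] mult_ac)
qed

lemma shift_rep_R_pos_arg: "sh.shift_rep (R_pos_arg n) (\<lambda>m j. if m = 1 then \<tau>_pos j * x j ^ n else 0)"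
proof (rule sh.shift_rep_1I)
  fix i j assume i: "i \<in> I" and j: "j \<in> I"
  obtain m1 e1 m2 e2 m1' e1' m2' e2' where ij: "j = ((m1, e1), (m2, e2))" "i = ((m1', e1'), (m2', e2'))"
    by (metis surj_pair)
  have B: "(m1, e1) \<in> basis l1" "(m1', e1') \<in> basis l1" "(m2, e2) \<in> basis l2" "(m2', e2') \<in> basis l2"
    using i j by (auto simp: ij)
  have e: "e2 \<in> {0, 1}" using B by (auto simp: basis_def)
  show "R_pos_arg n i j = (if i = sh j then \<tau>_pos j * x j ^ n else 0)"
  proof (cases "i = sh j")
    case True
    hence ie: "m1' = m1 + 1" "e1' = 1 - e1" "m2' = m2 + - 1" "e2' = 1 - e2" by (auto simp: ij sh_def)
    \<comment> \<open>The second tensor factor is odd, so the exponent of the super sign reduces to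
      \<open>e1\<close>.\<close>
    have "Suc 0 - e2 + e2 = Suc 0" using e by auto
    hence "R_pos_arg n i j = fls_const ((- 1) ^ (n + 1) * (qq b + inverse (qq b))) *
      ((- 1) ^ e1 * (lam1 ^ (2 * n + 1) * fls_const ((\<i> * P (- 2 * m1 - 2)) ^ n * qnum (l1 - m1))) *
      (inverse lam2 ^ (2 * n + 1) * fls_const (- ((- 1) ^ e2) * \<i> * (\<i> * P (2 * m2)) ^ n * qnum (l2 + m2))))"
      unfolding scale_op_def stensor_def ij
      using hopD[OF ev1.hop_E_plus B(1,2), of n] hopD[OF ev2.hop_F_plus B(3,4), of n] ie by simp
    also have "\<dots> = \<tau>_pos j * x j ^ n"
      unfolding root_factor_coeff by (simp add: ij \<tau>_pos_def x_def algebra_simps)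
    finally show ?thesis using True by simp
  next
    case False
    hence "\<not> (m1' = m1 + 1 \<and> e1' = 1 - e1) \<or> \<not> (m2' = m2 + - 1 \<and> e2' = 1 - e2)"
      by (auto simp: ij sh_def)
    hence "E_plus b (basis l1) ev1.E0 ev1.E1 n (m1', e1') (m1, e1) *
        F_plus b (basis l2) ev2.F0 ev2.F1 n (m2', e2') (m2, e2) = 0"
      using hopD[OF ev1.hop_E_plus B(1,2), of n] hopD[OF ev2.hop_F_plus B(3,4), of n] by auto
    thus ?thesis using False by (auto simp: scale_op_def stensor_def ij)
  qed
qed

lemma shift_rep_R_neg_arg:
  "sh.shift_rep (sh.tr (R_neg_arg n)) (\<lambda>m j. if m = 1 then \<tau>_neg j * x j ^ n else 0)"
proof (rule sh.shift_rep_1I)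
  fix i j assume i: "i \<in> I" and j: "j \<in> I"
  obtain m1 e1 m2 e2 m1' e1' m2' e2' where ij: "j = ((m1, e1), (m2, e2))" "i = ((m1', e1'), (m2', e2'))"
    by (metis surj_pair)
  have B: "(m1, e1) \<in> basis l1" "(m1', e1') \<in> basis l1" "(m2, e2) \<in> basis l2" "(m2', e2') \<in> basis l2"
    using i j by (auto simp: ij)
  have e: "e1 \<in> {0, 1}" "e2 \<in> {0, 1}" "e1' \<in> {0, 1}" "e2' \<in> {0, 1}" using B by (auto simp: basis_def)
  show "sh.tr (R_neg_arg n) i j = (if i = sh j then \<tau>_neg j * x j ^ n else 0)"
  proof (cases "i = sh j")
    case True
    hence ie: "m1' = m1 + 1" "e1' = 1 - e1" "m2' = m2 - 1" "e2' = 1 - e2" by (auto simp: ij sh_def)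
    hence ie': "m1 = m1' + - 1 \<and> e1 = 1 - e1'" "m2 = m2' + 1 \<and> e2 = 1 - e2'"
      using e(1,2) by (elim insertE; simp)+
    have "Suc 0 - e2' + e2' = Suc 0" using e by auto
    hence "sh.tr (R_neg_arg n) i j = fls_const ((- 1) ^ (n + 1) * (qq b + inverse (qq b))) *
      ((- 1) ^ e1' * (lam1 ^ (2 * n + 1) * fls_const ((\<i> * P (- 2 * m1')) ^ n * qnum (l1 + m1'))) *
      (inverse lam2 ^ (2 * n + 1) * fls_const (- ((- 1) ^ e2') * \<i> * (\<i> * P (2 * m2' + 2)) ^ n * qnum (l2 - m2'))))"
      unfolding scale_op_def stensor_def ij sh.tr_def
      using hopD[OF ev1.hop_E_minus B(2,1), of n] hopD[OF ev2.hop_F_minus B(4,3), of n] ie' by simp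
    also have "\<dots> = \<tau>_neg j * x j ^ n"
    proof -
      have "(- 1 :: complex) ^ (e1' + e2') = (- 1) ^ (e1 + e2)" using e ie by auto
      thus ?thesis
        unfolding root_factor_coeff by (simp add: ij ie \<tau>_neg_def x_def algebra_simps)
    qed
    finally show ?thesis using True by simp
  next
    case False
    hence "\<not> (m1' = m1 + 1 \<and> e1' = 1 - e1) \<or> \<not> (m2' = m2 - 1 \<and> e2' = 1 - e2)"
      by (simp add: ij sh_def)
    moreover have flip: "a = 1 - c \<longleftrightarrow> c = 1 - a" if "a \<in> {0, 1}" "c \<in> {0, 1}" for a c :: nat
      using that by auto
    moreover have "m1 = m1' + - 1 \<longleftrightarrow> m1' = m1 + 1" "m2 = m2' + 1 \<longleftrightarrow> m2' = m2 - 1"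
      by linarith+
    ultimately have "\<not> (m1 = m1' + - 1 \<and> e1 = 1 - e1') \<or> \<not> (m2 = m2' + 1 \<and> e2 = 1 - e2')"
      by (simp only: flip[OF e(1) e(3)] flip[OF e(2) e(4)])
    hence "E_minus b (basis l1) ev1.E0 ev1.E1 n (m1, e1) (m1', e1') *
        F_minus b (basis l2) ev2.F0 ev2.F1 n (m2, e2) (m2', e2') = 0"
      using hopD[OF ev1.hop_E_minus B(2,1), of n] hopD[OF ev2.hop_F_minus B(4,3), of n] by auto
    thus ?thesis using False by (auto simp: scale_op_def stensor_def ij sh.tr_def)
  qed
qed

lemma x_sh: "x (sh j) = fls_const (P (- 2) ^ 2) * x j"
proof -
  obtain m1 e1 m2 e2 where j: "j = ((m1, e1), (m2, e2))" by (metis surj_pair)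
  have "P (2 * (m2 - 1) - 2 * (m1 + 1) - 2) = P (- 2) ^ 2 * P (2 * m2 - 2 * m1 - 2)"
    unfolding P_power P_add[symmetric] by (simp add: algebra_simps)
  thus ?thesis
    by (simp only: j x_def sh_def prod.case fls_const_mult_const[symmetric] mult_ac)
qed

lemma ord_x: "ord_ge 1 (x j)"
proof -
  obtain m1 e1 m2 e2 where j: "j = ((m1, e1), (m2, e2))" by (metis surj_pair)
  have "ord_ge 0 (fls_X * fls_const (P (2 * m2 - 2 * m1 - 2)))"
    by (rule ord_ge_mono[OF ord_ge_fls_X_mult]) simp_all
  hence "ord_ge 1 (fls_X * (fls_X * fls_const (P (2 * m2 - 2 * m1 - 2))))"
    by (rule ord_ge_fls_X_mult)
  thus ?thesis by (simp add: j x_def power2_eq_square mult.assoc)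
qed

lemma ord_\<tau>: "ord_ge 0 (\<tau>_pos j)" "ord_ge 0 (\<tau>_neg j)"
proof -
  obtain m1 e1 m2 e2 where j: "j = ((m1, e1), (m2, e2))" by (metis surj_pair)
  show "ord_ge 0 (\<tau>_pos j)" "ord_ge 0 (\<tau>_neg j)"
    unfolding j \<tau>_pos_def \<tau>_neg_def prod.case
    by (rule ord_ge_mono[OF ord_ge_fls_X_mult[OF ord_ge_const]], simp)+
qed

definition coeffs :: "(label \<times> label \<Rightarrow> laurent) \<Rightarrow> nat \<Rightarrow> label \<times> label \<Rightarrow> laurent" where
  "coeffs \<tau> m j = (\<Prod>u<m. \<tau> ((sh ^^ u) j)) /
    (fls_const (ceil_fact (P (- 2)) m) * (\<Prod>u<m. 1 - x j * fls_const (P (- 2)) ^ u))"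

lemma R_pos_eq:
  assumes "i \<in> I" "j \<in> I"
  shows "R_pos b l1 l2 lam1 lam2 i j = sh.of_coeffs (coeffs \<tau>_pos) i j"
proof -
  have "R_pos_upto b l1 l2 lam1 lam2 N = sh.upto_op (\<lambda>n. qexp_op I (P (- 2)) (R_pos_arg n)) N" for N
    by (induction N) (simp_all add: R_pos_factor_def q_pow_minus_2)
  moreover have "(\<lambda>N. sh.upto_op (\<lambda>n. qexp_op I (P (- 2)) (R_pos_arg n)) N i j)
      \<longlonglongrightarrow> sh.of_coeffs (coeffs \<tau>_pos) i j"
    by (rule sh.upto_op_tendsto[OF t_power_ne_1 shift_rep_R_pos_arg x_sh ord_x ord_\<tau>(1)
          sh.shift_rep_cong[OF sh.shift_rep_of_coeffs coeffs_def] assms])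
  ultimately show ?thesis by (simp add: R_pos_def limI)
qed

lemma R_neg_eq:
  assumes i: "i \<in> I" and j: "j \<in> I"
  shows "R_neg b l1 l2 lam1 lam2 i j = sh.of_coeffs (coeffs \<tau>_neg) j i"
proof -
  have "R_neg_upto b l1 l2 lam1 lam2 N i j =
      sh.upto_op (\<lambda>n. qexp_op I (P (- 2)) (sh.tr (R_neg_arg n))) N j i" for N
    using i j
  proof (induction N arbitrary: i j)
    case 0
    show ?case by (auto simp: one_op_def)
  next
    case (Suc N)
    have "(\<Sum>k\<in>I. R_neg_factor b l1 l2 lam1 lam2 N i k * R_neg_upto b l1 l2 lam1 lam2 N k j) =
      (\<Sum>k\<in>I. sh.upto_op (\<lambda>n. qexp_op I (P (- 2)) (sh.tr (R_neg_arg n))) N j k *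
        qexp_op I (P (- 2)) (sh.tr (R_neg_arg N)) k i)"
    proof (intro sum.cong refl)
      fix k assume k: "k \<in> I"
      have "R_neg_factor b l1 l2 lam1 lam2 N i k = qexp_op I (P (- 2)) (sh.tr (R_neg_arg N)) k i"
        unfolding sh.qexp_op_tr[OF k Suc.prems(1)] by (simp add: R_neg_factor_def q_pow_minus_2)
      thus "R_neg_factor b l1 l2 lam1 lam2 N i k * R_neg_upto b l1 l2 lam1 lam2 N k j =
        sh.upto_op (\<lambda>n. qexp_op I (P (- 2)) (sh.tr (R_neg_arg n))) N j k *
        qexp_op I (P (- 2)) (sh.tr (R_neg_arg N)) k i"
        using Suc.IH[OF k Suc.prems(2)] by (simp add: mult.commute)
    qed
    thus ?case by (simp add: mult_op_def)
  qed
  moreover have "(\<lambda>N. sh.upto_op (\<lambda>n. qexp_op I (P (- 2)) (sh.tr (R_neg_arg n))) N j i)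
      \<longlonglongrightarrow> sh.of_coeffs (coeffs \<tau>_neg) j i"
    by (rule sh.upto_op_tendsto[OF t_power_ne_1 shift_rep_R_neg_arg x_sh ord_x ord_\<tau>(2)
          sh.shift_rep_cong[OF sh.shift_rep_of_coeffs coeffs_def] assms(2,1)])
  ultimately show ?thesis by (simp add: R_neg_def limI)
qed

end


section \<open>Closed formulas for the coefficients of the real root factors\<close>

context tensor_modules
begin

lemma lam_factor: "lam2\<^sup>2 - fls_const c * lam1\<^sup>2 = lam2\<^sup>2 * (1 - fls_X ^ 2 * fls_const c)"
  unfolding lam1_eq power_mult_distrib right_diff_distrib by (simp only: mult_1_right mult_1_left mult_ac)

text \<open>Separates the complex constants, which are compared in the hypothesis, from the spectral
  parameters, where \<open>(lam1 lam2)^n / lam2^(2n)\<close> is the \<open>n\<close>-th power of the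
  formal variable.\<close>

lemma assemble_coefficient:
  assumes "A / c = B * C1 * C2"
  shows "fls_X ^ n * fls_const A / (fls_const c * D) =
    fls_const B * (lam1 * lam2) ^ n / (lam2 ^ (2 * n) * D) * fls_const C1 * fls_const C2"
proof -
  have nz: "lam2 ^ (2 * n) \<noteq> 0" using lam2 by simp
  have "(lam1 * lam2) ^ n = fls_X ^ n * lam2 ^ (2 * n)"
    by (simp only: lam1_eq power_mult_distrib power_mult power2_eq_square mult_ac)
  hence "fls_const B * (lam1 * lam2) ^ n / (lam2 ^ (2 * n) * D) =
      (lam2 ^ (2 * n) * (fls_const B * fls_X ^ n)) / (lam2 ^ (2 * n) * D)"
    by (simp only: mult_ac)
  also have "\<dots> = fls_const B * fls_X ^ n / D"
    by (rule mult_divide_mult_cancel_left[OF nz])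
  finally have *: "fls_const B * (lam1 * lam2) ^ n / (lam2 ^ (2 * n) * D) = fls_const B * fls_X ^ n / D" .
  have "fls_const B * (lam1 * lam2) ^ n / (lam2 ^ (2 * n) * D) * fls_const C1 * fls_const C2 =
      fls_X ^ n * (fls_const B * fls_const C1 * fls_const C2) / D"
    unfolding * by (simp only: times_divide_eq_left times_divide_eq_right mult_ac)
  also have "fls_const B * fls_const C1 * fls_const C2 = fls_const (A / c)"
    unfolding assms by (simp only: fls_const_mult_const)
  also have "\<dots> = fls_const A / fls_const c"
    by (rule fls_const_divide_const[symmetric])
  finally have "fls_const B * (lam1 * lam2) ^ n / (lam2 ^ (2 * n) * D) * fls_const C1 * fls_const C2 =
    fls_X ^ n * (fls_const A / fls_const c) / D" .
  thus ?thesis by (metis times_divide_eq_right divide_divide_eq_left)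
qed

lemma coeffs_pos_formula:
  assumes m: "m1 \<in> weights l1" "m1 + real n \<in> weights l1" "m2 \<in> weights l2" "m2 - real n \<in> weights l2"
    and e: "e1 \<in> {0, 1}" "e2 \<in> {0, 1}"
  shows "coeffs \<tau>_pos n ((m1, e1), (m2, e2)) =
    fls_const ((- 1) powi (int n * (int e1 + int e2 - 1)) * (p - inverse p) ^ n)
     * (lam1 * lam2) ^ n
     / (\<Prod>k=1..n. lam2\<^sup>2 - fls_const (P (2 * m2 - 2 * m1 - 2 * real k)) * lam1\<^sup>2)
     * fls_const (q_fact p (nat \<lfloor>l1 - m1\<rfloor>) / (floor_fact p n * q_fact p (nat \<lfloor>l1 - m1 - real n\<rfloor>)))
     * fls_const (q_fact p (nat \<lfloor>l2 + m2\<rfloor>) / q_fact p (nat \<lfloor>l2 + m2 - real n\<rfloor>))"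
proof -
  obtain k1 k1' where k1: "l1 - m1 = real k1" "l1 - (m1 + real n) = real k1'"
    using weights_natE[OF l1 m(1)] weights_natE[OF l1 m(2)] by metis
  obtain k2 k2' where k2: "l2 + m2 = real k2" "l2 + (m2 - real n) = real k2'"
    using weights_natE[OF l2 m(3)] weights_natE[OF l2 m(4)] by metis
  have n: "n \<le> k1" "n \<le> k2" and k': "k1' = k1 - n" "k2' = k2 - n" using k1 k2 by linarith+
  have fl: "l1 - m1 - real n = real k1'" "l2 + m2 - real n = real k2'" using k1 k2 by auto
  define \<sigma> where "\<sigma> = - ((- 1 :: complex) ^ (e1 + e2))"
  \<comment> \<open>Both parities flip at every shift, so the sign is constant along the
    orbit.\<close>
  have \<sigma>: "- ((- 1 :: complex) ^ ((e1 + u) mod 2 + (e2 + u) mod 2)) = \<sigma>" for u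
    unfolding \<sigma>_def using e by (auto simp: minus_one_power_iff)
  define t where "t = P (- 2)"
  have "(\<Prod>u<n. \<tau>_pos ((sh ^^ u) ((m1, e1), (m2, e2)))) =
      (\<Prod>u<n. fls_X * fls_const (\<sigma> * (p - inverse p) * (qnum (real k1 - real u) * qnum (real k2 - real u))))"
  proof (intro prod.cong refl)
    fix u
    have q: "l1 - (m1 + real u) = real k1 - real u" "l2 + (m2 - real u) = real k2 - real u"
      using k1 k2 by auto
    show "\<tau>_pos ((sh ^^ u) ((m1, e1), (m2, e2))) =
      fls_X * fls_const (\<sigma> * (p - inverse p) * (qnum (real k1 - real u) * qnum (real k2 - real u)))"
      unfolding sh_funpow[OF e] \<tau>_pos_def prod.case \<sigma> q ..
  qed
  also have "\<dots> = fls_X ^ n * fls_const (\<Prod>u<n. \<sigma> * (p - inverse p) * (qnum (real k1 - real u) * qnum (real k2 - real u)))"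
    by (induction n) (simp_all add: mult_ac flip: fls_const_mult_const)
  also have "(\<Prod>u<n. \<sigma> * (p - inverse p) * (qnum (real k1 - real u) * qnum (real k2 - real u))) =
      (\<sigma> * (p - inverse p)) ^ n * (q_fact p k1 / q_fact p k1' * (q_fact p k2 / q_fact p k2'))"
    by (simp add: prod.distrib prod_qnum_down n k')
  finally have num: "(\<Prod>u<n. \<tau>_pos ((sh ^^ u) ((m1, e1), (m2, e2)))) = fls_X ^ n *
    fls_const ((\<sigma> * (p - inverse p)) ^ n * (q_fact p k1 / q_fact p k1' * (q_fact p k2 / q_fact p k2')))" .
  define D where "D = (\<Prod>u<n. 1 - x ((m1, e1), (m2, e2)) * fls_const t ^ u)"
  have "(\<Prod>k=1..n. lam2\<^sup>2 - fls_const (P (2 * m2 - 2 * m1 - 2 * real k)) * lam1\<^sup>2) =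
      (\<Prod>u<n. lam2\<^sup>2 - fls_const (P (2 * m2 - 2 * m1 - 2 * real (Suc u))) * lam1\<^sup>2)"
    by (rule prod.reindex_bij_witness[of _ Suc "\<lambda>k. k - 1"]) auto
  also have "\<dots> = (\<Prod>u<n. lam2\<^sup>2 * (1 - x ((m1, e1), (m2, e2)) * fls_const t ^ u))"
  proof (intro prod.cong refl)
    fix u
    have "P (2 * m2 - 2 * m1 - 2 * real (Suc u)) = P (2 * m2 - 2 * m1 - 2) * t ^ u"
      unfolding t_def P_power P_add[symmetric] by (simp add: algebra_simps)
    thus "lam2\<^sup>2 - fls_const (P (2 * m2 - 2 * m1 - 2 * real (Suc u))) * lam1\<^sup>2 =
        lam2\<^sup>2 * (1 - x ((m1, e1), (m2, e2)) * fls_const t ^ u)"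
      unfolding lam_factor by (simp add: x_def mult.assoc flip: fls_const_power)
  qed
  also have "\<dots> = lam2 ^ (2 * n) * D"
    by (simp add: prod.distrib D_def flip: power_mult)
  finally have den: "(\<Prod>k=1..n. lam2\<^sup>2 - fls_const (P (2 * m2 - 2 * m1 - 2 * real k)) * lam1\<^sup>2) =
    lam2 ^ (2 * n) * D" .
  show ?thesis
    unfolding coeffs_def num den t_def[symmetric] D_def[symmetric] fl
    unfolding k1(1) k2(1) floor_of_nat nat_int
    by (rule assemble_coefficient)
      (simp only: floor_fact_eq minus_one_powi_sign[OF e] \<sigma>_def t_def power_mult_distrib
      times_divide_eq_left times_divide_eq_right divide_divide_eq_left mult_ac)
qed

text \<open>The right side is written in the source label, whereas the transposed coefficient is
  indexed by the target, \<open>n\<close> steps lower in \<open>m1\<close>. The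
  \<open>q\<close>-numbers hence ascend from the target, and \<open>prod_qnum_up\<close> takes the
  place of \<open>prod_qnum_down\<close>.\<close>

lemma coeffs_neg_formula:
  assumes m: "m1 \<in> weights l1" "m1 - real n \<in> weights l1" "m2 \<in> weights l2" "m2 + real n \<in> weights l2"
    and e: "e1 \<in> {0, 1}" "e2 \<in> {0, 1}"
  shows "coeffs \<tau>_neg n ((m1 - real n, (e1 + n) mod 2), (m2 + real n, (e2 + n) mod 2)) =
    fls_const ((- 1) powi (int n * (int e1 + int e2 - 1)) * (p - inverse p) ^ n)
     * (lam1 * lam2) ^ n
     / (\<Prod>k=1..n. lam2\<^sup>2 - fls_const (P (2 * m2 - 2 * m1 + 2 * (real k + real n - 1))) * lam1\<^sup>2)
     * fls_const (q_fact p (nat \<lfloor>l1 + m1\<rfloor>) / (floor_fact p n * q_fact p (nat \<lfloor>l1 + m1 - real n\<rfloor>)))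
     * fls_const (q_fact p (nat \<lfloor>l2 - m2\<rfloor>) / q_fact p (nat \<lfloor>l2 - m2 - real n\<rfloor>))"
proof -
  obtain k1 k1' where k1: "l1 + m1 = real k1" "l1 + (m1 - real n) = real k1'"
    using weights_natE[OF l1 m(1)] weights_natE[OF l1 m(2)] by metis
  obtain k2 k2' where k2: "l2 - m2 = real k2" "l2 - (m2 + real n) = real k2'"
    using weights_natE[OF l2 m(3)] weights_natE[OF l2 m(4)] by metis
  have k: "k1 = k1' + n" "k2 = k2' + n" using k1 k2 by linarith+
  have fl: "l1 + m1 - real n = real k1'" "l2 - m2 - real n = real k2'" using k1 k2 by auto
  define \<sigma> where "\<sigma> = - ((- 1 :: complex) ^ (e1 + e2))"
  have \<sigma>: "- ((- 1 :: complex) ^ ((e1 + u) mod 2 + (e2 + u) mod 2)) = \<sigma>" for u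
    unfolding \<sigma>_def using e by (auto simp: minus_one_power_iff)
  have e': "(e1 + n) mod 2 \<in> {0, 1}" "(e2 + n) mod 2 \<in> {0, 1}" by auto
  define t where "t = P (- 2)"
  let ?i = "((m1 - real n, (e1 + n) mod 2), (m2 + real n, (e2 + n) mod 2))"
  have "(\<Prod>u<n. \<tau>_neg ((sh ^^ u) ?i)) =
      (\<Prod>u<n. fls_X * fls_const (\<sigma> * (p - inverse p) * (qnum (real k1' + 1 + real u) * qnum (real k2' + 1 + real u))))"
  proof (intro prod.cong refl)
    fix u
    have par: "((e + n) mod 2 + u) mod 2 = (e + (n + u)) mod 2" for e :: nat
      by (simp add: mod_add_left_eq add.assoc)
    have q: "l1 + (m1 - real n + real u) + 1 = real k1' + 1 + real u"
      "l2 - (m2 + real n - real u) + 1 = real k2' + 1 + real u"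
      using k1 k2 by auto
    show "\<tau>_neg ((sh ^^ u) ?i) =
      fls_X * fls_const (\<sigma> * (p - inverse p) * (qnum (real k1' + 1 + real u) * qnum (real k2' + 1 + real u)))"
      unfolding sh_funpow[OF e'] \<tau>_neg_def prod.case par \<sigma> q ..
  qed
  also have "\<dots> = fls_X ^ n * fls_const (\<Prod>u<n. \<sigma> * (p - inverse p) * (qnum (real k1' + 1 + real u) * qnum (real k2' + 1 + real u)))"
    by (induction n) (simp_all add: mult_ac flip: fls_const_mult_const)
  also have "(\<Prod>u<n. \<sigma> * (p - inverse p) * (qnum (real k1' + 1 + real u) * qnum (real k2' + 1 + real u))) =
      (\<sigma> * (p - inverse p)) ^ n * (q_fact p k1 / q_fact p k1' * (q_fact p k2 / q_fact p k2'))"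
    by (simp add: prod.distrib prod_qnum_up k)
  finally have num: "(\<Prod>u<n. \<tau>_neg ((sh ^^ u) ?i)) = fls_X ^ n *
    fls_const ((\<sigma> * (p - inverse p)) ^ n * (q_fact p k1 / q_fact p k1' * (q_fact p k2 / q_fact p k2')))" .
  define D where "D = (\<Prod>u<n. 1 - x ?i * fls_const t ^ u)"
  \<comment> \<open>The product is reversed by \<open>k = n - u\<close>: the exponents fall by
    \<open>2\<close> per shift from the target label, where \<open>u = 0\<close> matches
    \<open>k = n\<close>.\<close>
  have "(\<Prod>k=1..n. lam2\<^sup>2 - fls_const (P (2 * m2 - 2 * m1 + 2 * (real k + real n - 1))) * lam1\<^sup>2) =
      (\<Prod>u<n. lam2\<^sup>2 - fls_const (P (2 * m2 - 2 * m1 + 2 * (real (n - u) + real n - 1))) * lam1\<^sup>2)"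
    by (rule prod.reindex_bij_witness[of _ "\<lambda>u. n - u" "\<lambda>k. n - k"]) auto
  also have "\<dots> = (\<Prod>u<n. lam2\<^sup>2 * (1 - x ?i * fls_const t ^ u))"
  proof (intro prod.cong refl)
    fix u assume "u \<in> {..<n}"
    hence "P (2 * m2 - 2 * m1 + 2 * (real (n - u) + real n - 1)) =
        P (2 * (m2 + real n) - 2 * (m1 - real n) - 2) * t ^ u"
      unfolding t_def P_power P_add[symmetric] by (simp add: of_nat_diff algebra_simps)
    thus "lam2\<^sup>2 - fls_const (P (2 * m2 - 2 * m1 + 2 * (real (n - u) + real n - 1))) * lam1\<^sup>2 =
        lam2\<^sup>2 * (1 - x ?i * fls_const t ^ u)"
      unfolding lam_factor by (simp add: x_def mult.assoc flip: fls_const_power)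
  qed
  also have "\<dots> = lam2 ^ (2 * n) * D"
    by (simp add: prod.distrib D_def flip: power_mult)
  finally have den: "(\<Prod>k=1..n. lam2\<^sup>2 - fls_const (P (2 * m2 - 2 * m1 + 2 * (real k + real n - 1))) * lam1\<^sup>2) =
    lam2 ^ (2 * n) * D" .
  show ?thesis
    unfolding coeffs_def num den t_def[symmetric] D_def[symmetric] fl
    unfolding k1(1) k2(1) floor_of_nat nat_int
    by (rule assemble_coefficient)
      (simp only: floor_fact_eq minus_one_powi_sign[OF e] \<sigma>_def t_def power_mult_distrib
      times_divide_eq_left times_divide_eq_right divide_divide_eq_left mult_ac)
qed

lemma R_pos_formula:
  assumes j: "((m1, e1), (m2, e2)) \<in> I" and i: "((m1', e1'), (m2', e2')) \<in> I"
  shows "m1' - m1 \<noteq> m2 - m2' \<or> m2 - m2' < 0 \<Longrightarrow>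
      R_pos b l1 l2 lam1 lam2 ((m1', e1'), (m2', e2')) ((m1, e1), (m2, e2)) = 0"
    and "m1' - m1 = real n \<Longrightarrow> m2 - m2' = real n \<Longrightarrow>
      R_pos b l1 l2 lam1 lam2 ((m1', e1'), (m2', e2')) ((m1, e1), (m2, e2)) =
        (if e1' = (e1 + n) mod 2 \<and> e2' = (e2 + n) mod 2
         then coeffs \<tau>_pos n ((m1, e1), (m2, e2)) else 0)"
proof -
  have e: "e1 \<in> {0, 1}" "e2 \<in> {0, 1}" using j by (auto simp: basis_def)
  note sh = sh_funpow[OF e]
  note rep = sh.shift_rep_of_coeffs[of "coeffs \<tau>_pos"]
  show "R_pos b l1 l2 lam1 lam2 ((m1', e1'), (m2', e2')) ((m1, e1), (m2, e2)) = 0"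
    if "m1' - m1 \<noteq> m2 - m2' \<or> m2 - m2' < 0"
    unfolding R_pos_eq[OF i j]
  proof (rule sh.shift_repD(2)[OF rep i j])
    fix k
    show "((m1', e1'), (m2', e2')) \<noteq> (sh ^^ k) ((m1, e1), (m2, e2))"
      using that of_nat_0_le_iff[of k, where 'a = real] unfolding sh prod.inject by linarith
  qed
  show "R_pos b l1 l2 lam1 lam2 ((m1', e1'), (m2', e2')) ((m1, e1), (m2, e2)) =
        (if e1' = (e1 + n) mod 2 \<and> e2' = (e2 + n) mod 2
         then coeffs \<tau>_pos n ((m1, e1), (m2, e2)) else 0)"
    if n: "m1' - m1 = real n" "m2 - m2' = real n"
  proof (cases "e1' = (e1 + n) mod 2 \<and> e2' = (e2 + n) mod 2")
    case True
    hence eq: "((m1', e1'), (m2', e2')) = (sh ^^ n) ((m1, e1), (m2, e2))" using n by (simp add: sh)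
    have "sh.of_coeffs (coeffs \<tau>_pos) ((m1', e1'), (m2', e2')) ((m1, e1), (m2, e2)) =
        coeffs \<tau>_pos n ((m1, e1), (m2, e2))"
      using i unfolding eq by (rule sh.shift_repD(1)[OF rep j])
    thus ?thesis unfolding R_pos_eq[OF i j] if_P[OF True] .
  next
    case False
    have "sh.of_coeffs (coeffs \<tau>_pos) ((m1', e1'), (m2', e2')) ((m1, e1), (m2, e2)) = 0"
    proof (rule sh.shift_repD(2)[OF rep i j])
      fix k
      have "k = n" if "m1' = m1 + real k" using that n by simp
      thus "((m1', e1'), (m2', e2')) \<noteq> (sh ^^ k) ((m1, e1), (m2, e2))"
        using False unfolding sh prod.inject by blast
    qed
    thus ?thesis unfolding R_pos_eq[OF i j] using False by (simp only: if_False)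
  qed
qed

lemma R_neg_formula:
  assumes j: "((m1, e1), (m2, e2)) \<in> I" and i: "((m1', e1'), (m2', e2')) \<in> I"
  shows "m1' - m1 \<noteq> m2 - m2' \<or> m2 - m2' > 0 \<Longrightarrow>
      R_neg b l1 l2 lam1 lam2 ((m1', e1'), (m2', e2')) ((m1, e1), (m2, e2)) = 0"
    and "m1 - m1' = real n \<Longrightarrow> m2' - m2 = real n \<Longrightarrow>
      R_neg b l1 l2 lam1 lam2 ((m1', e1'), (m2', e2')) ((m1, e1), (m2, e2)) =
        (if e1' = (e1 + n) mod 2 \<and> e2' = (e2 + n) mod 2
         then coeffs \<tau>_neg n ((m1', e1'), (m2', e2')) else 0)"
proof -
  have e: "e1' \<in> {0, 1}" "e2' \<in> {0, 1}" "e1 \<in> {0, 1}" "e2 \<in> {0, 1}" using i j by (auto simp: basis_def)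
  note sh = sh_funpow[OF e(1,2)]
  note rep = sh.shift_rep_of_coeffs[of "coeffs \<tau>_neg"]
  show "R_neg b l1 l2 lam1 lam2 ((m1', e1'), (m2', e2')) ((m1, e1), (m2, e2)) = 0"
    if "m1' - m1 \<noteq> m2 - m2' \<or> m2 - m2' > 0"
    unfolding R_neg_eq[OF i j]
  proof (rule sh.shift_repD(2)[OF rep j i])
    fix k
    show "((m1, e1), (m2, e2)) \<noteq> (sh ^^ k) ((m1', e1'), (m2', e2'))"
      using that of_nat_0_le_iff[of k, where 'a = real] unfolding sh prod.inject by linarith
  qed
  \<comment> \<open>The \<open>n\<close>-fold parity flip is an involution, which allows source and
    target to be exchanged.\<close>
  have parity: "e = (e' + n) mod 2 \<longleftrightarrow> e' = (e + n) mod 2" if "e \<in> {0, 1}" "e' \<in> {0, 1}" for e e' :: nat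
  proof -
    have add: "(a + n) mod 2 = (if even n then a else 1 - a)" if "a \<in> {0, 1}" for a :: nat
      using that by (elim insertE) (simp_all add: mod2_eq_if)
    show ?thesis unfolding add[OF that(1)] add[OF that(2)] using that by (cases "even n") auto
  qed
  show "R_neg b l1 l2 lam1 lam2 ((m1', e1'), (m2', e2')) ((m1, e1), (m2, e2)) =
        (if e1' = (e1 + n) mod 2 \<and> e2' = (e2 + n) mod 2
         then coeffs \<tau>_neg n ((m1', e1'), (m2', e2')) else 0)"
    if n: "m1 - m1' = real n" "m2' - m2 = real n"
  proof (cases "e1' = (e1 + n) mod 2 \<and> e2' = (e2 + n) mod 2")
    case True
    have "e1 = (e1' + n) mod 2" "e2 = (e2' + n) mod 2"
      by (rule iffD2[OF parity[OF e(3,1)] conjunct1[OF True]] iffD2[OF parity[OF e(4,2)] conjunct2[OF True]])+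
    hence eq: "((m1, e1), (m2, e2)) = (sh ^^ n) ((m1', e1'), (m2', e2'))" using n by (simp add: sh)
    have "sh.of_coeffs (coeffs \<tau>_neg) ((m1, e1), (m2, e2)) ((m1', e1'), (m2', e2')) =
        coeffs \<tau>_neg n ((m1', e1'), (m2', e2'))"
      using j unfolding eq by (rule sh.shift_repD(1)[OF rep i])
    thus ?thesis unfolding R_neg_eq[OF i j] if_P[OF True] .
  next
    case False
    hence False': "\<not> (e1 = (e1' + n) mod 2 \<and> e2 = (e2' + n) mod 2)"
      by (subst parity[OF e(3,1)], subst parity[OF e(4,2)]) (rule False)
    have "sh.of_coeffs (coeffs \<tau>_neg) ((m1, e1), (m2, e2)) ((m1', e1'), (m2', e2')) = 0"
    proof (rule sh.shift_repD(2)[OF rep j i])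
      fix k
      have "k = n" if "m1 = m1' + real k" using that n by simp
      thus "((m1, e1), (m2, e2)) \<noteq> (sh ^^ k) ((m1', e1'), (m2', e2'))"
        using False' unfolding sh prod.inject by blast
    qed
    thus ?thesis unfolding R_neg_eq[OF i j] using False by (simp only: if_False)
  qed
qed

end

section \<open>Diagonal operators and the factor \<open>Q\<close>\<close>

lemma pow_op_diag:
  assumes I: "finite I" and D: "\<And>i j. i \<in> I \<Longrightarrow> j \<in> I \<Longrightarrow> D i j = (if i = j then d j else 0)"
  shows "i \<in> I \<Longrightarrow> j \<in> I \<Longrightarrow> pow_op I D n i j = (if i = j then d j ^ n else 0)"
proof (induction n arbitrary: i j)
  case 0
  show ?case by (simp add: one_op_def)
next
  case (Suc n)
  have "mult_op I D (pow_op I D n) i j = (\<Sum>k\<in>I. if k = j then D i j * d j ^ n else 0)"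
    unfolding mult_op_def by (intro sum.cong) (use Suc in auto)
  thus ?case using I D Suc.prems by simp
qed

lemma exp_op_diag:
  fixes D :: "('i, 'a::{field_char_0, t2_space}) oper"
  assumes "finite I" and "\<And>i j. i \<in> I \<Longrightarrow> j \<in> I \<Longrightarrow> D i j = (if i = j then d j else 0)"
    and "i \<in> I" "j \<in> I"
  shows "exp_op I D i j = (if i = j then (\<Sum>n. d j ^ n / fact n) else 0)"
  unfolding exp_op_def by (simp add: pow_op_diag[OF assms])

text \<open>The summands with \<open>Hd1\<close> or \<open>Hd2\<close> contain
  \<open>Hdelta_ev\<close>, which is zero. The remaining exponent is diagonal with entries
  \<open>(2 m1) (2 m2) / 2\<close>.\<close>

lemma Q_op_eq:
  assumes l1: "real s1 = 2 * l1" and l2: "real s2 = 2 * l2"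
    and j: "((m1, e1), (m2, e2)) \<in> basis l1 \<times> basis l2" and i: "i \<in> basis l1 \<times> basis l2"
  shows "Q_op b l1 l2 Hd1 Hd2 i ((m1, e1), (m2, e2)) =
    (if i = ((m1, e1), (m2, e2)) then fls_const ((- 1) ^ (e1 * e2) * qs_pow b (2 * m1 * m2)) else 0)"
proof -
  define I where "I = basis l1 \<times> basis l2"
  have fin: "finite I" using finite_basis l1 l2 by (auto simp: I_def)
  define H :: "(label \<times> label, complex) oper" where
    "H = scale_op (complex_of_real pi * \<i> * bstar2 b) (add_op (scale_op (1 / 2) (stensor H1_ev H1_ev))
       (add_op (stensor Hdelta_ev Hd2) (stensor Hd1 Hdelta_ev)))"
  define d :: "label \<times> label \<Rightarrow> complex" where
    "d = (\<lambda>((m1, e1), (m2, e2)). complex_of_real pi * \<i> * bstar2 b * complex_of_real (2 * m1 * m2))"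
  have H: "H i j = (if i = j then d j else 0)" if "i \<in> I" "j \<in> I" for i j
    by (cases i; cases j)
      (auto simp: H_def d_def scale_op_def add_op_def stensor_def Hdelta_ev_def zero_op_def H1_ev_def split: prod.splits)
  have ex: "exp_op I H k ((m1, e1), (m2, e2)) = (if k = ((m1, e1), (m2, e2)) then qs_pow b (2 * m1 * m2) else 0)"
    if k: "k \<in> I" for k
  proof -
    have "(\<Sum>n. z ^ n / fact n) = exp z" for z :: complex
      by (simp add: exp_def scaleR_conv_of_real field_simps)
    thus ?thesis
      using exp_op_diag[OF fin H k j[folded I_def]] by (auto simp: d_def qs_pow_def)
  qed
  have "mult_op I C_op (exp_op I H) i ((m1, e1), (m2, e2)) =
      (\<Sum>k\<in>I. if k = ((m1, e1), (m2, e2)) then C_op i k * qs_pow b (2 * m1 * m2) else 0)"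
    unfolding mult_op_def by (intro sum.cong) (auto simp: ex)
  also have "\<dots> = C_op i ((m1, e1), (m2, e2)) * qs_pow b (2 * m1 * m2)"
    using fin j by (simp add: I_def)
  finally show ?thesis
    by (simp add: Q_op_def qs_pow_op_def C_op_def flip: I_def H_def)
qed


section \<open>The imaginary root factor\<close>

text \<open>A partial fraction expansion. Clearing denominators leaves \<open>(1 - c1 v) (1 - c2 v)
  = (1 - c3 v) (1 - c4 v) - \<kappa> v (N1 (1 - c4 v) - N2 (1 - c3 v))\<close>, and
  \<open>h1\<close>, \<open>h2\<close> are its coefficients at \<open>v\<close> and
  \<open>v^2\<close>.\<close>

lemma fps_log_rational:
  fixes c1 c2 c3 c4 \<kappa> N1 N2 :: "'a::field_char_0"
  assumes h1: "c1 + c2 = c3 + c4 + \<kappa> * (N1 - N2)"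
    and h2: "c1 * c2 = c3 * c4 + \<kappa> * (N1 * c4 - N2 * c3)"
  shows "fps_compose (fps_ln 1) (Abs_fps (\<lambda>n. if n = 0 then 0 else - \<kappa> * (c3 ^ (n - 1) * N1 - c4 ^ (n - 1) * N2))) =
    fps_log1m c1 + fps_log1m c2 - fps_log1m c3 - fps_log1m c4"
proof (rule fps_ln_compose_eqI)
  define g :: "'a \<Rightarrow> 'a fps" where "g c = Abs_fps (\<lambda>n. c ^ n)" for c
  define A :: "'a \<Rightarrow> 'a fps" where "A c = 1 - fps_const c * fps_X" for c
  have Ag: "A c * g c = 1" for c
  proof (rule fps_ext)
    fix n
    have "A c * g c = g c - fps_const c * (fps_X * g c)"
      by (simp add: A_def algebra_simps)
    thus "fps_nth (A c * g c) n = fps_nth 1 n"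
      by (cases n) (simp_all add: g_def)
  qed
  define Y where "Y = - fps_const \<kappa> * (fps_X * (fps_const N1 * g c3 - fps_const N2 * g c4))"
  have Y: "Abs_fps (\<lambda>n. if n = 0 then 0 else - \<kappa> * (c3 ^ (n - 1) * N1 - c4 ^ (n - 1) * N2)) = Y"
  proof (rule fps_ext)
    fix n
    show "fps_nth (Abs_fps (\<lambda>n. if n = 0 then 0 else - \<kappa> * (c3 ^ (n - 1) * N1 - c4 ^ (n - 1) * N2))) n = fps_nth Y n"
      by (cases n) (simp_all add: Y_def g_def fps_const_neg[symmetric] mult.commute del: fps_const_neg)
  qed
  have log0: "fps_nth (fps_log1m c :: 'a fps) 0 = 0" for c by (simp add: fps_log1m_nth)
  have inv: "inverse (A c) = g c" for c by (rule fps_inverse_unique[OF Ag])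
  have "fps_Exp (fps_log1m c1 + fps_log1m c2 - fps_log1m c3 - fps_log1m c4) =
      A c1 * A c2 * g c3 * g c4"
    by (simp add: fps_Exp_add fps_Exp_diff log0 fps_Exp_log1m inv flip: A_def)
  also have "A c1 * A c2 = A c3 * A c4 - fps_const \<kappa> * (fps_X * (fps_const N1 * A c4 - fps_const N2 * A c3))"
  proof -
    have k1: "fps_const c1 + fps_const c2 = fps_const c3 + fps_const c4 + fps_const \<kappa> * (fps_const N1 - fps_const N2)"
      using h1 by simp
    have k2: "fps_const c1 * fps_const c2 = fps_const c3 * fps_const c4 +
        fps_const \<kappa> * (fps_const N1 * fps_const c4 - fps_const N2 * fps_const c3)"
      using h2 by simp
    have exp: "(1 - C * X) * (1 - D * X) = 1 - (C + D) * X + (C * D) * (X * X)" for C D X :: "'a fps"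
      by (simp add: algebra_simps)
    show ?thesis unfolding A_def exp k1 k2
      by (simp only: algebra_simps mult_1_left mult_1_right)
  qed
  also have "(A c3 * A c4 - fps_const \<kappa> * (fps_X * (fps_const N1 * A c4 - fps_const N2 * A c3))) * g c3 * g c4 =
      (A c3 * g c3) * (A c4 * g c4) -
      fps_const \<kappa> * (fps_X * (fps_const N1 * (A c4 * g c4) * g c3 - fps_const N2 * (A c3 * g c3) * g c4))"
    by (simp only: algebra_simps)
  also have "\<dots> = 1 + Y"
    unfolding Ag Y_def
    by (simp only: mult_1_left mult_1_right mult_minus_left diff_conv_add_uminus)
  finally show "fps_Exp (fps_log1m c1 + fps_log1m c2 - fps_log1m c3 - fps_log1m c4) =
      1 + Abs_fps (\<lambda>n. if n = 0 then 0 else - \<kappa> * (c3 ^ (n - 1) * N1 - c4 ^ (n - 1) * N2))"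
    unfolding Y by simp
qed (simp_all add: fps_log1m_nth)

lemma fls_const_sum: "fls_const (\<Sum>i\<in>S. f i) = (\<Sum>i\<in>S. fls_const (f i))"
  by (induction S rule: infinite_finite_induct) (simp_all flip: fls_plus_const)

lemma hop_sum:
  assumes "\<And>r. r \<in> S \<Longrightarrow> hop l c s \<rho> (A r) (f r)"
  shows "hop l c s \<rho> (\<lambda>i j. \<Sum>r\<in>S. A r i j) (\<lambda>m e. \<Sum>r\<in>S. f r m e)"
proof (rule hopI)
  fix m e m' e' assume "(m, e) \<in> basis l" "(m', e') \<in> basis l"
  hence "(\<Sum>r\<in>S. A r (m', e') (m, e)) =
      (\<Sum>r\<in>S. if m' = m + c \<and> e' = flip_if s e then \<rho> * fls_const (f r m e) else 0)"
    by (intro sum.cong refl hopD[OF assms])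
  also have "\<dots> = (if m' = m + c \<and> e' = flip_if s e then \<rho> * fls_const (\<Sum>r\<in>S. f r m e) else 0)"
    unfolding fls_const_sum sum_distrib_left
    by (cases "m' = m + c \<and> e' = flip_if s e") (simp_all only: if_True if_False sum.neutral_const simp_thms)
  finally show "(\<Sum>r\<in>S. A r (m', e') (m, e)) =
    (if m' = m + c \<and> e' = flip_if s e then \<rho> * fls_const (\<Sum>r\<in>S. f r m e) else 0)" .
qed

text \<open>All coefficients are diagonal, so on each weight the operator series is the scalar
  series \<open>G m\<close> with its variable rescaled by \<open>\<rho>\<close>.\<close>

lemma hop_series_pow:
  assumes l: "real s = 2 * l"
    and X: "\<And>r. hop l 0 False (\<rho> ^ r) (X r) (\<lambda>m e. fps_nth (G m) r)"
  shows "hop l 0 False (\<rho> ^ n) (series_pow (basis l) X k n) (\<lambda>m e. fps_nth (G m ^ k) n)"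
proof (induction k arbitrary: n)
  case 0
  show ?case by (rule hopI) (auto simp: one_op_def zero_op_def)
next
  case (Suc k)
  have "hop l 0 False (\<rho> ^ n) (mult_op (basis l) (X r) (series_pow (basis l) X k (n - r)))
      (\<lambda>m e. fps_nth (G m) r * fps_nth (G m ^ k) (n - r))" if "r \<in> {..n}" for r
    by (rule hop_cong[OF hop_mult[OF l X Suc]]) (use that in \<open>simp_all flip: power_add\<close>)
  hence "hop l 0 False (\<rho> ^ n) (series_pow (basis l) X (Suc k) n)
      (\<lambda>m e. \<Sum>r\<le>n. fps_nth (G m) r * fps_nth (G m ^ k) (n - r))"
    unfolding series_pow.simps by (rule hop_sum)
  thus ?case by (simp add: fps_mult_nth atLeast0AtMost)
qed

lemma hop_series_ln1p:
  assumes l: "real s = 2 * l"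
    and X: "\<And>r. hop l 0 False (\<rho> ^ r) (X r) (\<lambda>m e. fps_nth (G m) r)"
  shows "hop l 0 False (\<rho> ^ n) (series_ln1p (basis l) X n) (\<lambda>m e. fps_nth (fps_compose (fps_ln 1) (G m)) n)"
proof -
  have c: "(- 1) ^ (k + 1) / of_nat k = fls_const ((- 1) ^ (k + 1) / of_nat k :: complex)" for k
    by (simp add: fls_of_nat fls_const_divide_const fls_const_power flip: fls_const_divide_const)
  have "hop l 0 False (\<rho> ^ n) (\<lambda>i j. (- 1) ^ (k + 1) / of_nat k * series_pow (basis l) X k n i j)
      (\<lambda>m e. (- 1) ^ (k + 1) / of_nat k * fps_nth (G m ^ k) n)" for k
    unfolding c using hop_scale[OF hop_series_pow[OF l X]] by (simp only: scale_op_def)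
  hence "hop l 0 False (\<rho> ^ n) (series_ln1p (basis l) X n)
      (\<lambda>m e. \<Sum>k=1..n. (- 1) ^ (k + 1) / of_nat k * fps_nth (G m ^ k) n)"
    unfolding series_ln1p_def by (rule hop_sum)
  moreover have "(\<Sum>k=1..n. (- 1) ^ (k + 1) / of_nat k * fps_nth (G m ^ k) n) =
      fps_nth (fps_compose (fps_ln 1) (G m)) n" for m
    unfolding fps_compose_nth
    by (rule sum.mono_neutral_cong_left) (auto simp: fps_ln_nth Suc_le_eq gr0_conv_Suc)
  ultimately show ?thesis by simp
qed

context generic_q
begin

text \<open>Up to the factor \<open>p - 1/p\<close> this is
  \<open>[l+m] [l-m+1] - [l-m] [l+m+1] = [2m]\<close>, the commutator of raising and lowering
  operators on the spin-\<open>l\<close> module of quantum \<open>sl_2\<close> at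
  \<open>q_*\<close>.\<close>

lemma qnum_bracket:
  "(p - inverse p) * (qnum (l + m) * qnum (l - m + 1) - qnum (l - m) * qnum (l + m + 1)) = P (2 * m) - P (- 2 * m)"
proof -
  define u v where "u = P l" and "v = P m"
  have nz: "u \<noteq> 0" "v \<noteq> 0" "p \<noteq> 0" by (simp_all add: u_def v_def)
  have d: "p ^ 2 - 1 \<noteq> 0" using p_power_ne_1[of 2] by simp
  have e: "P (2 * m) = v ^ 2" "P (- 2 * m) = inverse (v ^ 2)"
    using P_minus[of "2 * m"] by (simp_all add: v_def P_power mult.commute)
  have e1: "qnum (l + m) = (u * v - inverse (u * v)) / (p - inverse p)"
    "qnum (l - m) = (u / v - v / u) / (p - inverse p)"
    "qnum (l - m + 1) = (u * p / v - v / (u * p)) / (p - inverse p)"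
    "qnum (l + m + 1) = (u * v * p - inverse (u * v * p)) / (p - inverse p)"
    by (simp_all add: qnum_def P_add P_diff P_minus u_def v_def field_simps)
  have d': "p - inverse p = (p ^ 2 - 1) / p" using nz by (simp add: field_simps power2_eq_square)
  show ?thesis
    unfolding e e1 d' using nz d by (simp add: divide_simps) (simp add: algebra_simps power_numeral_reduce)
qed

end

context evaluation_module
begin

text \<open>The logarithm of a rational function. Its denominators come from the ratios of the
  geometric sequences of \<open>E_minus\<close> at the weights \<open>m\<close> and
  \<open>m + 1\<close>; the numerator constants are the two numbers with the sum and product that
  this forces, and they depend on \<open>l\<close> only.\<close>

definition log_E :: "real \<Rightarrow> complex fps" where
  "log_E m = fps_log1m (\<i> * P (2 * l)) + fps_log1m (\<i> * P (- 2 * l - 2))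
     - fps_log1m (\<i> * P (- 2 * m)) - fps_log1m (\<i> * P (- 2 * m - 2))"

definition log_F :: "real \<Rightarrow> complex fps" where
  "log_F m = fps_log1m (\<i> * P (- 2 * l)) + fps_log1m (\<i> * P (2 * l + 2))
     - fps_log1m (\<i> * P (2 * m)) - fps_log1m (\<i> * P (2 * m + 2))"

text \<open>The condition of \<open>fps_log_rational\<close> on the sum is the eigenvalue of
  \<open>E_delta\<close> in \<open>qnum_quadratic\<close>; the one on the product reduces to
  \<open>qnum_bracket\<close>.\<close>

lemma log_E_eq:
  "log_E m = fps_compose (fps_ln 1) (Abs_fps (\<lambda>n. if n = 0 then 0 else
     - (\<i> * (p - inverse p)) * ((\<i> * P (- 2 * m)) ^ (n - 1) * (qnum (l + m) * qnum (l - m + 1))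
       - (\<i> * P (- 2 * m - 2)) ^ (n - 1) * (P (- 2) * (qnum (l - m) * qnum (l + m + 1))))))"
  unfolding log_E_def
proof (rule fps_log_rational[symmetric])
  define d where "d = p - inverse p"
  define N M where "N = qnum (l + m) * qnum (l - m + 1)" and "M = qnum (l - m) * qnum (l + m + 1)"
  have 1: "d * (N - P (- 2) * M) = P (2 * l) + P (- 2 * l - 2) - P (- 2 * m) - P (- 2 * m - 2)"
  proof -
    have "d * (N - P (- 2) * M) = P (- 1) * (P (2 * l + 1) + P (- 2 * l - 1) - P (- 2 * m) * (P 1 + P (- 1)))"
      unfolding N_def M_def d_def qnum_quadratic(1) P_minus[of 1] using p_minus_nonzero by simp
    also have "\<dots> = P (2 * l) + P (- 2 * l - 2) - P (- 2 * m) - P (- 2 * m - 2)"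
    proof -
      have "P (- 1) * P (2 * l + 1) = P (2 * l)" "P (- 1) * P (- 2 * l - 1) = P (- 2 * l - 2)"
        "P (- 1) * (P (- 2 * m) * P 1) = P (- 2 * m)" "P (- 1) * (P (- 2 * m) * P (- 1)) = P (- 2 * m - 2)"
        unfolding P_add[symmetric] by (rule arg_cong[where f = P], linarith)+
      thus ?thesis by (simp only: right_diff_distrib distrib_left diff_diff_eq)
    qed
    finally show ?thesis .
  qed
  have 2: "d * (N - M) = P (2 * m) - P (- 2 * m)"
    using qnum_bracket by (simp only: N_def M_def d_def)
  show "\<i> * P (2 * l) + \<i> * P (- 2 * l - 2) = \<i> * P (- 2 * m) + \<i> * P (- 2 * m - 2) + \<i> * d * (N - P (- 2) * M)"
    unfolding mult.assoc 1 by (simp add: algebra_simps)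
  have "\<i> * d * (N * (\<i> * P (- 2 * m - 2)) - P (- 2) * M * (\<i> * P (- 2 * m))) =
      (\<i> * \<i>) * (P (- 2 * m - 2) * (d * (N - M)))"
  proof -
    have *: "P (- 2 * m - 2) = P (- 2) * P (- 2 * m)"
      unfolding P_add[symmetric] by (rule arg_cong[where f = P]) linarith
    show ?thesis unfolding * by (simp only: algebra_simps)
  qed
  also have "P (- 2 * m - 2) * (d * (N - M)) = P (- 2) - P (- 2 * m) * P (- 2 * m - 2)"
    unfolding 2 unfolding right_diff_distrib P_add[symmetric] by (simp add: algebra_simps)
  finally show "\<i> * P (2 * l) * (\<i> * P (- 2 * l - 2)) = \<i> * P (- 2 * m) * (\<i> * P (- 2 * m - 2)) +
      \<i> * d * (N * (\<i> * P (- 2 * m - 2)) - P (- 2) * M * (\<i> * P (- 2 * m)))"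
    using P_add[of "2 * l" "- 2 * l - 2"] by (simp add: algebra_simps)
qed

lemma log_F_eq:
  "log_F m = fps_compose (fps_ln 1) (Abs_fps (\<lambda>n. if n = 0 then 0 else
     - (- (\<i> * (p - inverse p))) * ((\<i> * P (2 * m)) ^ (n - 1) * (qnum (l + m) * qnum (l - m + 1))
       - (\<i> * P (2 * m + 2)) ^ (n - 1) * (P 2 * (qnum (l - m) * qnum (l + m + 1))))))"
  unfolding log_F_def
proof (rule fps_log_rational[symmetric])
  define d where "d = p - inverse p"
  define N M where "N = qnum (l + m) * qnum (l - m + 1)" and "M = qnum (l - m) * qnum (l + m + 1)"
  have 1: "d * (N - P 2 * M) = - (P (- 2 * l) + P (2 * l + 2) - P (2 * m) - P (2 * m + 2))"
  proof -
    have "d * (N - P 2 * M) = - (P 1 * (P (2 * l + 1) + P (- 2 * l - 1) - P (2 * m) * (P 1 + P (- 1))))"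
      unfolding N_def M_def d_def qnum_quadratic(2) P_minus[of 1] using p_minus_nonzero by simp
    also have "\<dots> = - (P (- 2 * l) + P (2 * l + 2) - P (2 * m) - P (2 * m + 2))"
    proof -
      have "P 1 * P (2 * l + 1) = P (2 * l + 2)" "P 1 * P (- 2 * l - 1) = P (- 2 * l)"
        "P 1 * (P (2 * m) * P 1) = P (2 * m + 2)" "P 1 * (P (2 * m) * P (- 1)) = P (2 * m)"
        unfolding P_add[symmetric] by (rule arg_cong[where f = P], linarith)+
      hence "P 1 * (P (2 * l + 1) + P (- 2 * l - 1) - P (2 * m) * (P 1 + P (- 1))) =
          P (2 * l + 2) + P (- 2 * l) - (P (2 * m + 2) + P (2 * m))"
        by (simp only: right_diff_distrib distrib_left)
      thus ?thesis by simp
    qed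
    finally show ?thesis .
  qed
  have 2: "d * (N - M) = P (2 * m) - P (- 2 * m)"
    using qnum_bracket by (simp only: N_def M_def d_def)
  show "\<i> * P (- 2 * l) + \<i> * P (2 * l + 2) = \<i> * P (2 * m) + \<i> * P (2 * m + 2) + - (\<i> * d) * (N - P 2 * M)"
    unfolding mult.assoc mult_minus_left 1 by (simp add: algebra_simps)
  have "- (\<i> * d) * (N * (\<i> * P (2 * m + 2)) - P 2 * M * (\<i> * P (2 * m))) =
      - (\<i> * \<i>) * (P (2 * m + 2) * (d * (N - M)))"
  proof -
    have *: "P (2 * m + 2) = P 2 * P (2 * m)"
      unfolding P_add[symmetric] by (rule arg_cong[where f = P]) linarith
    show ?thesis unfolding * by (simp only: algebra_simps mult_minus_left mult_minus_right)
  qed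
  also have "P (2 * m + 2) * (d * (N - M)) = P (2 * m) * P (2 * m + 2) - P 2"
    unfolding 2 unfolding right_diff_distrib P_add[symmetric] by (simp add: algebra_simps)
  finally show "\<i> * P (- 2 * l) * (\<i> * P (2 * l + 2)) = \<i> * P (2 * m) * (\<i> * P (2 * m + 2)) +
      - (\<i> * d) * (N * (\<i> * P (2 * m + 2)) - P 2 * M * (\<i> * P (2 * m)))"
    using P_add[of "- 2 * l" "2 * l + 2"] by (simp add: algebra_simps)
qed

text \<open>\<open>E_minus\<close> acts at \<open>m\<close> in one product and, after
  \<open>E1\<close>, at \<open>m + 1\<close> in the other. This yields two geometric sequences, with
  a relative minus sign from \<open>q^(-2) = -q_*^(-2)\<close>, and so a rational generating
  series.\<close>

lemma hop_E_imag:
  "hop l 0 False ((lam ^ 2) ^ n) (E_imag b I E0 E1 n) (\<lambda>m e. - 1 / (\<i> * (p - inverse p)) * fps_nth (log_E m) n)"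
proof -
  have 1: "hop l 0 False ((lam ^ 2) ^ Suc n) (mult_op I E1 (E_minus b I E0 E1 n))
      (\<lambda>m e. (\<i> * P (- 2 * m)) ^ n * (qnum (l + m) * qnum (l - m + 1)))" for n
    by (rule hop_cong[OF hop_mult[OF l hop_generators(1) hop_E_minus]])
      (simp_all add: bottom algebra_simps power_mult power2_eq_square)
  have shift: "P (- (m * 2) - 2) = P (- 2 - m * 2)" for m
    by (rule arg_cong[where f = P]) simp
  have 2: "hop l 0 False ((lam ^ 2) ^ Suc n) (mult_op I (E_minus b I E0 E1 n) E1)
      (\<lambda>m e. (\<i> * P (- 2 * m - 2)) ^ n * (qnum (l - m) * qnum (l + m + 1)))" for n
    by (rule hop_cong[OF hop_mult[OF l hop_E_minus hop_generators(1)]])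
      (simp_all add: top shift algebra_simps power_mult power2_eq_square)
  have "hop l 0 False ((lam ^ 2) ^ r) (scale_op (fls_const (- (qq b + inverse (qq b)))) (E_imag' b I E0 E1 r))
      (\<lambda>m e. fps_nth (Abs_fps (\<lambda>n. if n = 0 then 0 else
     - (\<i> * (p - inverse p)) * ((\<i> * P (- 2 * m)) ^ (n - 1) * (qnum (l + m) * qnum (l - m + 1))
       - (\<i> * P (- 2 * m - 2)) ^ (n - 1) * (P (- 2) * (qnum (l - m) * qnum (l + m + 1)))))) r)" for r
  proof (cases r)
    case 0
    show ?thesis unfolding 0 by (rule hopI) (simp add: scale_op_def E_imag'_def zero_op_def)
  next
    case (Suc n)
    show ?thesis
      unfolding Suc E_imag'_def
      by (simp only: nat.distinct if_False diff_Suc_1, rule hop_cong[OF hop_scale[OF hop_add[OF 1 hop_scale[OF 2]]]])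
        (simp_all add: q_pow_minus_2 qq_plus algebra_simps)
  qed
  from hop_scale[OF hop_series_ln1p[OF l this]] show ?thesis
    unfolding E_imag_def qq_plus log_E_eq .
qed

lemma hop_F_imag:
  "hop l 0 False ((inverse lam ^ 2) ^ n) (F_imag b I F0 F1 n) (\<lambda>m e. 1 / (\<i> * (p - inverse p)) * fps_nth (log_F m) n)"
proof -
  have 1: "hop l 0 False ((inverse lam ^ 2) ^ Suc n) (mult_op I (F_minus b I F0 F1 n) F1)
      (\<lambda>m e. (\<i> * P (2 * m)) ^ n * (qnum (l + m) * qnum (l - m + 1)))" for n
    by (rule hop_cong[OF hop_mult[OF l hop_F_minus hop_generators(3)]])
      (auto simp: bottom algebra_simps power_mult power2_eq_square)
  have 2: "hop l 0 False ((inverse lam ^ 2) ^ Suc n) (mult_op I F1 (F_minus b I F0 F1 n))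
      (\<lambda>m e. (\<i> * P (2 * m + 2)) ^ n * (qnum (l - m) * qnum (l + m + 1)))" for n
    by (rule hop_cong[OF hop_mult[OF l hop_generators(3) hop_F_minus]])
      (auto simp: top algebra_simps power_mult power2_eq_square)
  have "hop l 0 False ((inverse lam ^ 2) ^ r) (scale_op (fls_const (qq b + inverse (qq b))) (F_imag' b I F0 F1 r))
      (\<lambda>m e. fps_nth (Abs_fps (\<lambda>n. if n = 0 then 0 else
     - (- (\<i> * (p - inverse p))) * ((\<i> * P (2 * m)) ^ (n - 1) * (qnum (l + m) * qnum (l - m + 1))
       - (\<i> * P (2 * m + 2)) ^ (n - 1) * (P 2 * (qnum (l - m) * qnum (l + m + 1)))))) r)" for r
  proof (cases r)
    case 0
    show ?thesis unfolding 0 by (rule hopI) (simp add: scale_op_def F_imag'_def zero_op_def)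
  next
    case (Suc n)
    show ?thesis
      unfolding Suc F_imag'_def
      by (simp only: nat.distinct if_False diff_Suc_1, rule hop_cong[OF hop_scale[OF hop_add[OF 1 hop_scale[OF 2]]]])
        (simp_all add: q_pow_2 qq_plus algebra_simps)
  qed
  from hop_scale[OF hop_series_ln1p[OF l this]] show ?thesis
    unfolding F_imag_def qq_plus log_F_eq .
qed

end


section \<open>The exponent of \<open>\<R>\<^sub>0\<close> and its exponential\<close>

lemma sum_pos_cong: "(\<And>n. n > 0 \<Longrightarrow> f n = g n) \<Longrightarrow> sum_pos f = sum_pos g"
  unfolding sum_pos_def by simp

text \<open>The series of \<open>ln (1 - c X^2)\<close>, split over the two square roots of
  \<open>c\<close> to reuse the linear case; the odd powers cancel.\<close>

definition fps_log1m_sq :: "complex \<Rightarrow> complex fps" where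
  "fps_log1m_sq c = fps_log1m (csqrt c) + fps_log1m (- csqrt c)"

lemma fps_log1m_sq_nth:
  "fps_nth (fps_log1m_sq c) k = (if even k \<and> k > 0 then - (c ^ (k div 2)) / of_nat (k div 2) else 0)"
proof (cases "even k")
  case True
  then obtain r where r: "k = 2 * r" by (elim evenE)
  have "csqrt c ^ k = c ^ r" by (simp add: r power_mult)
  thus ?thesis by (auto simp: fps_log1m_sq_def fps_log1m_nth r power_mult)
next
  case False
  thus ?thesis by (simp add: fps_log1m_sq_def fps_log1m_nth)
qed

lemma fps_Exp_log1m_sq: "fps_Exp (fps_log1m_sq c) = 1 - fps_const c * fps_X ^ 2"
proof -
  have "fps_Exp (fps_log1m_sq c) =
      (1 - fps_const (csqrt c) * fps_X) * (1 - fps_const (- csqrt c) * fps_X)"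
    unfolding fps_log1m_sq_def by (simp add: fps_Exp_add fps_log1m_nth fps_Exp_log1m)
  also have "\<dots> = 1 - fps_const (csqrt c) * fps_const (csqrt c) * (fps_X * fps_X)"
    by (simp add: algebra_simps fps_const_neg[symmetric] del: fps_const_neg fps_const_mult)
  also have "fps_const (csqrt c) * fps_const (csqrt c) = fps_const c"
    by (simp flip: power2_eq_square)
  finally show ?thesis by (simp add: power2_eq_square)
qed

lemma geometric_sum_diff:
  fixes x y w :: "'a::field"
  assumes "w \<noteq> 0"
  shows "(w - 1) * (\<Sum>k=1..a. x * inverse w ^ k - y * w ^ k) = x * (1 - inverse w ^ a) - y * w * (w ^ a - 1)"
proof (induction a)
  case (Suc a)
  have "(\<Sum>k=1..Suc a. x * inverse w ^ k - y * w ^ k) =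
      (\<Sum>k=1..a. x * inverse w ^ k - y * w ^ k) + (x * inverse w ^ Suc a - y * w ^ Suc a)"
    by simp
  hence *: "(w - 1) * (\<Sum>k=1..Suc a. x * inverse w ^ k - y * w ^ k) =
      x * (1 - inverse w ^ a) - y * w * (w ^ a - 1) + (w - 1) * (x * inverse w ^ Suc a - y * w ^ Suc a)"
    by (simp only: distrib_left Suc.IH)
  show ?case unfolding * using assms by (simp add: field_simps)
qed simp

lemma fps_to_fls_divide_unit:
  fixes f g :: "'a::field fps"
  assumes "fps_nth g 0 \<noteq> 0"
  shows "fps_to_fls (f * inverse g) = fps_to_fls f / fps_to_fls g"
proof -
  have "fps_to_fls (f * inverse g) * fps_to_fls g = fps_to_fls f"
    using inverse_mult_eq_1[OF assms] by (simp add: mult.assoc flip: fls_times_fps_to_fls)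
  moreover have "fps_to_fls g \<noteq> 0" using assms by auto
  ultimately show ?thesis by (simp add: eq_divide_eq)
qed

lemma fps_to_fls_prod: "fps_to_fls (\<Prod>i\<in>S. f i :: 'a::field fps) = (\<Prod>i\<in>S. fps_to_fls (f i))"
  by (induction S rule: infinite_finite_induct) (simp_all add: fls_times_fps_to_fls)

text \<open>The \<open>n\<close>-th coefficient of the exponent of \<open>\<R>\<^sub>0\<close> up to
  \<open>1/n\<close>, with \<open>A = q_*^(2 l1 n)\<close>, \<open>B = q_*^(2 l2 n)\<close>,
  \<open>U = q_*^(-2 m1 n)\<close>, \<open>V = q_*^(2 m2 n)\<close>, \<open>W = q_*^(2n)\<close>.
  The left factors come from \<open>log_E\<close> and \<open>log_F\<close>; \<open>S1\<close> and
  \<open>S2\<close> are the geometric sums that become the two products.\<close>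

lemma imaginary_root_identity:
  fixes A B U V W :: complex
  assumes "A \<noteq> 0" "B \<noteq> 0" "W \<noteq> 0" "W \<noteq> 1" "W + 1 \<noteq> 0"
    and S1: "(W - 1) * S1 = W * (A - U) * (B - V)"
    and S2: "(W - 1) * S2 = (U - inverse A) * (V - inverse B)"
  shows "- ((U + U * inverse W - A - inverse A * inverse W) * (V + V * W - inverse B - B * W)) / (W - inverse W) =
    (A - inverse A) * (B - inverse B) / (W - inverse W) - S1 - S2"
proof -
  have W1: "W - 1 \<noteq> 0" using assms by simp
  have S: "S1 = W * (A - U) * (B - V) / (W - 1)" "S2 = (U - inverse A) * (V - inverse B) / (W - 1)"
    using S1 S2 W1 by (simp_all add: eq_divide_eq mult.commute)
  have fac: "W - inverse W = (W - 1) * (W + 1) / W" using assms(3) by (simp add: field_simps)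
  have nz: "W - inverse W \<noteq> 0" unfolding fac using assms W1 by simp
  have "S1 = W * (A - U) * (B - V) * (W + 1) * inverse W / (W - inverse W)"
    "S2 = (U - inverse A) * (V - inverse B) * (W + 1) * inverse W / (W - inverse W)"
    unfolding S fac using assms W1 by (simp_all add: divide_simps)
  hence "(A - inverse A) * (B - inverse B) / (W - inverse W) - S1 - S2 =
    ((A - inverse A) * (B - inverse B) - W * (A - U) * (B - V) * (W + 1) * inverse W
      - (U - inverse A) * (V - inverse B) * (W + 1) * inverse W) / (W - inverse W)"
    by (simp only: diff_divide_distrib)
  also have "(A - inverse A) * (B - inverse B) - W * (A - U) * (B - V) * (W + 1) * inverse W
      - (U - inverse A) * (V - inverse B) * (W + 1) * inverse W =
      - ((U + U * inverse W - A - inverse A * inverse W) * (V + V * W - inverse B - B * W))"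
    using assms(1-3) by (simp add: field_simps)
  finally show ?thesis ..
qed

context generic_q
begin

lemma P_2n: "n > 0 \<Longrightarrow> P (2 * real n) \<noteq> 1" "n > 0 \<Longrightarrow> P (2 * real n) + 1 \<noteq> 0"
proof -
  assume n: "n > 0"
  show "P (2 * real n) \<noteq> 1" using P_nat_ne_1[of "2 * n"] n by simp
  show "P (2 * real n) + 1 \<noteq> 0"
  proof
    assume "P (2 * real n) + 1 = 0"
    hence "P (2 * real n) = - 1" by (simp add: eq_neg_iff_add_eq_0)
    hence "P (2 * real n) ^ 2 = 1" by simp
    thus False using P_nat_ne_1[of "4 * n"] n by (simp add: P_power mult.commute)
  qed
qed

definition num1 :: "real \<Rightarrow> real \<Rightarrow> nat \<Rightarrow> complex" where
  "num1 l1 l2 k = P (2 * l1 + 2 * l2 - 2 * real k + 2)"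
definition den1 :: "real \<Rightarrow> real \<Rightarrow> nat \<Rightarrow> complex" where
  "den1 m1 m2 k = P (2 * m2 - 2 * m1 + 2 * real k)"
definition num2 :: "real \<Rightarrow> real \<Rightarrow> nat \<Rightarrow> complex" where
  "num2 m1 m2 k = P (2 * m2 - 2 * m1 - 2 * real k)"
definition den2 :: "real \<Rightarrow> real \<Rightarrow> nat \<Rightarrow> complex" where
  "den2 l1 l2 k = P (- 2 * l1 - 2 * l2 + 2 * real k - 2)"

lemma imaginary_exponent:
  assumes n: "n > 0" and a: "l1 + m1 = real a" and c: "l2 + m2 = real c"
  shows "- ((P (- 2 * m1 * real n) + P ((- 2 * m1 - 2) * real n) - P (2 * l1 * real n) - P ((- 2 * l1 - 2) * real n)) *
      (P (2 * m2 * real n) + P ((2 * m2 + 2) * real n) - P (- 2 * l2 * real n) - P ((2 * l2 + 2) * real n)))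
      / (P (2 * real n) - P (- 2 * real n)) =
    (P (2 * l1 * real n) - P (- 2 * l1 * real n)) * (P (2 * l2 * real n) - P (- 2 * l2 * real n))
      / (P (2 * real n) - P (- 2 * real n))
    - (\<Sum>k=1..a. num1 l1 l2 k ^ n - den1 m1 m2 k ^ n) - (\<Sum>k=1..c. num2 m1 m2 k ^ n - den2 l1 l2 k ^ n)"
proof -
  define A B U V W where "A = P (2 * l1 * real n)" and "B = P (2 * l2 * real n)"
    and "U = P (- 2 * m1 * real n)" and "V = P (2 * m2 * real n)" and "W = P (2 * real n)"
  have inv: "inverse A = P (- 2 * l1 * real n)" "inverse B = P (- 2 * l2 * real n)" "inverse W = P (- 2 * real n)"
    unfolding A_def B_def W_def P_minus[symmetric] by simp_all
  have nz: "A \<noteq> 0" "B \<noteq> 0" "U \<noteq> 0" "V \<noteq> 0" "W \<noteq> 0" by (simp_all add: A_def B_def U_def V_def W_def)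
  have W1: "W \<noteq> 1" "W + 1 \<noteq> 0" using P_2n[OF n] by (simp_all add: W_def)
  \<comment> \<open>The numbers of factors, \<open>l1 + m1\<close> and \<open>l2 + m2\<close>, are
    what lets the geometric sums close up in \<open>A\<close>, \<open>B\<close>, \<open>U\<close>,
    \<open>V\<close>.\<close>
  have Wa: "W ^ a = A * inverse U" "W ^ c = B * V"
    unfolding A_def B_def U_def V_def W_def P_minus[symmetric] P_add[symmetric] P_power a[symmetric] c[symmetric]
    by (rule arg_cong[where f = P], simp add: algebra_simps)+
  have pw: "num1 l1 l2 k ^ n = (A * B * W) * inverse W ^ k" "den1 m1 m2 k ^ n = (U * V) * W ^ k"
    "num2 m1 m2 k ^ n = (U * V) * inverse W ^ k" "den2 l1 l2 k ^ n = (inverse A * inverse B * inverse W) * W ^ k" for k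
    unfolding num1_def den1_def num2_def den2_def A_def B_def U_def V_def W_def P_minus[symmetric] P_power P_add[symmetric]
    by (rule arg_cong[where f = P], simp add: algebra_simps)+
  have S1: "(W - 1) * (\<Sum>k=1..a. num1 l1 l2 k ^ n - den1 m1 m2 k ^ n) = W * (A - U) * (B - V)"
    unfolding pw geometric_sum_diff[OF nz(5)] unfolding power_inverse Wa using nz by (simp add: field_simps)
  have S2: "(W - 1) * (\<Sum>k=1..c. num2 m1 m2 k ^ n - den2 l1 l2 k ^ n) = (U - inverse A) * (V - inverse B)"
    unfolding pw geometric_sum_diff[OF nz(5)] unfolding power_inverse Wa using nz by (simp add: field_simps)
  have args: "P ((- 2 * m1 - 2) * real n) = U * inverse W" "P ((- 2 * l1 - 2) * real n) = inverse A * inverse W"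
    "P ((2 * m2 + 2) * real n) = V * W" "P ((2 * l2 + 2) * real n) = B * W"
    unfolding A_def B_def U_def V_def W_def P_minus[symmetric] P_add[symmetric]
    by (rule arg_cong[where f = P], simp add: algebra_simps)+
  show ?thesis
    using imaginary_root_identity[OF nz(1,2,5) W1 S1 S2]
    unfolding args inv(1,2,3)[symmetric] A_def[symmetric] B_def[symmetric] U_def[symmetric] V_def[symmetric] W_def[symmetric] .
qed

text \<open>The denominator factors as \<open>D S\<close>, and each numerator is \<open>D\<close>
  times a \<open>q\<close>-number at \<open>p ^ n\<close>; one \<open>D\<close> survives.\<close>

lemma f_q_coefficient:
  assumes n: "n > 0" and l1: "real s1 = 2 * l1" and l2: "real s2 = 2 * l2"
  shows "(P (2 * l1 * real n) - P (- 2 * l1 * real n)) * (P (2 * l2 * real n) - P (- 2 * l2 * real n))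
          / (P (2 * real n) - P (- 2 * real n)) =
    q_num (p ^ n) \<lfloor>2 * l1\<rfloor> * q_num (p ^ n) \<lfloor>2 * l2\<rfloor> * (p ^ n - inverse (p ^ n)) / (p ^ n + inverse (p ^ n))"
proof -
  define D S where "D = p ^ n - inverse (p ^ n)" and "S = p ^ n + inverse (p ^ n)"
  have nz: "D \<noteq> 0" "S \<noteq> 0" using p_power_ne[OF n] by (simp_all add: D_def S_def)
  have q: "q_num (p ^ n) \<lfloor>2 * l\<rfloor> = (P (2 * l * real n) - P (- 2 * l * real n)) / D" if "real s = 2 * l" for s l
  proof -
    have "\<lfloor>2 * l\<rfloor> = int s" unfolding that[symmetric] by simp
    thus ?thesis
      unfolding q_num_def D_def P_power P_powi by (simp add: that mult_ac)
  qed
  have DS: "P (2 * real n) - P (- 2 * real n) = D * S"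
  proof -
    have "P (2 * real n) = p ^ n * p ^ n" "P (- 2 * real n) = inverse (p ^ n) * inverse (p ^ n)"
      unfolding P_power P_minus[symmetric] P_add[symmetric] by (rule arg_cong[where f = P], simp)+
    thus ?thesis unfolding D_def S_def by (simp only: algebra_simps)
  qed
  show ?thesis
    unfolding q[OF l1] q[OF l2] DS D_def[symmetric] S_def[symmetric] using nz by simp
qed

end

context tensor_modules
begin

definition imag_coeff :: "real \<Rightarrow> real \<Rightarrow> nat \<Rightarrow> complex" where
  "imag_coeff m1 m2 n = of_nat n * (qq b + inverse (qq b))\<^sup>2 / (q_pow b (2 * real n) - q_pow b (- 2 * real n)) *
     ((- 1 / (\<i> * (p - inverse p)) * fps_nth (ev1.log_E m1) n) * (1 / (\<i> * (p - inverse p)) * fps_nth (ev2.log_F m2) n))"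

text \<open>\<open>(q + 1/q)^2\<close> cancels the prefactors of the imaginary root vectors up to
  sign, \<open>\<i>^n \<i>^n\<close> cancels the sign in \<open>q^(2n) - q^(-2n)\<close>, and
  \<open>n\<close> cancels one of the two factors \<open>1/n\<close> of the logarithms.\<close>

lemma imag_coeff_eq:
  assumes n: "n > 0" and a: "l1 + m1 = real a" and c: "l2 + m2 = real c"
  shows "imag_coeff m1 m2 n =
    1 / of_nat n * ((P (2 * l1 * real n) - P (- 2 * l1 * real n)) * (P (2 * l2 * real n) - P (- 2 * l2 * real n))
      / (P (2 * real n) - P (- 2 * real n)))
    - (\<Sum>k=1..a. num1 l1 l2 k ^ n - den1 m1 m2 k ^ n) / of_nat n
    - (\<Sum>k=1..c. num2 m1 m2 k ^ n - den2 l1 l2 k ^ n) / of_nat n"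
proof -
  define r :: complex where "r = of_nat n"
  have r: "r \<noteq> 0" using n by (simp add: r_def)
  define X where "X = P (- 2 * m1 * real n) + P ((- 2 * m1 - 2) * real n) - P (2 * l1 * real n) - P ((- 2 * l1 - 2) * real n)"
  define Y where "Y = P (2 * m2 * real n) + P ((2 * m2 + 2) * real n) - P (- 2 * l2 * real n) - P ((2 * l2 + 2) * real n)"
  define W where "W = P (2 * real n) - P (- 2 * real n)"
  have E: "fps_nth (ev1.log_E m1) n = \<i> ^ n * X / r"
    unfolding ev1.log_E_def X_def r_def using n
    by (simp add: fps_log1m_nth power_mult_distrib P_power add_divide_distrib diff_divide_distrib algebra_simps)
  have F: "fps_nth (ev2.log_F m2) n = \<i> ^ n * Y / r"
    unfolding ev2.log_F_def Y_def r_def using n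
    by (simp add: fps_log1m_nth power_mult_distrib P_power add_divide_distrib diff_divide_distrib algebra_simps)
  define d where "d = \<i> * (p - inverse p)"
  have d: "d \<noteq> 0" unfolding d_def using p_minus_nonzero by simp
  have q: "q_pow b (2 * real n) - q_pow b (- 2 * real n) = (- 1) ^ n * W"
    by (simp add: q_pow_even q_pow_minus_even W_def right_diff_distrib del: mult_minus_left)
  have ii: "\<i> ^ n * \<i> ^ n = (- 1) ^ n" by (simp flip: power_mult_distrib)
  have "imag_coeff m1 m2 n = r * d ^ 2 / ((- 1) ^ n * W) * ((- 1 / d * (\<i> ^ n * X / r)) * (1 / d * (\<i> ^ n * Y / r)))"
    unfolding imag_coeff_def E F q qq_plus d_def[symmetric] r_def[symmetric] ..
  also have "\<dots> = - (X * Y) / W / r * (\<i> ^ n * \<i> ^ n / (- 1) ^ n)"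
    using r d by (simp add: power2_eq_square mult_ac)
  also have "\<dots> = 1 / r * (- (X * Y) / W)"
    unfolding ii by simp
  finally show ?thesis
    unfolding X_def Y_def W_def imaginary_exponent[OF n a c] r_def
    by (simp add: diff_divide_distrib)
qed

lemma R_zero_exponent:
  assumes i: "i \<in> I" and j: "((m1, e1), (m2, e2)) \<in> I"
  shows "sum_pos (\<lambda>n. fls_const (of_nat n * (qq b + inverse (qq b))\<^sup>2 / (q_pow b (2 * real n) - q_pow b (- 2 * real n)))
          * stensor (E_imag b (basis l1) ev1.E0 ev1.E1 n) (F_imag b (basis l2) ev2.F0 ev2.F1 n) i ((m1, e1), (m2, e2))) =
    (if i = ((m1, e1), (m2, e2)) then sum_pos (\<lambda>n. fls_const (imag_coeff m1 m2 n) * fls_X ^ (2 * n)) else 0)"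
proof -
  obtain m1' e1' m2' e2' where ii: "i = ((m1', e1'), (m2', e2'))" by (metis surj_pair)
  have B: "(m1, e1) \<in> basis l1" "(m1', e1') \<in> basis l1" "(m2, e2) \<in> basis l2" "(m2', e2') \<in> basis l2"
    using i j by (auto simp: ii)
  note E = hopD[OF ev1.hop_E_imag B(1,2)] and F = hopD[OF ev2.hop_F_imag B(3,4)]
  show ?thesis
  proof (cases "i = ((m1, e1), (m2, e2))")
    case True
    hence e: "m1' = m1 + 0" "e1' = flip_if False e1" "m2' = m2 + 0" "e2' = flip_if False e2" by (auto simp: ii)
    have "fls_const (of_nat n * (qq b + inverse (qq b))\<^sup>2 / (q_pow b (2 * real n) - q_pow b (- 2 * real n)))
          * stensor (E_imag b (basis l1) ev1.E0 ev1.E1 n) (F_imag b (basis l2) ev2.F0 ev2.F1 n) i ((m1, e1), (m2, e2)) =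
        fls_const (imag_coeff m1 m2 n) * fls_X ^ (2 * n)" for n
    proof -
      have sgn: "(- 1 :: laurent) ^ ((e2' + e2) * e1) = 1" using e(4) by simp
      have st: "stensor (E_imag b (basis l1) ev1.E0 ev1.E1 n) (F_imag b (basis l2) ev2.F0 ev2.F1 n) i ((m1, e1), (m2, e2)) =
          ((lam1 ^ 2) ^ n * fls_const (- 1 / (\<i> * (p - inverse p)) * fps_nth (ev1.log_E m1) n)) *
          ((inverse lam2 ^ 2) ^ n * fls_const (1 / (\<i> * (p - inverse p)) * fps_nth (ev2.log_F m2) n))"
        unfolding stensor_def ii prod.case sgn E[of n] F[of n] using e by simp
      have lam: "(lam1 ^ 2) ^ n * (inverse lam2 ^ 2) ^ n = fls_X ^ (2 * n)"
        unfolding power_mult[symmetric] by (rule lam_ratio)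
      show ?thesis
        unfolding st lam[symmetric] imag_coeff_def fls_const_mult_const[symmetric] by (simp only: mult_ac)
    qed
    thus ?thesis using True by simp
  next
    case False
    hence ne: "\<not> (m1' = m1 + 0 \<and> e1' = flip_if False e1) \<or> \<not> (m2' = m2 + 0 \<and> e2' = flip_if False e2)"
      by (auto simp: ii)
    have "stensor (E_imag b (basis l1) ev1.E0 ev1.E1 n) (F_imag b (basis l2) ev2.F0 ev2.F1 n) i ((m1, e1), (m2, e2)) = 0" for n
      unfolding stensor_def ii prod.case E[of n] F[of n] using ne by auto
    thus ?thesis using False by (simp add: sum_pos_def)
  qed
qed

definition f_exponent :: "complex fps" where
  "f_exponent = Abs_fps (\<lambda>k. if even k \<and> k > 0 then 1 / of_nat (k div 2) *
     ((P (2 * l1 * real (k div 2)) - P (- 2 * l1 * real (k div 2))) * (P (2 * l2 * real (k div 2)) - P (- 2 * l2 * real (k div 2)))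
      / (P (2 * real (k div 2)) - P (- 2 * real (k div 2)))) else 0)"

lemma f_q_eq:
  "exp_laurent (sum_pos (\<lambda>n. fls_const (1 / of_nat n) * (lam1 / lam2) ^ (2 * n) *
      fls_const ((P (2 * l1 * real n) - P (- 2 * l1 * real n)) * (P (2 * l2 * real n) - P (- 2 * l2 * real n))
          / (P (2 * real n) - P (- 2 * real n))))) = fps_to_fls (fps_Exp f_exponent)"
proof -
  have "sum_pos (\<lambda>n. fls_const (1 / of_nat n) * (lam1 / lam2) ^ (2 * n) *
      fls_const ((P (2 * l1 * real n) - P (- 2 * l1 * real n)) * (P (2 * l2 * real n) - P (- 2 * l2 * real n))
          / (P (2 * real n) - P (- 2 * real n)))) =
    sum_pos (\<lambda>n. fls_const (1 / of_nat n * ((P (2 * l1 * real n) - P (- 2 * l1 * real n)) * (P (2 * l2 * real n) - P (- 2 * l2 * real n))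
          / (P (2 * real n) - P (- 2 * real n)))) * fls_X ^ (2 * n))"
    unfolding formal fls_const_mult_const[symmetric] by (simp only: mult_ac)
  also have "\<dots> = fps_to_fls f_exponent"
    unfolding sum_pos_even f_exponent_def ..
  finally show ?thesis by (simp add: exp_laurent_fps f_exponent_def)
qed

text \<open>At degree \<open>2n\<close> the series \<open>ln (1 - c X^2)\<close> has coefficient
  \<open>-c^n / n\<close>; each term of the finite sums in \<open>imag_coeff_eq\<close> is thus the
  logarithm of one factor of the products.\<close>

lemma exponent_decomposition:
  assumes a: "l1 + m1 = real a" and c: "l2 + m2 = real c"
  shows "Abs_fps (\<lambda>k. if even k \<and> k > 0 then imag_coeff m1 m2 (k div 2) else 0) =
    f_exponent + (\<Sum>k=1..a. fps_log1m_sq (num1 l1 l2 k) - fps_log1m_sq (den1 m1 m2 k))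
      + (\<Sum>k=1..c. fps_log1m_sq (num2 m1 m2 k) - fps_log1m_sq (den2 l1 l2 k))"
proof (rule fps_ext)
  fix k
  show "fps_nth (Abs_fps (\<lambda>k. if even k \<and> k > 0 then imag_coeff m1 m2 (k div 2) else 0)) k =
    fps_nth (f_exponent + (\<Sum>k=1..a. fps_log1m_sq (num1 l1 l2 k) - fps_log1m_sq (den1 m1 m2 k))
      + (\<Sum>k=1..c. fps_log1m_sq (num2 m1 m2 k) - fps_log1m_sq (den2 l1 l2 k))) k"
  proof (cases "even k \<and> k > 0")
    case True
    hence n: "k div 2 > 0" by auto
    have "(\<Sum>r\<in>S. - (f r ^ n) / of_nat n - - (g r ^ n) / of_nat n) = - ((\<Sum>r\<in>S. f r ^ n - g r ^ n) / of_nat n)"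
      for S :: "nat set" and f g :: "nat \<Rightarrow> complex" and n
      unfolding sum_divide_distrib sum_negf[symmetric] by (intro sum.cong) (simp_all add: diff_divide_distrib)
    thus ?thesis
      using True
      by (simp add: f_exponent_def fps_sum_nth fps_log1m_sq_nth imag_coeff_eq[OF n a c])
  next
    case False
    hence "fps_nth (fps_log1m_sq x) k = 0" for x by (simp only: fps_log1m_sq_nth if_False)
    thus ?thesis using False by (simp only: f_exponent_def fps_sum_nth fps_nth_Abs_fps fps_add_nth fps_sub_nth if_False) simp
  qed
qed

lemma R_zero_formula:
  assumes i: "i \<in> I" and j: "((m1, e1), (m2, e2)) \<in> I"
  shows "R_zero b l1 l2 lam1 lam2 i ((m1, e1), (m2, e2)) =
    (if i = ((m1, e1), (m2, e2)) then
      fps_to_fls (fps_Exp f_exponent)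
        * (\<Prod>k=1..nat \<lfloor>l1 + m1\<rfloor>. (lam2\<^sup>2 - lam1\<^sup>2 * fls_const (num1 l1 l2 k)) / (lam2\<^sup>2 - lam1\<^sup>2 * fls_const (den1 m1 m2 k)))
        * (\<Prod>k=1..nat \<lfloor>l2 + m2\<rfloor>. (lam2\<^sup>2 - lam1\<^sup>2 * fls_const (num2 m1 m2 k)) / (lam2\<^sup>2 - lam1\<^sup>2 * fls_const (den2 l1 l2 k)))
     else 0)"
proof -
  have w: "m1 \<in> weights l1" "m2 \<in> weights l2" using j by (auto simp: basis_def)
  obtain a where a: "l1 + m1 = real a" using weights_natE[OF l1 w(1)] by metis
  obtain c where c: "l2 + m2 = real c" using weights_natE[OF l2 w(2)] by metis
  define d :: "label \<times> label \<Rightarrow> laurent" where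
    "d = (\<lambda>((m1, e1), (m2, e2)). sum_pos (\<lambda>n. fls_const (imag_coeff m1 m2 n) * fls_X ^ (2 * n)))"
  have "R_zero b l1 l2 lam1 lam2 i ((m1, e1), (m2, e2)) =
    (if i = ((m1, e1), (m2, e2)) then (\<Sum>n. d ((m1, e1), (m2, e2)) ^ n / fact n) else 0)"
    unfolding R_zero_def
  proof (rule exp_op_diag[OF sh.finite_I _ i j])
    fix i' j' assume ij: "i' \<in> I" "j' \<in> I"
    obtain m1 e1 m2 e2 where j': "j' = ((m1, e1), (m2, e2))" by (metis surj_pair)
    show "sum_pos (\<lambda>n. fls_const (of_nat n * (qq b + inverse (qq b))\<^sup>2 / (q_pow b (2 * real n) - q_pow b (- 2 * real n)))
          * stensor (E_imag b (basis l1) ev1.E0 ev1.E1 n) (F_imag b (basis l2) ev2.F0 ev2.F1 n) i' j') = (if i' = j' then d j' else 0)"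
      using R_zero_exponent[OF ij(1), of m1 e1 m2 e2] ij(2) unfolding j' d_def prod.case by blast
  qed
  also have "(\<Sum>n. d ((m1, e1), (m2, e2)) ^ n / fact n) = exp_laurent (d ((m1, e1), (m2, e2)))"
    by (simp only: exp_laurent_def)
  also have "\<dots> = fps_to_fls (fps_Exp (Abs_fps (\<lambda>k. if even k \<and> k > 0 then imag_coeff m1 m2 (k div 2) else 0)))"
    unfolding d_def prod.case sum_pos_even by (rule exp_laurent_fps) simp
  also have "\<dots> = fps_to_fls (fps_Exp f_exponent)
      * (\<Prod>k=1..a. (lam2\<^sup>2 - lam1\<^sup>2 * fls_const (num1 l1 l2 k)) / (lam2\<^sup>2 - lam1\<^sup>2 * fls_const (den1 m1 m2 k)))
      * (\<Prod>k=1..c. (lam2\<^sup>2 - lam1\<^sup>2 * fls_const (num2 m1 m2 k)) / (lam2\<^sup>2 - lam1\<^sup>2 * fls_const (den2 l1 l2 k)))"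
  proof -
    have 0: "fps_nth (fps_log1m_sq x) 0 = 0" for x by (simp add: fps_log1m_sq_nth)
    have f0: "fps_nth f_exponent 0 = 0" by (simp add: f_exponent_def)
    have s0: "fps_nth (\<Sum>k=1..a. fps_log1m_sq (f k) - fps_log1m_sq (g k)) 0 = 0" for a :: nat and f g
      by (simp add: fps_sum_nth 0)
    have quot: "fps_to_fls (fps_Exp (fps_log1m_sq x - fps_log1m_sq y)) =
        (lam2\<^sup>2 - lam1\<^sup>2 * fls_const x) / (lam2\<^sup>2 - lam1\<^sup>2 * fls_const y)" for x y
    proof -
      have L: "fps_to_fls (1 - fps_const x * fps_X ^ 2) = 1 - fls_X ^ 2 * fls_const x" for x :: complex
        by (simp add: fls_times_fps_to_fls fps_to_fls_power mult.commute)
      have lf: "lam2\<^sup>2 - lam1\<^sup>2 * fls_const x = lam2\<^sup>2 * (1 - fls_X ^ 2 * fls_const x)" for x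
        using lam_factor[of x] by (simp only: mult.commute[of "lam1\<^sup>2"])
      have "fps_to_fls (fps_Exp (fps_log1m_sq x - fps_log1m_sq y)) =
          fps_to_fls ((1 - fps_const x * fps_X ^ 2) * inverse (1 - fps_const y * fps_X ^ 2))"
        by (simp only: fps_Exp_diff[OF 0 0] fps_Exp_log1m_sq)
      also have "\<dots> = (1 - fls_X ^ 2 * fls_const x) / (1 - fls_X ^ 2 * fls_const y)"
        unfolding L[symmetric] by (rule fps_to_fls_divide_unit) simp
      also have "\<dots> = (lam2\<^sup>2 - lam1\<^sup>2 * fls_const x) / (lam2\<^sup>2 - lam1\<^sup>2 * fls_const y)"
        unfolding lf using lam2 by simp
      finally show ?thesis .
    qed
    have E: "fps_to_fls (fps_Exp (\<Sum>k=1..a. fps_log1m_sq (f k) - fps_log1m_sq (g k))) =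
        (\<Prod>k=1..a. (lam2\<^sup>2 - lam1\<^sup>2 * fls_const (f k)) / (lam2\<^sup>2 - lam1\<^sup>2 * fls_const (g k)))" for a :: nat and f g
      by (subst fps_Exp_sum) (simp_all add: 0 fps_to_fls_prod quot)
    have "fps_nth (f_exponent + (\<Sum>k=1..a. fps_log1m_sq (num1 l1 l2 k) - fps_log1m_sq (den1 m1 m2 k))) 0 = 0"
      unfolding fps_add_nth f0 s0 by simp
    thus ?thesis
      unfolding exponent_decomposition[OF a c]
      by (simp only: fps_Exp_add f0 s0 fls_times_fps_to_fls E)
  qed
  finally show ?thesis unfolding a c floor_of_nat nat_int .
qed

section \<open>The real root coefficients in their final form\<close>

lemma R_pos_coefficient:
  assumes "(m1, e1) \<in> basis l1" "(m2, e2) \<in> basis l2" "(m1', e1') \<in> basis l1" "(m2', e2') \<in> basis l2"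
  shows "(m1' - m1 \<noteq> m2 - m2' \<or> (m1' - m1 = m2 - m2' \<and> m2 - m2' < 0) \<longrightarrow>
          R_pos b l1 l2 lam1 lam2 ((m1', e1'), (m2', e2')) ((m1, e1), (m2, e2)) = 0) \<and>
       (\<forall>n::nat. m1' - m1 = real n \<and> m2 - m2' = real n \<longrightarrow>
          R_pos b l1 l2 lam1 lam2 ((m1', e1'), (m2', e2')) ((m1, e1), (m2, e2)) =
          (if e1' = (e1 + n) mod 2 \<and> e2' = (e2 + n) mod 2 then
             fls_const ((- 1) powi (int n * (int e1 + int e2 - 1)) * (qs b - inverse (qs b)) ^ n)
             * (lam1 * lam2) ^ n
             / (\<Prod>k=1..n. lam2\<^sup>2 - fls_const (qs_pow b (2 * m2 - 2 * m1 - 2 * real k)) * lam1\<^sup>2)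
             * fls_const (q_fact (qs b) (nat \<lfloor>l1 - m1\<rfloor>)
                 / (floor_fact (qs b) n * q_fact (qs b) (nat \<lfloor>l1 - m1 - real n\<rfloor>)))
             * fls_const (q_fact (qs b) (nat \<lfloor>l2 + m2\<rfloor>)
                 / q_fact (qs b) (nat \<lfloor>l2 + m2 - real n\<rfloor>))
           else 0))"
proof (intro conjI impI allI)
  have j: "((m1, e1), (m2, e2)) \<in> I" and i: "((m1', e1'), (m2', e2')) \<in> I" using assms by auto
  show "R_pos b l1 l2 lam1 lam2 ((m1', e1'), (m2', e2')) ((m1, e1), (m2, e2)) = 0"
    if "m1' - m1 \<noteq> m2 - m2' \<or> (m1' - m1 = m2 - m2' \<and> m2 - m2' < 0)"
    using R_pos_formula(1)[OF j i] that by blast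
  fix n :: nat assume n: "m1' - m1 = real n \<and> m2 - m2' = real n"
  hence w: "m1 + real n = m1'" "m2 - real n = m2'" by auto
  have co: "coeffs \<tau>_pos n ((m1, e1), (m2, e2)) =
    fls_const ((- 1) powi (int n * (int e1 + int e2 - 1)) * (qs b - inverse (qs b)) ^ n)
           * (lam1 * lam2) ^ n
           / (\<Prod>k=1..n. lam2\<^sup>2 - fls_const (qs_pow b (2 * m2 - 2 * m1 - 2 * real k)) * lam1\<^sup>2)
           * fls_const (q_fact (qs b) (nat \<lfloor>l1 - m1\<rfloor>)
               / (floor_fact (qs b) n * q_fact (qs b) (nat \<lfloor>l1 - m1 - real n\<rfloor>)))
           * fls_const (q_fact (qs b) (nat \<lfloor>l2 + m2\<rfloor>)
               / q_fact (qs b) (nat \<lfloor>l2 + m2 - real n\<rfloor>))"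
    by (rule coeffs_pos_formula) (use assms w in \<open>auto simp: basis_def\<close>)
  show "R_pos b l1 l2 lam1 lam2 ((m1', e1'), (m2', e2')) ((m1, e1), (m2, e2)) =
        (if e1' = (e1 + n) mod 2 \<and> e2' = (e2 + n) mod 2 then
           fls_const ((- 1) powi (int n * (int e1 + int e2 - 1)) * (qs b - inverse (qs b)) ^ n)
           * (lam1 * lam2) ^ n
           / (\<Prod>k=1..n. lam2\<^sup>2 - fls_const (qs_pow b (2 * m2 - 2 * m1 - 2 * real k)) * lam1\<^sup>2)
           * fls_const (q_fact (qs b) (nat \<lfloor>l1 - m1\<rfloor>)
               / (floor_fact (qs b) n * q_fact (qs b) (nat \<lfloor>l1 - m1 - real n\<rfloor>)))
           * fls_const (q_fact (qs b) (nat \<lfloor>l2 + m2\<rfloor>)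
               / q_fact (qs b) (nat \<lfloor>l2 + m2 - real n\<rfloor>))
         else 0)"
    unfolding R_pos_formula(2)[OF j i conjunct1[OF n] conjunct2[OF n]] co ..
qed

lemma R_neg_coefficient:
  assumes "(m1, e1) \<in> basis l1" "(m2, e2) \<in> basis l2" "(m1', e1') \<in> basis l1" "(m2', e2') \<in> basis l2"
  shows "(m1' - m1 \<noteq> m2 - m2' \<or> (m1' - m1 = m2 - m2' \<and> m2 - m2' > 0) \<longrightarrow>
          R_neg b l1 l2 lam1 lam2 ((m1', e1'), (m2', e2')) ((m1, e1), (m2, e2)) = 0) \<and>
       (\<forall>n::nat. m1 - m1' = real n \<and> m2' - m2 = real n \<longrightarrow>
          R_neg b l1 l2 lam1 lam2 ((m1', e1'), (m2', e2')) ((m1, e1), (m2, e2)) =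
          (if e1' = (e1 + n) mod 2 \<and> e2' = (e2 + n) mod 2 then
             fls_const ((- 1) powi (int n * (int e1 + int e2 - 1)) * (qs b - inverse (qs b)) ^ n)
             * (lam1 * lam2) ^ n
             / (\<Prod>k=1..n. lam2\<^sup>2
                 - fls_const (qs_pow b (2 * m2 - 2 * m1 + 2 * (real k + real n - 1))) * lam1\<^sup>2)
             * fls_const (q_fact (qs b) (nat \<lfloor>l1 + m1\<rfloor>)
                 / (floor_fact (qs b) n * q_fact (qs b) (nat \<lfloor>l1 + m1 - real n\<rfloor>)))
             * fls_const (q_fact (qs b) (nat \<lfloor>l2 - m2\<rfloor>)
                 / q_fact (qs b) (nat \<lfloor>l2 - m2 - real n\<rfloor>))
           else 0))"
proof (intro conjI impI allI)
  have j: "((m1, e1), (m2, e2)) \<in> I" and i: "((m1', e1'), (m2', e2')) \<in> I" using assms by auto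
  show "R_neg b l1 l2 lam1 lam2 ((m1', e1'), (m2', e2')) ((m1, e1), (m2, e2)) = 0"
    if "m1' - m1 \<noteq> m2 - m2' \<or> (m1' - m1 = m2 - m2' \<and> m2 - m2' > 0)"
    using R_neg_formula(1)[OF j i] that by blast
  fix n :: nat assume n: "m1 - m1' = real n \<and> m2' - m2 = real n"
  hence w: "m1 - real n = m1'" "m2 + real n = m2'" by auto
  have co: "coeffs \<tau>_neg n ((m1 - real n, (e1 + n) mod 2), (m2 + real n, (e2 + n) mod 2)) =
    fls_const ((- 1) powi (int n * (int e1 + int e2 - 1)) * (qs b - inverse (qs b)) ^ n)
           * (lam1 * lam2) ^ n
           / (\<Prod>k=1..n. lam2\<^sup>2
               - fls_const (qs_pow b (2 * m2 - 2 * m1 + 2 * (real k + real n - 1))) * lam1\<^sup>2)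
           * fls_const (q_fact (qs b) (nat \<lfloor>l1 + m1\<rfloor>)
               / (floor_fact (qs b) n * q_fact (qs b) (nat \<lfloor>l1 + m1 - real n\<rfloor>)))
           * fls_const (q_fact (qs b) (nat \<lfloor>l2 - m2\<rfloor>)
               / q_fact (qs b) (nat \<lfloor>l2 - m2 - real n\<rfloor>))"
    by (rule coeffs_neg_formula) (use assms w in \<open>auto simp: basis_def\<close>)
  show "R_neg b l1 l2 lam1 lam2 ((m1', e1'), (m2', e2')) ((m1, e1), (m2, e2)) =
        (if e1' = (e1 + n) mod 2 \<and> e2' = (e2 + n) mod 2 then
           fls_const ((- 1) powi (int n * (int e1 + int e2 - 1)) * (qs b - inverse (qs b)) ^ n)
           * (lam1 * lam2) ^ n
           / (\<Prod>k=1..n. lam2\<^sup>2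
               - fls_const (qs_pow b (2 * m2 - 2 * m1 + 2 * (real k + real n - 1))) * lam1\<^sup>2)
           * fls_const (q_fact (qs b) (nat \<lfloor>l1 + m1\<rfloor>)
               / (floor_fact (qs b) n * q_fact (qs b) (nat \<lfloor>l1 + m1 - real n\<rfloor>)))
           * fls_const (q_fact (qs b) (nat \<lfloor>l2 - m2\<rfloor>)
               / q_fact (qs b) (nat \<lfloor>l2 - m2 - real n\<rfloor>))
         else 0)"
  proof (cases "e1' = (e1 + n) mod 2 \<and> e2' = (e2 + n) mod 2")
    case True
    show ?thesis
      unfolding R_neg_formula(2)[OF j i conjunct1[OF n] conjunct2[OF n]] if_P[OF True] co[symmetric] w
      by (simp only: True[THEN conjunct1] True[THEN conjunct2])
  next
    case False
    show ?thesis
      unfolding R_neg_formula(2)[OF j i conjunct1[OF n] conjunct2[OF n]] if_not_P[OF False] ..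
  qed
qed

end


theorem theoremA4:
  fixes b :: complex and s1 s2 :: nat and l1 l2 :: real
    and lam1 lam2 f_q :: "complex fls"
    and Hd1 Hd2 :: "(label, complex) oper"
  assumes not_root_of_unity: "\<forall>n::nat. n > 0 \<longrightarrow> qs b ^ n \<noteq> 1"
    and s1: "real s1 = 2 * l1" and s2: "real s2 = 2 * l2"
    and lam1: "lam1 \<noteq> 0" and lam2: "lam2 \<noteq> 0"
    and formal: "lam1 / lam2 = fls_X"
    and f_q: "f_q = exp_laurent (sum_pos (\<lambda>n.
      fls_const (1 / of_nat n) * (lam1 / lam2) ^ (2 * n)
      * fls_const ((qs_pow b (2 * l1 * real n) - qs_pow b (- 2 * l1 * real n))
          * (qs_pow b (2 * l2 * real n) - qs_pow b (- 2 * l2 * real n))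
          / (qs_pow b (2 * real n) - qs_pow b (- 2 * real n)))))"
  shows
    "\<comment> \<open>(1)\<close>
    (\<forall>(m1, e1) \<in> basis l1. \<forall>(m2, e2) \<in> basis l2. \<forall>(m1', e1') \<in> basis l1. \<forall>(m2', e2') \<in> basis l2.
       (m1' - m1 \<noteq> m2 - m2' \<or> (m1' - m1 = m2 - m2' \<and> m2 - m2' < 0) \<longrightarrow>
          R_pos b l1 l2 lam1 lam2 ((m1', e1'), (m2', e2')) ((m1, e1), (m2, e2)) = 0) \<and>
       (\<forall>n::nat. m1' - m1 = real n \<and> m2 - m2' = real n \<longrightarrow>
          R_pos b l1 l2 lam1 lam2 ((m1', e1'), (m2', e2')) ((m1, e1), (m2, e2)) =
          (if e1' = (e1 + n) mod 2 \<and> e2' = (e2 + n) mod 2 then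
             fls_const ((- 1) powi (int n * (int e1 + int e2 - 1)) * (qs b - inverse (qs b)) ^ n)
             * (lam1 * lam2) ^ n
             / (\<Prod>k=1..n. lam2\<^sup>2 - fls_const (qs_pow b (2 * m2 - 2 * m1 - 2 * real k)) * lam1\<^sup>2)
             * fls_const (q_fact (qs b) (nat \<lfloor>l1 - m1\<rfloor>)
                 / (floor_fact (qs b) n * q_fact (qs b) (nat \<lfloor>l1 - m1 - real n\<rfloor>)))
             * fls_const (q_fact (qs b) (nat \<lfloor>l2 + m2\<rfloor>)
                 / q_fact (qs b) (nat \<lfloor>l2 + m2 - real n\<rfloor>))
           else 0)))
   \<and> \<comment> \<open>(2)\<close>
    (\<forall>(m1, e1) \<in> basis l1. \<forall>(m2, e2) \<in> basis l2. \<forall>(m1', e1') \<in> basis l1. \<forall>(m2', e2') \<in> basis l2.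
       (m1' - m1 \<noteq> m2 - m2' \<or> (m1' - m1 = m2 - m2' \<and> m2 - m2' > 0) \<longrightarrow>
          R_neg b l1 l2 lam1 lam2 ((m1', e1'), (m2', e2')) ((m1, e1), (m2, e2)) = 0) \<and>
       (\<forall>n::nat. m1 - m1' = real n \<and> m2' - m2 = real n \<longrightarrow>
          R_neg b l1 l2 lam1 lam2 ((m1', e1'), (m2', e2')) ((m1, e1), (m2, e2)) =
          (if e1' = (e1 + n) mod 2 \<and> e2' = (e2 + n) mod 2 then
             fls_const ((- 1) powi (int n * (int e1 + int e2 - 1)) * (qs b - inverse (qs b)) ^ n)
             * (lam1 * lam2) ^ n
             / (\<Prod>k=1..n. lam2\<^sup>2
                 - fls_const (qs_pow b (2 * m2 - 2 * m1 + 2 * (real k + real n - 1))) * lam1\<^sup>2)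
             * fls_const (q_fact (qs b) (nat \<lfloor>l1 + m1\<rfloor>)
                 / (floor_fact (qs b) n * q_fact (qs b) (nat \<lfloor>l1 + m1 - real n\<rfloor>)))
             * fls_const (q_fact (qs b) (nat \<lfloor>l2 - m2\<rfloor>)
                 / q_fact (qs b) (nat \<lfloor>l2 - m2 - real n\<rfloor>))
           else 0)))
   \<and> \<comment> \<open>(3)\<close>
    (\<forall>(m1, e1) \<in> basis l1. \<forall>(m2, e2) \<in> basis l2. \<forall>i \<in> basis l1 \<times> basis l2.
       R_zero b l1 l2 lam1 lam2 i ((m1, e1), (m2, e2)) =
       (if i = ((m1, e1), (m2, e2)) then
          f_q
          * (\<Prod>k=1..nat \<lfloor>l1 + m1\<rfloor>.
               (lam2\<^sup>2 - lam1\<^sup>2 * fls_const (qs_pow b (2 * l1 + 2 * l2 - 2 * real k + 2)))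
               / (lam2\<^sup>2 - lam1\<^sup>2 * fls_const (qs_pow b (2 * m2 - 2 * m1 + 2 * real k))))
          * (\<Prod>k=1..nat \<lfloor>l2 + m2\<rfloor>.
               (lam2\<^sup>2 - lam1\<^sup>2 * fls_const (qs_pow b (2 * m2 - 2 * m1 - 2 * real k)))
               / (lam2\<^sup>2 - lam1\<^sup>2 * fls_const (qs_pow b (- 2 * l1 - 2 * l2 + 2 * real k - 2))))
        else 0))
   \<and> f_q = exp_laurent (sum_pos (\<lambda>n.
        fls_const (1 / of_nat n) * (lam1 / lam2) ^ (2 * n)
        * fls_const (q_num (qs b ^ n) \<lfloor>2 * l1\<rfloor> * q_num (qs b ^ n) \<lfloor>2 * l2\<rfloor>
            * (qs b ^ n - inverse (qs b ^ n)) / (qs b ^ n + inverse (qs b ^ n)))))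
   \<and> \<comment> \<open>(4)\<close>
    (\<forall>(m1, e1) \<in> basis l1. \<forall>(m2, e2) \<in> basis l2. \<forall>i \<in> basis l1 \<times> basis l2.
       Q_op b l1 l2 Hd1 Hd2 i ((m1, e1), (m2, e2)) =
       (if i = ((m1, e1), (m2, e2)) then fls_const ((- 1) ^ (e1 * e2) * qs_pow b (2 * m1 * m2))
        else 0))"
proof -
  interpret tensor_modules b s1 s2 l1 l2 lam1 lam2
    using assms by unfold_locales auto
  show ?thesis
  proof (intro conjI, goal_cases)
    case 1
    show ?case by (intro ballI case_prodI2, rule R_pos_coefficient) simp_all
  next
    case 2
    show ?case by (intro ballI case_prodI2, rule R_neg_coefficient) simp_all
  next
    case 3
    show ?case
      by (intro ballI case_prodI2)
        (simp only: f_q f_q_eq R_zero_formula num1_def den1_def num2_def den2_def mem_Times_iff fst_conv snd_conv simp_thms)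
  next
    case 4
    show ?case
      unfolding f_q
      by (rule arg_cong[where f = exp_laurent], rule sum_pos_cong) (simp only: f_q_coefficient[OF _ s1 s2])
  next
    case 5
    show ?case
      by (intro ballI case_prodI2) (simp only: Q_op_eq[OF s1 s2] mem_Times_iff fst_conv snd_conv simp_thms)
  qed
qed

end
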